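(* Let $\mathcal C$ be a strict monoidal category with coequalizers, $\mathcal D$ a right $\mathcal C$-category with coequalizers, and $(A,X)$ a cowreath in $\mathcal C$ with structure morphisms $\psi,\delta,f$, such that $A$ and $X$ are (left) $\mathcal D$-coflat and left coflat objects of $\mathcal C$. Then the category $\mathcal D^{\mathfrak C}$ of right corepresentations in $\mathcal D$ over the $A$-coring $\mathfrak C=A\otimes X$ is isomorphic to the category $\mathcal D(\psi,\delta,f)_A^X$ of right generalized entwined modules in $\mathcal D$ over $(A,X)$.
   Context: Identity morphisms in composites are denoted by the object. $A$ is an algebra with multiplication $m_A$ and unit $\eta_A$. A cowreath $(A,X)$ in $\mathcal C$: an algebra $A$, an object $X$, and morphisms $\psi:X\otimes A\to A\otimes X$, $\delta:X\to A\otimes X\otimes X$, $f:X\to A$ satisfying $\psi(X\otimes m_A)=(m_A\otimes X)(A\otimes\psi)(\psi\otimes A)$, $\psi(X\otimes\eta_A)=\eta_A\otimes X$; $(m_A\otimes X\otimes X)(A\otimes\delta)\psi=(m_A\otimes X\otimes X)(A\otimes\psi\otimes X)(A\otimes X\otimes\psi)(\delta\otimes A)$; $(m_A\otimes X^{\otimes3})(A\otimes\psi\otimes X^{\otimes2})(A\otimes X\otimes\delta)\delta=(m_A\otimes X^{\otimes3})(A\otimes\delta\otimes X)\delta$; $m_A(A\otimes f)\psi=m_A(f\otimes A)$; $(m_A\otimes X)(A\otimes f\otimes X)\delta=\eta_A\otimes X=(m_A\otimes X)(A\otimes\psi)(A\otimes X\otimes f)\delta$. Right $\mathcal C$-category (taken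 strict): a category $\mathcal D$ with a functor $\diamond:\mathcal D\times\mathcal C\to\mathcal D$, $(M\diamond X)\diamond Y=M\diamond(X\otimes Y)$, $M\diamond\underline 1=M$. $\mathcal D_A$ is the category of right modules $(M,\nu_M:M\diamond A\to M)$ in $\mathcal D$ over $A$. For $M\in\mathcal D_A$ and a left $A$-module $Y$, $q_{M,Y}:M\diamond Y\to M\diamond_AY$ is the coequalizer of the two morphisms $M\diamond A\diamond Y\rightrightarrows M\diamond Y$ ($\otimes_A$ when $\mathcal D=\mathcal C$). $X$ is left coflat (resp. $\mathcal D$-coflat) if $-\otimes X$ on $\mathcal C$ (resp. $-\diamond X$ on $\mathcal D$) preserves coequalizers. A left $A$-module $Y$ is $\mathcal D$-robust if $(M\diamond Z)\diamond_AY\to M\diamond(Z\otimes_AY)$ is an isomorphism for all $M\in\mathcal D$, $Z\in\mathcal C_A$; left robust is the case $\mathcal D=\mathcal C$. The $A$-bimodules that are left coflat, $\mathcal D$-coflat, left robust and $\mathcal D$-robust form a monoidal category ${}^{\mathcal D!}_A\mathcal C_A$ under $\otimes_A$ (unit $A$), and $\mathcal D_A$ is a right ${}^{\mathcal D!}_A\mathcal C_A$-category via $\diamond_A$. An $A$-coring compatible with $\mathcal D$ is a coalgebra $\mathfrak C$ in ${}^{\mathcal D!}_A\mathcal C_A$; a right corepresentation in $\mathcal D$ over it is $M\in\mathcal D_A$ with a coassociative counital coaction $M\to M\diamond_A\mathfrak C$ in $\mathcal D_A$; morphisms are $\mathfrak C$-colinear morphisms of $\mathcal D_A$. The $A$-coring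 $\mathfrak C=A\otimes X$ of the cowreath has left action $m_A\otimes X$, right action $(m_A\otimes X)(A\otimes\psi)$, comultiplication $\Upsilon^{-1}(m_A\otimes X\otimes X)(A\otimes\delta)$, where $\Upsilon:\mathfrak C\otimes_A\mathfrak C\to\mathfrak C\otimes X=A\otimes X\otimes X$ is the canonical isomorphism induced by the right $A$-action of $\mathfrak C$, and counit $m_A(A\otimes f)$. A right generalized entwined module in $\mathcal D$ over $(A,X)$ is $M\in\mathcal D_A$ with a morphism $\rho_M:M\to M\diamond X$ in $\mathcal D$ such that $\rho_M\nu_M=(\nu_M\diamond X)(M\diamond\psi)(\rho_M\diamond A)$, $(\rho_M\diamond X)\rho_M=(\nu_M\diamond X\otimes X)(M\diamond\delta)\rho_M$, $\nu_M(M\diamond f)\rho_M=\mathrm{Id}_M$. $\mathcal D(\psi,\delta,f)_A^X$ is the category of these, with morphisms the $\vartheta:M\to N$ in $\mathcal D_A$ satisfying $\rho_N\vartheta=(\vartheta\diamond X)\rho_M$. *)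

theory Defs
  imports Main
begin

section \<open>Categories, coequalizers, isomorphism of categories\<close>

record ('o, 'a) cat =
  Obj :: "'o set"
  Arr :: "'a set"
  Dom :: "'a \<Rightarrow> 'o"
  Cod :: "'a \<Rightarrow> 'o"
  Idn :: "'o \<Rightarrow> 'a"  ("\<one>\<index> _" [81] 80)
  Cmp :: "'a \<Rightarrow> 'a \<Rightarrow> 'a"  (infixr "\<cdot>\<index>" 60)

definition hom :: "('o, 'a, 'z) cat_scheme \<Rightarrow> 'o \<Rightarrow> 'o \<Rightarrow> 'a set" where
  "hom C X Y = {f \<in> Arr C. Dom C f = X \<and> Cod C f = Y}"

locale category =
  fixes C :: "('o, 'a, 'z) cat_scheme" (structure)
  assumes Dom_in: "f \<in> Arr C \<Longrightarrow> Dom C f \<in> Obj C"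
    and Cod_in: "f \<in> Arr C \<Longrightarrow> Cod C f \<in> Obj C"
    and Idn_in: "X \<in> Obj C \<Longrightarrow> \<one> X \<in> hom C X X"
    and Cmp_in: "\<lbrakk>f \<in> hom C X Y; g \<in> hom C Y Z\<rbrakk> \<Longrightarrow> g \<cdot> f \<in> hom C X Z"
    and Cmp_assoc: "\<lbrakk>f \<in> hom C W X; g \<in> hom C X Y; h \<in> hom C Y Z\<rbrakk> \<Longrightarrow> (h \<cdot> g) \<cdot> f = h \<cdot> (g \<cdot> f)"
    and Cmp_Idn: "f \<in> hom C X Y \<Longrightarrow> f \<cdot> \<one> X = f"
    and Idn_Cmp: "f \<in> hom C X Y \<Longrightarrow> \<one> Y \<cdot> f = f"

definition inverse_arrows :: "('o, 'a, 'z) cat_scheme \<Rightarrow> 'a \<Rightarrow> 'a \<Rightarrow> bool" where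
  "inverse_arrows C f g \<longleftrightarrow> f \<in> Arr C \<and> g \<in> hom C (Cod C f) (Dom C f) \<and>
     g \<cdot>\<^bsub>C\<^esub> f = \<one>\<^bsub>C\<^esub> (Dom C f) \<and> f \<cdot>\<^bsub>C\<^esub> g = \<one>\<^bsub>C\<^esub> (Cod C f)"

definition is_iso :: "('o, 'a, 'z) cat_scheme \<Rightarrow> 'a \<Rightarrow> bool" where
  "is_iso C f \<longleftrightarrow> (\<exists>g. inverse_arrows C f g)"

definition inv_arr :: "('o, 'a, 'z) cat_scheme \<Rightarrow> 'a \<Rightarrow> 'a" where
  "inv_arr C f = (THE g. inverse_arrows C f g)"

definition parallel :: "('o, 'a, 'z) cat_scheme \<Rightarrow> 'a \<Rightarrow> 'a \<Rightarrow> bool" where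
  "parallel C f g \<longleftrightarrow> f \<in> Arr C \<and> g \<in> Arr C \<and> Dom C f = Dom C g \<and> Cod C f = Cod C g"

definition is_coequalizer :: "('o, 'a, 'z) cat_scheme \<Rightarrow> 'a \<Rightarrow> 'a \<Rightarrow> 'a \<Rightarrow> bool" where
  "is_coequalizer C f g q \<longleftrightarrow> parallel C f g \<and> q \<in> Arr C \<and> Dom C q = Cod C f \<and>
     q \<cdot>\<^bsub>C\<^esub> f = q \<cdot>\<^bsub>C\<^esub> g \<and>
     (\<forall>h \<in> Arr C. Dom C h = Cod C f \<and> h \<cdot>\<^bsub>C\<^esub> f = h \<cdot>\<^bsub>C\<^esub> g \<longrightarrow>
        (\<exists>!k. k \<in> hom C (Cod C q) (Cod C h) \<and> k \<cdot>\<^bsub>C\<^esub> q = h))"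

definition has_coequalizers :: "('o, 'a, 'z) cat_scheme \<Rightarrow> bool" where
  "has_coequalizers C \<longleftrightarrow> (\<forall>f g. parallel C f g \<longrightarrow> (\<exists>q. is_coequalizer C f g q))"

definition coeq :: "('o, 'a, 'z) cat_scheme \<Rightarrow> 'a \<Rightarrow> 'a \<Rightarrow> 'a" where
  "coeq C f g = (SOME q. is_coequalizer C f g q)"

text \<open>The unique factorization \<open>k\<close> of \<open>h\<close> through \<open>q\<close>, i.e.\ \<open>k \<cdot> q = h\<close>. It is only used where
  such a \<open>k\<close> exists and is unique.\<close>

definition factor :: "('o, 'a, 'z) cat_scheme \<Rightarrow> 'a \<Rightarrow> 'a \<Rightarrow> 'a" where
  "factor C q h = (THE k. k \<in> hom C (Cod C q) (Cod C h) \<and> k \<cdot>\<^bsub>C\<^esub> q = h)"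

locale cat_functor = S: category S + T: category T
  for S :: "('o, 'a, 'z) cat_scheme" and T :: "('p, 'b, 'y) cat_scheme"
    and Fo :: "'o \<Rightarrow> 'p" and Fa :: "'a \<Rightarrow> 'b" +
  assumes Fo_in: "X \<in> Obj S \<Longrightarrow> Fo X \<in> Obj T"
    and Fa_in: "f \<in> hom S X Y \<Longrightarrow> Fa f \<in> hom T (Fo X) (Fo Y)"
    and Fa_Idn: "X \<in> Obj S \<Longrightarrow> Fa (\<one>\<^bsub>S\<^esub> X) = \<one>\<^bsub>T\<^esub> (Fo X)"
    and Fa_Cmp: "\<lbrakk>f \<in> hom S X Y; g \<in> hom S Y Z\<rbrakk> \<Longrightarrow> Fa (g \<cdot>\<^bsub>S\<^esub> f) = Fa g \<cdot>\<^bsub>T\<^esub> Fa f"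

definition isomorphic_categories ::
    "('o, 'a, 'z) cat_scheme \<Rightarrow> ('p, 'b, 'y) cat_scheme \<Rightarrow> bool" where
  "isomorphic_categories S T \<longleftrightarrow>
     (\<exists>Fo Fa Go Ga. cat_functor S T Fo Fa \<and> cat_functor T S Go Ga \<and>
        (\<forall>X \<in> Obj S. Go (Fo X) = X) \<and> (\<forall>f \<in> Arr S. Ga (Fa f) = f) \<and>
        (\<forall>Y \<in> Obj T. Fo (Go Y) = Y) \<and> (\<forall>g \<in> Arr T. Fa (Ga g) = g))"


section \<open>Strict monoidal categories and strict right module categories\<close>

record ('o, 'a) mcat = "('o, 'a) cat" +
  tob :: "'o \<Rightarrow> 'o \<Rightarrow> 'o"  (infixr "\<otimes>\<^sub>o\<index>" 70)
  tar :: "'a \<Rightarrow> 'a \<Rightarrow> 'a"  (infixr "\<otimes>\<index>" 70)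
  uob :: 'o

locale strict_monoidal_category = category C
  for C :: "('o, 'a) mcat" (structure) +
  assumes tob_in: "\<lbrakk>X \<in> Obj C; Y \<in> Obj C\<rbrakk> \<Longrightarrow> X \<otimes>\<^sub>o Y \<in> Obj C"
    and uob_in: "uob C \<in> Obj C"
    and tar_in: "\<lbrakk>f \<in> hom C X X'; g \<in> hom C Y Y'\<rbrakk> \<Longrightarrow> f \<otimes> g \<in> hom C (X \<otimes>\<^sub>o Y) (X' \<otimes>\<^sub>o Y')"
    and tar_Idn: "\<lbrakk>X \<in> Obj C; Y \<in> Obj C\<rbrakk> \<Longrightarrow> \<one> X \<otimes> \<one> Y = \<one> (X \<otimes>\<^sub>o Y)"
    and interchange: "\<lbrakk>f \<in> hom C X X'; f' \<in> hom C X' X''; g \<in> hom C Y Y'; g' \<in> hom C Y' Y''\<rbrakk>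
        \<Longrightarrow> (f' \<cdot> f) \<otimes> (g' \<cdot> g) = (f' \<otimes> g') \<cdot> (f \<otimes> g)"
    and tob_assoc: "\<lbrakk>X \<in> Obj C; Y \<in> Obj C; Z \<in> Obj C\<rbrakk>
        \<Longrightarrow> (X \<otimes>\<^sub>o Y) \<otimes>\<^sub>o Z = X \<otimes>\<^sub>o (Y \<otimes>\<^sub>o Z)"
    and tar_assoc: "\<lbrakk>f \<in> Arr C; g \<in> Arr C; h \<in> Arr C\<rbrakk> \<Longrightarrow> (f \<otimes> g) \<otimes> h = f \<otimes> (g \<otimes> h)"
    and tob_unit: "X \<in> Obj C \<Longrightarrow> uob C \<otimes>\<^sub>o X = X" "X \<in> Obj C \<Longrightarrow> X \<otimes>\<^sub>o uob C = X"
    and tar_unit: "f \<in> Arr C \<Longrightarrow> \<one> (uob C) \<otimes> f = f" "f \<in> Arr C \<Longrightarrow> f \<otimes> \<one> (uob C) = f"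

text \<open>A category with objects \<open>'p\<close> and arrows \<open>'b\<close>, acted upon by a category with objects \<open>'o\<close>
  and arrows \<open>'a\<close>.\<close>

record ('p, 'b, 'o, 'a) rcat = "('p, 'b) cat" +
  aob :: "'p \<Rightarrow> 'o \<Rightarrow> 'p"  (infixl "\<diamondop>\<^sub>o\<index>" 69)
  aar :: "'b \<Rightarrow> 'a \<Rightarrow> 'b"  (infixl "\<diamondop>\<index>" 69)

locale right_C_category = C: strict_monoidal_category C + category D
  for C :: "('o, 'a) mcat" and D :: "('p, 'b, 'o, 'a) rcat" (structure) +
  assumes aob_in: "\<lbrakk>M \<in> Obj D; X \<in> Obj C\<rbrakk> \<Longrightarrow> M \<diamondop>\<^sub>o X \<in> Obj D"
    and aar_in: "\<lbrakk>f \<in> hom D M M'; g \<in> hom C X X'\<rbrakk> \<Longrightarrow> f \<diamondop> g \<in> hom D (M \<diamondop>\<^sub>o X) (M' \<diamondop>\<^sub>o X')"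
    and aar_Idn: "\<lbrakk>M \<in> Obj D; X \<in> Obj C\<rbrakk> \<Longrightarrow> \<one> M \<diamondop> \<one>\<^bsub>C\<^esub> X = \<one> (M \<diamondop>\<^sub>o X)"
    and act_interchange: "\<lbrakk>f \<in> hom D M M'; f' \<in> hom D M' M''; g \<in> hom C X X'; g' \<in> hom C X' X''\<rbrakk>
        \<Longrightarrow> (f' \<cdot> f) \<diamondop> (g' \<cdot>\<^bsub>C\<^esub> g) = (f' \<diamondop> g') \<cdot> (f \<diamondop> g)"
    and aob_assoc: "\<lbrakk>M \<in> Obj D; X \<in> Obj C; Y \<in> Obj C\<rbrakk>
        \<Longrightarrow> (M \<diamondop>\<^sub>o X) \<diamondop>\<^sub>o Y = M \<diamondop>\<^sub>o (X \<otimes>\<^sub>o\<^bsub>C\<^esub> Y)"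
    and aar_assoc: "\<lbrakk>f \<in> Arr D; g \<in> Arr C; h \<in> Arr C\<rbrakk> \<Longrightarrow> (f \<diamondop> g) \<diamondop> h = f \<diamondop> (g \<otimes>\<^bsub>C\<^esub> h)"
    and aob_unit: "M \<in> Obj D \<Longrightarrow> M \<diamondop>\<^sub>o uob C = M"
    and aar_unit: "f \<in> Arr D \<Longrightarrow> f \<diamondop> \<one>\<^bsub>C\<^esub> (uob C) = f"

text \<open>\<open>C\<close> as a right \<open>C\<close>-category over itself. Instantiating \<open>D = self C\<close> below turns
  \<open>\<diamondop>\<^sub>A\<close> into \<open>\<otimes>\<^sub>A\<close>, \<open>D\<close>-coflat into left coflat, and \<open>D\<close>-robust into left robust.\<close>

definition self :: "('o, 'a) mcat \<Rightarrow> ('o, 'a, 'o, 'a) rcat" where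
  "self C = \<lparr>Obj = Obj C, Arr = Arr C, Dom = Dom C, Cod = Cod C, Idn = Idn C, Cmp = Cmp C,
             aob = tob C, aar = tar C\<rparr>"

definition coflat :: "('p, 'b, 'o, 'a) rcat \<Rightarrow> ('o, 'a) mcat \<Rightarrow> 'o \<Rightarrow> bool" where
  "coflat D C X \<longleftrightarrow> (\<forall>f g q. is_coequalizer D f g q \<longrightarrow>
     is_coequalizer D (f \<diamondop>\<^bsub>D\<^esub> \<one>\<^bsub>C\<^esub> X) (g \<diamondop>\<^bsub>D\<^esub> \<one>\<^bsub>C\<^esub> X) (q \<diamondop>\<^bsub>D\<^esub> \<one>\<^bsub>C\<^esub> X))"

abbreviation left_coflat :: "('o, 'a) mcat \<Rightarrow> 'o \<Rightarrow> bool" where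
  "left_coflat C X \<equiv> coflat (self C) C X"


section \<open>Algebras and modules\<close>

record ('o, 'a) algebra =
  alg :: 'o
  mul :: 'a
  eta :: 'a

record ('p, 'b) rmod =
  rob :: 'p
  ract :: 'b

record ('o, 'a) lmod =
  lob :: 'o
  lact :: 'a

record ('o, 'a) bimod =
  bob :: 'o
  blact :: 'a
  bract :: 'a

definition right_part :: "('o, 'a, 'z) bimod_scheme \<Rightarrow> ('o, 'a) rmod" where
  "right_part Y = \<lparr>rob = bob Y, ract = bract Y\<rparr>"

definition left_part :: "('o, 'a, 'z) bimod_scheme \<Rightarrow> ('o, 'a) lmod" where
  "left_part Y = \<lparr>lob = bob Y, lact = blact Y\<rparr>"

definition is_algebra :: "('o, 'a) mcat \<Rightarrow> ('o, 'a) algebra \<Rightarrow> bool" where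
  "is_algebra C A \<longleftrightarrow> alg A \<in> Obj C \<and>
     mul A \<in> hom C (alg A \<otimes>\<^sub>o\<^bsub>C\<^esub> alg A) (alg A) \<and> eta A \<in> hom C (uob C) (alg A) \<and>
     mul A \<cdot>\<^bsub>C\<^esub> (mul A \<otimes>\<^bsub>C\<^esub> \<one>\<^bsub>C\<^esub> alg A) = mul A \<cdot>\<^bsub>C\<^esub> (\<one>\<^bsub>C\<^esub> alg A \<otimes>\<^bsub>C\<^esub> mul A) \<and>
     mul A \<cdot>\<^bsub>C\<^esub> (eta A \<otimes>\<^bsub>C\<^esub> \<one>\<^bsub>C\<^esub> alg A) = \<one>\<^bsub>C\<^esub> alg A \<and>
     mul A \<cdot>\<^bsub>C\<^esub> (\<one>\<^bsub>C\<^esub> alg A \<otimes>\<^bsub>C\<^esub> eta A) = \<one>\<^bsub>C\<^esub> alg A"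

definition right_module ::
    "('p, 'b, 'o, 'a) rcat \<Rightarrow> ('o, 'a) mcat \<Rightarrow> ('o, 'a) algebra \<Rightarrow> ('p, 'b, 'z) rmod_scheme \<Rightarrow> bool" where
  "right_module D C A M \<longleftrightarrow> rob M \<in> Obj D \<and> ract M \<in> hom D (rob M \<diamondop>\<^sub>o\<^bsub>D\<^esub> alg A) (rob M) \<and>
     ract M \<cdot>\<^bsub>D\<^esub> (ract M \<diamondop>\<^bsub>D\<^esub> \<one>\<^bsub>C\<^esub> alg A) = ract M \<cdot>\<^bsub>D\<^esub> (\<one>\<^bsub>D\<^esub> rob M \<diamondop>\<^bsub>D\<^esub> mul A) \<and>
     ract M \<cdot>\<^bsub>D\<^esub> (\<one>\<^bsub>D\<^esub> rob M \<diamondop>\<^bsub>D\<^esub> eta A) = \<one>\<^bsub>D\<^esub> rob M"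

definition right_linear ::
    "('p, 'b, 'o, 'a) rcat \<Rightarrow> ('o, 'a) mcat \<Rightarrow> ('o, 'a) algebra \<Rightarrow>
     ('p, 'b, 'z) rmod_scheme \<Rightarrow> ('p, 'b, 'y) rmod_scheme \<Rightarrow> 'b \<Rightarrow> bool" where
  "right_linear D C A M N h \<longleftrightarrow> h \<in> hom D (rob M) (rob N) \<and>
     h \<cdot>\<^bsub>D\<^esub> ract M = ract N \<cdot>\<^bsub>D\<^esub> (h \<diamondop>\<^bsub>D\<^esub> \<one>\<^bsub>C\<^esub> alg A)"

definition left_module :: "('o, 'a) mcat \<Rightarrow> ('o, 'a) algebra \<Rightarrow> ('o, 'a) lmod \<Rightarrow> bool" where
  "left_module C A Y \<longleftrightarrow> lob Y \<in> Obj C \<and> lact Y \<in> hom C (alg A \<otimes>\<^sub>o\<^bsub>C\<^esub> lob Y) (lob Y) \<and>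
     lact Y \<cdot>\<^bsub>C\<^esub> (\<one>\<^bsub>C\<^esub> alg A \<otimes>\<^bsub>C\<^esub> lact Y) = lact Y \<cdot>\<^bsub>C\<^esub> (mul A \<otimes>\<^bsub>C\<^esub> \<one>\<^bsub>C\<^esub> lob Y) \<and>
     lact Y \<cdot>\<^bsub>C\<^esub> (eta A \<otimes>\<^bsub>C\<^esub> \<one>\<^bsub>C\<^esub> lob Y) = \<one>\<^bsub>C\<^esub> lob Y"

definition left_linear ::
    "('o, 'a) mcat \<Rightarrow> ('o, 'a) algebra \<Rightarrow> ('o, 'a) lmod \<Rightarrow> ('o, 'a) lmod \<Rightarrow> 'a \<Rightarrow> bool" where
  "left_linear C A Y Z h \<longleftrightarrow> h \<in> hom C (lob Y) (lob Z) \<and>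
     h \<cdot>\<^bsub>C\<^esub> lact Y = lact Z \<cdot>\<^bsub>C\<^esub> (\<one>\<^bsub>C\<^esub> alg A \<otimes>\<^bsub>C\<^esub> h)"

definition bimodule ::
    "('o, 'a) mcat \<Rightarrow> ('o, 'a) algebra \<Rightarrow> ('o, 'a, 'z) bimod_scheme \<Rightarrow> bool" where
  "bimodule C A Y \<longleftrightarrow> left_module C A (left_part Y) \<and> right_module (self C) C A (right_part Y) \<and>
     bract Y \<cdot>\<^bsub>C\<^esub> (blact Y \<otimes>\<^bsub>C\<^esub> \<one>\<^bsub>C\<^esub> alg A) = blact Y \<cdot>\<^bsub>C\<^esub> (\<one>\<^bsub>C\<^esub> alg A \<otimes>\<^bsub>C\<^esub> bract Y)"

definition bimodule_map ::
    "('o, 'a) mcat \<Rightarrow> ('o, 'a) algebra \<Rightarrow>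
     ('o, 'a, 'z) bimod_scheme \<Rightarrow> ('o, 'a, 'y) bimod_scheme \<Rightarrow> 'a \<Rightarrow> bool" where
  "bimodule_map C A Y Z h \<longleftrightarrow> left_linear C A (left_part Y) (left_part Z) h \<and>
     right_linear (self C) C A (right_part Y) (right_part Z) h"

definition regular_bimod :: "('o, 'a) algebra \<Rightarrow> ('o, 'a) bimod" where
  "regular_bimod A = \<lparr>bob = alg A, blact = mul A, bract = mul A\<rparr>"


section \<open>The balanced action \<open>M \<diamondop>\<^sub>A Y\<close>\<close>

text \<open>The coequalizer \<open>q\<^sub>M\<^sub>,\<^sub>Y : M \<diamondop> Y \<rightarrow> M \<diamondop>\<^sub>A Y\<close>.\<close>

definition quo ::
    "('p, 'b, 'o, 'a) rcat \<Rightarrow> ('o, 'a) mcat \<Rightarrow> ('p, 'b) rmod \<Rightarrow> ('o, 'a) lmod \<Rightarrow> 'b" where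
  "quo D C M Y = coeq D (ract M \<diamondop>\<^bsub>D\<^esub> \<one>\<^bsub>C\<^esub> lob Y) (\<one>\<^bsub>D\<^esub> rob M \<diamondop>\<^bsub>D\<^esub> lact Y)"

definition bal_ob ::
    "('p, 'b, 'o, 'a) rcat \<Rightarrow> ('o, 'a) mcat \<Rightarrow> ('p, 'b) rmod \<Rightarrow> ('o, 'a) lmod \<Rightarrow> 'p" where
  "bal_ob D C M Y = Cod D (quo D C M Y)"

text \<open>\<open>bal_ar D C M M' Y Y' g h\<close> is \<open>g \<diamondop>\<^sub>A h : M \<diamondop>\<^sub>A Y \<rightarrow> M' \<diamondop>\<^sub>A Y'\<close> for linear \<open>g : M \<rightarrow> M'\<close> and
  \<open>h : Y \<rightarrow> Y'\<close>.\<close>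

definition bal_ar ::
    "('p, 'b, 'o, 'a) rcat \<Rightarrow> ('o, 'a) mcat \<Rightarrow> ('p, 'b) rmod \<Rightarrow> ('p, 'b) rmod \<Rightarrow>
     ('o, 'a) lmod \<Rightarrow> ('o, 'a) lmod \<Rightarrow> 'b \<Rightarrow> 'a \<Rightarrow> 'b" where
  "bal_ar D C M M' Y Y' g h = factor D (quo D C M Y) (quo D C M' Y' \<cdot>\<^bsub>D\<^esub> (g \<diamondop>\<^bsub>D\<^esub> h))"

text \<open>\<open>M \<diamondop> Z\<close> as a right module, for an object \<open>M\<close> of \<open>D\<close> and a right module \<open>Z\<close> in \<open>C\<close>.\<close>

definition free_act ::
    "('p, 'b, 'o, 'a) rcat \<Rightarrow> 'p \<Rightarrow> ('o, 'a) rmod \<Rightarrow> ('p, 'b) rmod" where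
  "free_act D M Z = \<lparr>rob = M \<diamondop>\<^sub>o\<^bsub>D\<^esub> rob Z, ract = \<one>\<^bsub>D\<^esub> M \<diamondop>\<^bsub>D\<^esub> ract Z\<rparr>"

text \<open>The canonical morphism \<open>(M \<diamondop> Z) \<diamondop>\<^sub>A Y \<rightarrow> M \<diamondop> (Z \<otimes>\<^sub>A Y)\<close>.\<close>

definition theta ::
    "('p, 'b, 'o, 'a) rcat \<Rightarrow> ('o, 'a) mcat \<Rightarrow> 'p \<Rightarrow> ('o, 'a) rmod \<Rightarrow> ('o, 'a) lmod \<Rightarrow> 'b" where
  "theta D C M Z Y =
     factor D (quo D C (free_act D M Z) Y) (\<one>\<^bsub>D\<^esub> M \<diamondop>\<^bsub>D\<^esub> quo (self C) C Z Y)"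

definition robust ::
    "('p, 'b, 'o, 'a) rcat \<Rightarrow> ('o, 'a) mcat \<Rightarrow> ('o, 'a) algebra \<Rightarrow> ('o, 'a) lmod \<Rightarrow> bool" where
  "robust D C A Y \<longleftrightarrow>
     (\<forall>M Z. M \<in> Obj D \<and> right_module (self C) C A Z \<longrightarrow> is_iso D (theta D C M Z Y))"

abbreviation left_robust ::
    "('o, 'a) mcat \<Rightarrow> ('o, 'a) algebra \<Rightarrow> ('o, 'a) lmod \<Rightarrow> bool" where
  "left_robust C A Y \<equiv> robust (self C) C A Y"

text \<open>The objects of the monoidal category of bimodules that are coflat and robust for both
  \<open>C\<close> and \<open>D\<close>. Its morphisms are all bimodule maps.\<close>

definition good_bimodule ::
    "('p, 'b, 'o, 'a) rcat \<Rightarrow> ('o, 'a) mcat \<Rightarrow> ('o, 'a) algebra \<Rightarrow>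
     ('o, 'a, 'z) bimod_scheme \<Rightarrow> bool" where
  "good_bimodule D C A Y \<longleftrightarrow> bimodule C A Y \<and> left_coflat C (bob Y) \<and> coflat D C (bob Y) \<and>
     left_robust C A (left_part Y) \<and> robust D C A (left_part Y)"

text \<open>\<open>M \<diamondop>\<^sub>A Y\<close> as a right module. Its action is the unique \<open>\<nu>\<close> with
  \<open>\<nu> \<cdot> (q \<diamondop> A) = q \<cdot> (M \<diamondop> \<nu>\<^sub>Y)\<close>; here \<open>q \<diamondop> A\<close> is again a coequalizer because \<open>A\<close>, the unit
  of \<open>\<otimes>\<^sub>A\<close>, is \<open>D\<close>-coflat.\<close>

definition bal_rmod ::
    "('p, 'b, 'o, 'a) rcat \<Rightarrow> ('o, 'a) mcat \<Rightarrow> ('o, 'a) algebra \<Rightarrow>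
     ('p, 'b) rmod \<Rightarrow> ('o, 'a, 'z) bimod_scheme \<Rightarrow> ('p, 'b) rmod" where
  "bal_rmod D C A M Y =
     \<lparr>rob = bal_ob D C M (left_part Y),
      ract = factor D (quo D C M (left_part Y) \<diamondop>\<^bsub>D\<^esub> \<one>\<^bsub>C\<^esub> alg A)
               (quo D C M (left_part Y) \<cdot>\<^bsub>D\<^esub> (\<one>\<^bsub>D\<^esub> rob M \<diamondop>\<^bsub>D\<^esub> bract Y))\<rparr>"

text \<open>\<open>X \<otimes>\<^sub>A Y\<close> as a bimodule. Its left action is the unique \<open>\<mu>\<close> with
  \<open>\<mu> \<cdot> (A \<otimes> q) = q \<cdot> (\<mu>\<^sub>X \<otimes> Y)\<close>; here \<open>A \<otimes> q\<close> is a coequalizer because \<open>Y\<close> is left robust.\<close>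

definition bal_bimod ::
    "('o, 'a) mcat \<Rightarrow> ('o, 'a) algebra \<Rightarrow> ('o, 'a, 'z) bimod_scheme \<Rightarrow> ('o, 'a, 'y) bimod_scheme \<Rightarrow>
     ('o, 'a) bimod" where
  "bal_bimod C A X Y = (let q = quo (self C) C (right_part X) (left_part Y) in
     \<lparr>bob = Cod C q,
      blact = factor C (\<one>\<^bsub>C\<^esub> alg A \<otimes>\<^bsub>C\<^esub> q) (q \<cdot>\<^bsub>C\<^esub> (blact X \<otimes>\<^bsub>C\<^esub> \<one>\<^bsub>C\<^esub> bob Y)),
      bract = ract (bal_rmod (self C) C A (right_part X) Y)\<rparr>)"

text \<open>The associativity constraint \<open>(M \<diamondop>\<^sub>A X) \<diamondop>\<^sub>A Y \<rightarrow> M \<diamondop>\<^sub>A (X \<otimes>\<^sub>A Y)\<close>, induced by the identity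
  of \<open>M \<diamondop> X \<diamondop> Y\<close>, and the unit constraints \<open>M \<diamondop>\<^sub>A A \<rightarrow> M\<close> and \<open>A \<otimes>\<^sub>A Y \<rightarrow> Y\<close>.\<close>

definition assoc_c ::
    "('p, 'b, 'o, 'a) rcat \<Rightarrow> ('o, 'a) mcat \<Rightarrow> ('o, 'a) algebra \<Rightarrow>
     ('p, 'b) rmod \<Rightarrow> ('o, 'a, 'z) bimod_scheme \<Rightarrow> ('o, 'a, 'y) bimod_scheme \<Rightarrow> 'b" where
  "assoc_c D C A M X Y =
     factor D
       (quo D C (bal_rmod D C A M X) (left_part Y) \<cdot>\<^bsub>D\<^esub> (quo D C M (left_part X) \<diamondop>\<^bsub>D\<^esub> \<one>\<^bsub>C\<^esub> bob Y))
       (quo D C M (left_part (bal_bimod C A X Y)) \<cdot>\<^bsub>D\<^esub>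
          (\<one>\<^bsub>D\<^esub> rob M \<diamondop>\<^bsub>D\<^esub> quo (self C) C (right_part X) (left_part Y)))"

definition runit_c ::
    "('p, 'b, 'o, 'a) rcat \<Rightarrow> ('o, 'a) mcat \<Rightarrow> ('o, 'a) algebra \<Rightarrow> ('p, 'b) rmod \<Rightarrow> 'b" where
  "runit_c D C A M = factor D (quo D C M (left_part (regular_bimod A))) (ract M)"

definition lunit_c ::
    "('o, 'a) mcat \<Rightarrow> ('o, 'a) algebra \<Rightarrow> ('o, 'a) lmod \<Rightarrow> 'a" where
  "lunit_c C A Y = factor C (quo (self C) C (right_part (regular_bimod A)) Y) (lact Y)"


section \<open>Corings compatible with \<open>D\<close> and their corepresentations\<close>

record ('o, 'a) coring = "('o, 'a) bimod" +
  comul :: 'a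
  couni :: 'a

definition compatible_coring ::
    "('p, 'b, 'o, 'a) rcat \<Rightarrow> ('o, 'a) mcat \<Rightarrow> ('o, 'a) algebra \<Rightarrow> ('o, 'a) coring \<Rightarrow> bool" where
  "compatible_coring D C A K \<longleftrightarrow>
     (let R = right_part K; L = left_part K; R2 = right_part (bal_bimod C A K K);
          L2 = left_part (bal_bimod C A K K); RA = right_part (regular_bimod A);
          LA = left_part (regular_bimod A)
      in good_bimodule D C A K \<and>
         bimodule_map C A K (bal_bimod C A K K) (comul K) \<and>
         bimodule_map C A K (regular_bimod A) (couni K) \<and>
         assoc_c (self C) C A R K K \<cdot>\<^bsub>C\<^esub> bal_ar (self C) C R R2 L L (comul K) (\<one>\<^bsub>C\<^esub> bob K) \<cdot>\<^bsub>C\<^esub> comul K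
           = bal_ar (self C) C R R L L2 (\<one>\<^bsub>C\<^esub> bob K) (comul K) \<cdot>\<^bsub>C\<^esub> comul K \<and>
         lunit_c C A L \<cdot>\<^bsub>C\<^esub> bal_ar (self C) C R RA L L (couni K) (\<one>\<^bsub>C\<^esub> bob K) \<cdot>\<^bsub>C\<^esub> comul K = \<one>\<^bsub>C\<^esub> bob K \<and>
         runit_c (self C) C A R \<cdot>\<^bsub>C\<^esub> bal_ar (self C) C R R L LA (\<one>\<^bsub>C\<^esub> bob K) (couni K) \<cdot>\<^bsub>C\<^esub> comul K
           = \<one>\<^bsub>C\<^esub> bob K)"

text \<open>A right module with an additional structure morphism: a coaction \<open>M \<rightarrow> M \<diamondop>\<^sub>A K\<close> for
  corepresentations, or a morphism \<open>M \<rightarrow> M \<diamondop> X\<close> for generalized entwined modules.\<close>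

record ('p, 'b) comod = "('p, 'b) rmod" +
  coact :: 'b

definition mod_part :: "('p, 'b) comod \<Rightarrow> ('p, 'b) rmod" where
  "mod_part M = \<lparr>rob = rob M, ract = ract M\<rparr>"

definition corepresentation ::
    "('p, 'b, 'o, 'a) rcat \<Rightarrow> ('o, 'a) mcat \<Rightarrow> ('o, 'a) algebra \<Rightarrow> ('o, 'a) coring \<Rightarrow>
     ('p, 'b) comod \<Rightarrow> bool" where
  "corepresentation D C A K N \<longleftrightarrow>
     (let M = mod_part N; L = left_part K; L2 = left_part (bal_bimod C A K K);
          LA = left_part (regular_bimod A)
      in right_module D C A M \<and>
         right_linear D C A M (bal_rmod D C A M K) (coact N) \<and>
         assoc_c D C A M K K \<cdot>\<^bsub>D\<^esub>
             bal_ar D C M (bal_rmod D C A M K) L L (coact N) (\<one>\<^bsub>C\<^esub> bob K) \<cdot>\<^bsub>D\<^esub> coact N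
           = bal_ar D C M M L L2 (\<one>\<^bsub>D\<^esub> rob M) (comul K) \<cdot>\<^bsub>D\<^esub> coact N \<and>
         runit_c D C A M \<cdot>\<^bsub>D\<^esub> bal_ar D C M M L LA (\<one>\<^bsub>D\<^esub> rob M) (couni K) \<cdot>\<^bsub>D\<^esub> coact N = \<one>\<^bsub>D\<^esub> rob M)"

definition colinear ::
    "('p, 'b, 'o, 'a) rcat \<Rightarrow> ('o, 'a) mcat \<Rightarrow> ('o, 'a) algebra \<Rightarrow> ('o, 'a) coring \<Rightarrow>
     ('p, 'b) comod \<Rightarrow> ('p, 'b) comod \<Rightarrow> 'b \<Rightarrow> bool" where
  "colinear D C A K M N h \<longleftrightarrow> right_linear D C A M N h \<and>
     coact N \<cdot>\<^bsub>D\<^esub> h =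
       bal_ar D C (mod_part M) (mod_part N) (left_part K) (left_part K) h (\<one>\<^bsub>C\<^esub> bob K) \<cdot>\<^bsub>D\<^esub> coact M"

text \<open>The category of structured objects of \<open>D\<close>: its objects are the comodule records satisfying
  \<open>P\<close>, and an arrow \<open>M \<rightarrow> N\<close> is a triple \<open>(M, h, N)\<close> with \<open>H M N h\<close>, composed as in \<open>D\<close>.\<close>

definition structured_cat ::
    "('p, 'b, 'o, 'a) rcat \<Rightarrow> (('p, 'b) comod \<Rightarrow> bool) \<Rightarrow>
     (('p, 'b) comod \<Rightarrow> ('p, 'b) comod \<Rightarrow> 'b \<Rightarrow> bool) \<Rightarrow>
     (('p, 'b) comod, ('p, 'b) comod \<times> 'b \<times> ('p, 'b) comod) cat" where
  "structured_cat D P H =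
     \<lparr>Obj = {M. P M}, Arr = {(M, h, N). P M \<and> P N \<and> H M N h},
      Dom = (\<lambda>(M, h, N). M), Cod = (\<lambda>(M, h, N). N),
      Idn = (\<lambda>M. (M, \<one>\<^bsub>D\<^esub> rob M, M)),
      Cmp = (\<lambda>(N', h', N'') (M, h, N). (M, h' \<cdot>\<^bsub>D\<^esub> h, N''))\<rparr>"

definition corep_cat ::
    "('p, 'b, 'o, 'a) rcat \<Rightarrow> ('o, 'a) mcat \<Rightarrow> ('o, 'a) algebra \<Rightarrow> ('o, 'a) coring \<Rightarrow>
     (('p, 'b) comod, ('p, 'b) comod \<times> 'b \<times> ('p, 'b) comod) cat" where
  "corep_cat D C A K = structured_cat D (corepresentation D C A K) (colinear D C A K)"


section \<open>Cowreaths, their corings, and generalized entwined modules\<close>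

locale cowreath = strict_monoidal_category C
  for C :: "('o, 'a) mcat" (structure) and A :: "('o, 'a) algebra" and X :: 'o
    and \<psi> \<delta> f :: 'a +
  assumes alg_A: "is_algebra C A"
    and X_in: "X \<in> Obj C"
    and psi_in: "\<psi> \<in> hom C (X \<otimes>\<^sub>o alg A) (alg A \<otimes>\<^sub>o X)"
    and delta_in: "\<delta> \<in> hom C X (alg A \<otimes>\<^sub>o X \<otimes>\<^sub>o X)"
    and f_in: "f \<in> hom C X (alg A)"
    and psi_mul: "\<psi> \<cdot> (\<one> X \<otimes> mul A) = (mul A \<otimes> \<one> X) \<cdot> (\<one> alg A \<otimes> \<psi>) \<cdot> (\<psi> \<otimes> \<one> alg A)"
    and psi_eta: "\<psi> \<cdot> (\<one> X \<otimes> eta A) = eta A \<otimes> \<one> X"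
    and delta_psi: "(mul A \<otimes> \<one> X \<otimes> \<one> X) \<cdot> (\<one> alg A \<otimes> \<delta>) \<cdot> \<psi> =
        (mul A \<otimes> \<one> X \<otimes> \<one> X) \<cdot> (\<one> alg A \<otimes> \<psi> \<otimes> \<one> X) \<cdot> (\<one> alg A \<otimes> \<one> X \<otimes> \<psi>) \<cdot> (\<delta> \<otimes> \<one> alg A)"
    and delta_coassoc: "(mul A \<otimes> \<one> X \<otimes> \<one> X \<otimes> \<one> X) \<cdot> (\<one> alg A \<otimes> \<psi> \<otimes> \<one> X \<otimes> \<one> X) \<cdot>
          (\<one> alg A \<otimes> \<one> X \<otimes> \<delta>) \<cdot> \<delta> =
        (mul A \<otimes> \<one> X \<otimes> \<one> X \<otimes> \<one> X) \<cdot> (\<one> alg A \<otimes> \<delta> \<otimes> \<one> X) \<cdot> \<delta>"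
    and f_psi: "mul A \<cdot> (\<one> alg A \<otimes> f) \<cdot> \<psi> = mul A \<cdot> (f \<otimes> \<one> alg A)"
    and f_delta_left: "(mul A \<otimes> \<one> X) \<cdot> (\<one> alg A \<otimes> f \<otimes> \<one> X) \<cdot> \<delta> = eta A \<otimes> \<one> X"
    and f_delta_right: "(mul A \<otimes> \<one> X) \<cdot> (\<one> alg A \<otimes> \<psi>) \<cdot> (\<one> alg A \<otimes> \<one> X \<otimes> f) \<cdot> \<delta> = eta A \<otimes> \<one> X"

definition cowreath_bimod ::
    "('o, 'a) mcat \<Rightarrow> ('o, 'a) algebra \<Rightarrow> 'o \<Rightarrow> 'a \<Rightarrow> ('o, 'a) bimod" where
  "cowreath_bimod C A X \<psi> =
     \<lparr>bob = alg A \<otimes>\<^sub>o\<^bsub>C\<^esub> X,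
      blact = mul A \<otimes>\<^bsub>C\<^esub> \<one>\<^bsub>C\<^esub> X,
      bract = (mul A \<otimes>\<^bsub>C\<^esub> \<one>\<^bsub>C\<^esub> X) \<cdot>\<^bsub>C\<^esub> (\<one>\<^bsub>C\<^esub> alg A \<otimes>\<^bsub>C\<^esub> \<psi>)\<rparr>"

text \<open>The canonical isomorphism \<open>K \<otimes>\<^sub>A K \<rightarrow> K \<otimes> X\<close> for \<open>K = A \<otimes> X\<close>, induced by the right action
  \<open>K \<otimes> A \<rightarrow> K\<close>.\<close>

definition Upsilon :: "('o, 'a) mcat \<Rightarrow> ('o, 'a) algebra \<Rightarrow> 'o \<Rightarrow> 'a \<Rightarrow> 'a" where
  "Upsilon C A X \<psi> = (let K = cowreath_bimod C A X \<psi> in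
     factor C (quo (self C) C (right_part K) (left_part K)) (bract K \<otimes>\<^bsub>C\<^esub> \<one>\<^bsub>C\<^esub> X))"

definition cowreath_coring ::
    "('o, 'a) mcat \<Rightarrow> ('o, 'a) algebra \<Rightarrow> 'o \<Rightarrow> 'a \<Rightarrow> 'a \<Rightarrow> 'a \<Rightarrow> ('o, 'a) coring" where
  "cowreath_coring C A X \<psi> \<delta> f = bimod.extend (cowreath_bimod C A X \<psi>)
     \<lparr>comul = inv_arr C (Upsilon C A X \<psi>) \<cdot>\<^bsub>C\<^esub>
        (mul A \<otimes>\<^bsub>C\<^esub> \<one>\<^bsub>C\<^esub> X \<otimes>\<^bsub>C\<^esub> \<one>\<^bsub>C\<^esub> X) \<cdot>\<^bsub>C\<^esub> (\<one>\<^bsub>C\<^esub> alg A \<otimes>\<^bsub>C\<^esub> \<delta>),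
      couni = mul A \<cdot>\<^bsub>C\<^esub> (\<one>\<^bsub>C\<^esub> alg A \<otimes>\<^bsub>C\<^esub> f)\<rparr>"

definition entwined_module ::
    "('p, 'b, 'o, 'a) rcat \<Rightarrow> ('o, 'a) mcat \<Rightarrow> ('o, 'a) algebra \<Rightarrow> 'o \<Rightarrow> 'a \<Rightarrow> 'a \<Rightarrow> 'a \<Rightarrow>
     ('p, 'b) comod \<Rightarrow> bool" where
  "entwined_module D C A X \<psi> \<delta> f M \<longleftrightarrow> right_module D C A M \<and>
     coact M \<in> hom D (rob M) (rob M \<diamondop>\<^sub>o\<^bsub>D\<^esub> X) \<and>
     coact M \<cdot>\<^bsub>D\<^esub> ract M =
       (ract M \<diamondop>\<^bsub>D\<^esub> \<one>\<^bsub>C\<^esub> X) \<cdot>\<^bsub>D\<^esub> (\<one>\<^bsub>D\<^esub> rob M \<diamondop>\<^bsub>D\<^esub> \<psi>) \<cdot>\<^bsub>D\<^esub> (coact M \<diamondop>\<^bsub>D\<^esub> \<one>\<^bsub>C\<^esub> alg A) \<and>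
     (coact M \<diamondop>\<^bsub>D\<^esub> \<one>\<^bsub>C\<^esub> X) \<cdot>\<^bsub>D\<^esub> coact M =
       (ract M \<diamondop>\<^bsub>D\<^esub> \<one>\<^bsub>C\<^esub> X \<otimes>\<^bsub>C\<^esub> \<one>\<^bsub>C\<^esub> X) \<cdot>\<^bsub>D\<^esub> (\<one>\<^bsub>D\<^esub> rob M \<diamondop>\<^bsub>D\<^esub> \<delta>) \<cdot>\<^bsub>D\<^esub> coact M \<and>
     ract M \<cdot>\<^bsub>D\<^esub> (\<one>\<^bsub>D\<^esub> rob M \<diamondop>\<^bsub>D\<^esub> f) \<cdot>\<^bsub>D\<^esub> coact M = \<one>\<^bsub>D\<^esub> rob M"

definition entwined_map ::
    "('p, 'b, 'o, 'a) rcat \<Rightarrow> ('o, 'a) mcat \<Rightarrow> ('o, 'a) algebra \<Rightarrow> 'o \<Rightarrow>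
     ('p, 'b) comod \<Rightarrow> ('p, 'b) comod \<Rightarrow> 'b \<Rightarrow> bool" where
  "entwined_map D C A X M N h \<longleftrightarrow> right_linear D C A M N h \<and>
     coact N \<cdot>\<^bsub>D\<^esub> h = (h \<diamondop>\<^bsub>D\<^esub> \<one>\<^bsub>C\<^esub> X) \<cdot>\<^bsub>D\<^esub> coact M"

definition entwined_cat ::
    "('p, 'b, 'o, 'a) rcat \<Rightarrow> ('o, 'a) mcat \<Rightarrow> ('o, 'a) algebra \<Rightarrow> 'o \<Rightarrow> 'a \<Rightarrow> 'a \<Rightarrow> 'a \<Rightarrow>
     (('p, 'b) comod, ('p, 'b) comod \<times> 'b \<times> ('p, 'b) comod) cat" where
  "entwined_cat D C A X \<psi> \<delta> f =
     structured_cat D (entwined_module D C A X \<psi> \<delta> f) (entwined_map D C A X)"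

end

theory Submission
  imports Defs
begin

text \<open>
The left module \<open>K = A \<otimes> X\<close> is free, so that \<open>M \<diamondop>\<^sub>A K\<close> is just \<open>M \<diamondop> X\<close>: the morphism
\<open>\<nu>\<^sub>M \<diamondop> X : M \<diamondop> A \<diamondop> X \<rightarrow> M \<diamondop> X\<close> is a coequalizer of the two morphisms that define \<open>M \<diamondop>\<^sub>A K\<close>, and
it is one for equational reasons, being split by \<open>M \<diamondop> \<eta> \<diamondop> X\<close> (\<open>free_quotient\<close>). The same
holds for \<open>K \<otimes>\<^sub>A K\<close>, which the isomorphism \<open>\<Upsilon>\<close> turns into the free module \<open>A \<otimes> X \<otimes> X\<close>
(\<open>KK_free_via\<close>). Split coequalizers are preserved by every functor, hence by tensoring with any
object on either side. This makes all the factorizations in the definitions of balanced actions,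
associativity and unit constraints exist and be unique, and it makes \<open>K\<close> robust.

Let \<open>contract M : M \<diamondop>\<^sub>A K \<rightarrow> M \<diamondop> X\<close> and \<open>expand M : M \<diamondop> X \<rightarrow> M \<diamondop>\<^sub>A K\<close> be the inverse
isomorphisms that result. Coactions \<open>M \<rightarrow> M \<diamondop>\<^sub>A K\<close> and morphisms \<open>\<rho> : M \<rightarrow> M \<diamondop> X\<close> correspond to each
other by composition with them, and the underlying module and the underlying morphisms stay the
same. It then suffices to compare the axioms one by one. Precomposing with
\<open>M \<diamondop> \<eta> \<diamondop> X\<close>, which is what \<open>expand\<close> does, strips from each structure morphism of \<open>K\<close> the
multiplication of \<open>A\<close> and leaves the datum \<open>\<psi>\<close>, \<open>\<delta>\<close> or \<open>f\<close> of the cowreath from which it was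
built: linearity of the coaction becomes the \<open>\<psi>\<close>-axiom (\<open>coact_linear_iff\<close>), coassociativity
the \<open>\<delta>\<close>-axiom (\<open>coact_coassoc_iff\<close>), and counitality the \<open>f\<close>-axiom (\<open>coact_counit\<close>).

Applied to the action of \<open>C\<close> on itself, the same comparison proves most of the coring axioms: right
linearity of the comultiplication, coassociativity and the right counit law say exactly that \<open>K\<close>
is a corepresentation of itself, equivalently that \<open>K\<close> with \<open>(m \<otimes> X \<otimes> X)(A \<otimes> \<delta>)\<close> is a generalized
entwined module (\<open>K_compatible\<close>). That is a computation with Kleisli extensions for the monad
\<open>A \<otimes> -\<close>, of which the right action and the counit of \<open>K\<close> are instances, and also, up to \<open>\<Upsilon>\<close>, the
comultiplication.
\<close>

section \<open>Typed calculations in strict monoidal and module categories\<close>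

lemma homD:
  assumes "f \<in> hom C X Y"
  shows "f \<in> Arr C" "Dom C f = X" "Cod C f = Y"
  using assms by (simp_all add: hom_def)

text \<open>The laws of the structures, with membership in a hom-set split into conditions on arrow, domain
  and codomain. In this form no condition mentions an object that is absent from the left-hand side,
  and the simplifier can type-check composites by itself. Its normal form is a composite, associated
  to the right, of morphisms each tensored with identities.\<close>

context category
begin

lemma Dom_Obj [simp]: "f \<in> Arr C \<Longrightarrow> Dom C f \<in> Obj C"
  by (rule Dom_in)

lemma Cod_Obj [simp]: "f \<in> Arr C \<Longrightarrow> Cod C f \<in> Obj C"
  by (rule Cod_in)

lemma Idn_typing [simp]:
  assumes "X \<in> Obj C"
  shows "\<one> X \<in> Arr C" "Dom C (\<one> X) = X" "Cod C (\<one> X) = X"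
  using Idn_in[OF assms] by (auto dest: homD)

lemma Cmp_typing [simp]:
  assumes "f \<in> Arr C" "g \<in> Arr C" "Cod C f = Dom C g"
  shows "g \<cdot> f \<in> Arr C" "Dom C (g \<cdot> f) = Dom C f" "Cod C (g \<cdot> f) = Cod C g"
  using Cmp_in[of f "Dom C f" "Dom C g" g "Cod C g"] assms by (auto simp: hom_def)

lemma Cmp_assoc_typed [simp]:
  "\<lbrakk>f \<in> Arr C; g \<in> Arr C; h \<in> Arr C; Cod C f = Dom C g; Cod C g = Dom C h\<rbrakk>
    \<Longrightarrow> (h \<cdot> g) \<cdot> f = h \<cdot> (g \<cdot> f)"
  by (rule Cmp_assoc) (auto simp: hom_def)

lemma Cmp_Idn_typed [simp]: "\<lbrakk>f \<in> Arr C; Dom C f = X\<rbrakk> \<Longrightarrow> f \<cdot> \<one> X = f"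
  by (rule Cmp_Idn) (auto simp: hom_def)

lemma Idn_Cmp_typed [simp]: "\<lbrakk>f \<in> Arr C; Cod C f = X\<rbrakk> \<Longrightarrow> \<one> X \<cdot> f = f"
  by (rule Idn_Cmp) (auto simp: hom_def)

text \<open>An equation between composites
  therefore rewrites the middle of a longer one only after it has been extended by a further
  morphism \<open>x\<close>.\<close>

lemma reassoc:
  "\<lbrakk>a \<cdot> b = c; a \<in> Arr C; b \<in> Arr C; Cod C b = Dom C a; x \<in> Arr C; Cod C x = Dom C b\<rbrakk>
    \<Longrightarrow> a \<cdot> (b \<cdot> x) = c \<cdot> x"
  by (metis Cmp_assoc_typed)

lemma reassoc_square:
  "\<lbrakk>a \<cdot> b = c \<cdot> d; a \<in> Arr C; b \<in> Arr C; Cod C b = Dom C a; c \<in> Arr C; d \<in> Arr C;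
    Cod C d = Dom C c; x \<in> Arr C; Cod C x = Dom C b; Dom C d = Dom C b\<rbrakk>
    \<Longrightarrow> a \<cdot> (b \<cdot> x) = c \<cdot> (d \<cdot> x)"
  by (metis Cmp_assoc_typed)

end

context strict_monoidal_category
begin

lemma tob_Obj [simp]: "\<lbrakk>X \<in> Obj C; Y \<in> Obj C\<rbrakk> \<Longrightarrow> X \<otimes>\<^sub>o Y \<in> Obj C"
  by (rule tob_in)

lemma uob_Obj [simp]: "uob C \<in> Obj C"
  by (rule uob_in)

lemma tar_typing [simp]:
  assumes "f \<in> Arr C" "g \<in> Arr C"
  shows "f \<otimes> g \<in> Arr C" "Dom C (f \<otimes> g) = Dom C f \<otimes>\<^sub>o Dom C g"
    "Cod C (f \<otimes> g) = Cod C f \<otimes>\<^sub>o Cod C g"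
  using tar_in[of f "Dom C f" "Cod C f" g "Dom C g" "Cod C g"] assms by (auto simp: hom_def)

lemma tob_assoc_typed [simp]:
  "\<lbrakk>X \<in> Obj C; Y \<in> Obj C; Z \<in> Obj C\<rbrakk> \<Longrightarrow> (X \<otimes>\<^sub>o Y) \<otimes>\<^sub>o Z = X \<otimes>\<^sub>o Y \<otimes>\<^sub>o Z"
  by (rule tob_assoc)

lemma tar_assoc_typed [simp]:
  "\<lbrakk>f \<in> Arr C; g \<in> Arr C; h \<in> Arr C\<rbrakk> \<Longrightarrow> (f \<otimes> g) \<otimes> h = f \<otimes> g \<otimes> h"
  by (rule tar_assoc)

lemmas unit_simps [simp] = tob_unit tar_unit tar_Idn

lemma Idn_merge [simp]:
  "\<lbrakk>X \<in> Obj C; Y \<in> Obj C; f \<in> Arr C\<rbrakk> \<Longrightarrow> \<one> X \<otimes> \<one> Y \<otimes> f = \<one> (X \<otimes>\<^sub>o Y) \<otimes> f"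
  by (metis Idn_typing(1) tar_Idn tar_assoc_typed)

lemma interchange_typed:
  "\<lbrakk>f \<in> Arr C; f' \<in> Arr C; g \<in> Arr C; g' \<in> Arr C; Cod C f = Dom C f'; Cod C g = Dom C g'\<rbrakk>
    \<Longrightarrow> (f' \<otimes> g') \<cdot> (f \<otimes> g) = (f' \<cdot> f) \<otimes> (g' \<cdot> g)"
  by (rule interchange[symmetric]) (auto simp: hom_def)

lemma whisker_left [simp]:
  "\<lbrakk>f \<in> Arr C; g \<in> Arr C; Cod C f = Dom C g; X \<in> Obj C\<rbrakk>
    \<Longrightarrow> \<one> X \<otimes> (g \<cdot> f) = (\<one> X \<otimes> g) \<cdot> (\<one> X \<otimes> f)"
  by (simp add: interchange_typed)

lemma whisker_right [simp]:
  "\<lbrakk>f \<in> Arr C; g \<in> Arr C; Cod C f = Dom C g; X \<in> Obj C\<rbrakk>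
    \<Longrightarrow> (g \<cdot> f) \<otimes> \<one> X = (g \<otimes> \<one> X) \<cdot> (f \<otimes> \<one> X)"
  by (simp add: interchange_typed)

lemma slide:
  "\<lbrakk>f \<in> Arr C; g \<in> Arr C\<rbrakk> \<Longrightarrow>
    (f \<otimes> \<one> Cod C g) \<cdot> (\<one> Dom C f \<otimes> g) = (\<one> Cod C f \<otimes> g) \<cdot> (f \<otimes> \<one> Dom C g)"
  by (simp add: interchange_typed)

end

context right_C_category
begin

lemma aob_Obj [simp]: "\<lbrakk>M \<in> Obj D; X \<in> Obj C\<rbrakk> \<Longrightarrow> M \<diamondop>\<^sub>o X \<in> Obj D"
  by (rule aob_in)

lemma aar_typing [simp]:
  assumes "f \<in> Arr D" "g \<in> Arr C"
  shows "f \<diamondop> g \<in> Arr D" "Dom D (f \<diamondop> g) = Dom D f \<diamondop>\<^sub>o Dom C g"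
    "Cod D (f \<diamondop> g) = Cod D f \<diamondop>\<^sub>o Cod C g"
  using aar_in[of f "Dom D f" "Cod D f" g "Dom C g" "Cod C g"] assms by (auto simp: hom_def)

lemma aob_assoc_typed [simp]:
  "\<lbrakk>M \<in> Obj D; X \<in> Obj C; Y \<in> Obj C\<rbrakk> \<Longrightarrow> (M \<diamondop>\<^sub>o X) \<diamondop>\<^sub>o Y = M \<diamondop>\<^sub>o (X \<otimes>\<^sub>o\<^bsub>C\<^esub> Y)"
  by (rule aob_assoc)

lemma aar_assoc_typed [simp]:
  "\<lbrakk>f \<in> Arr D; g \<in> Arr C; h \<in> Arr C\<rbrakk> \<Longrightarrow> (f \<diamondop> g) \<diamondop> h = f \<diamondop> (g \<otimes>\<^bsub>C\<^esub> h)"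
  by (rule aar_assoc)

lemmas act_unit_simps [simp] = aob_unit aar_unit aar_Idn

lemma act_Idn_split [simp]:
  "\<lbrakk>M \<in> Obj D; X \<in> Obj C; f \<in> Arr C\<rbrakk> \<Longrightarrow> \<one> (M \<diamondop>\<^sub>o X) \<diamondop> f = \<one> M \<diamondop> (\<one>\<^bsub>C\<^esub> X \<otimes>\<^bsub>C\<^esub> f)"
  by (metis Idn_typing(1) C.Idn_typing(1) aar_Idn aar_assoc_typed)

lemma act_interchange_typed:
  "\<lbrakk>f \<in> Arr D; f' \<in> Arr D; g \<in> Arr C; g' \<in> Arr C; Cod D f = Dom D f'; Cod C g = Dom C g'\<rbrakk>
    \<Longrightarrow> (f' \<diamondop> g') \<cdot> (f \<diamondop> g) = (f' \<cdot> f) \<diamondop> (g' \<cdot>\<^bsub>C\<^esub> g)"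
  by (rule act_interchange[symmetric]) (auto simp: hom_def)

lemma act_whisker_left [simp]:
  "\<lbrakk>f \<in> Arr C; g \<in> Arr C; Cod C f = Dom C g; M \<in> Obj D\<rbrakk>
    \<Longrightarrow> \<one> M \<diamondop> (g \<cdot>\<^bsub>C\<^esub> f) = (\<one> M \<diamondop> g) \<cdot> (\<one> M \<diamondop> f)"
  by (simp add: act_interchange_typed)

lemma act_whisker_right [simp]:
  "\<lbrakk>f \<in> Arr D; g \<in> Arr D; Cod D f = Dom D g; X \<in> Obj C\<rbrakk>
    \<Longrightarrow> (g \<cdot> f) \<diamondop> \<one>\<^bsub>C\<^esub> X = (g \<diamondop> \<one>\<^bsub>C\<^esub> X) \<cdot> (f \<diamondop> \<one>\<^bsub>C\<^esub> X)"
  by (simp add: act_interchange_typed)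

lemma act_slide:
  "\<lbrakk>f \<in> Arr D; g \<in> Arr C\<rbrakk> \<Longrightarrow>
    (f \<diamondop> \<one>\<^bsub>C\<^esub> Cod C g) \<cdot> (\<one> Dom D f \<diamondop> g) = (\<one> Cod D f \<diamondop> g) \<cdot> (f \<diamondop> \<one>\<^bsub>C\<^esub> Dom C g)"
  by (simp add: act_interchange_typed)

end

section \<open>Coequalizers\<close>

context category
begin

lemma coequalizerD:
  assumes "is_coequalizer C f g q"
  shows "f \<in> Arr C" "g \<in> Arr C" "q \<in> Arr C" "Dom C g = Dom C f" "Cod C g = Cod C f"
    "Dom C q = Cod C f" "q \<cdot> f = q \<cdot> g"
  using assms by (auto simp: is_coequalizer_def parallel_def)

lemma coequalizer_factor:
  assumes q: "is_coequalizer C f g q" and h: "h \<in> Arr C" "Dom C h = Cod C f" "h \<cdot> f = h \<cdot> g"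
  shows "factor C q h \<in> hom C (Cod C q) (Cod C h)" "factor C q h \<cdot> q = h"
proof -
  have "\<exists>!k. k \<in> hom C (Cod C q) (Cod C h) \<and> k \<cdot> q = h"
    using q h by (simp add: is_coequalizer_def)
  from theI'[OF this] show "factor C q h \<in> hom C (Cod C q) (Cod C h)" "factor C q h \<cdot> q = h"
    by (simp_all add: factor_def)
qed

lemma coequalizer_epi:
  assumes q: "is_coequalizer C f g q"
    and k: "k \<in> Arr C" "k' \<in> Arr C" "Dom C k = Cod C q" "Dom C k' = Cod C q" "k \<cdot> q = k' \<cdot> q"
  shows "k = k'"
proof -
  note t = coequalizerD[OF q]
  let ?h = "k \<cdot> q"
  have "?h \<cdot> f = ?h \<cdot> g" using t k by simp
  moreover have "?h \<in> Arr C" "Dom C ?h = Cod C f" using t k by simp_all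
  ultimately have ex: "\<exists>!j. j \<in> hom C (Cod C q) (Cod C ?h) \<and> j \<cdot> q = ?h"
    using q unfolding is_coequalizer_def by blast
  have "Cod C ?h = Cod C k" using t k(1,3) by simp
  moreover have "Cod C ?h = Cod C k'" unfolding k(5) using t k(2,4) by simp
  ultimately have "k \<in> hom C (Cod C q) (Cod C ?h)" "k' \<in> hom C (Cod C q) (Cod C ?h)"
    using k(1-4) by (auto simp: hom_def)
  with ex k(5) show ?thesis by metis
qed

lemma factor_eqI:
  assumes "k \<in> hom C (Cod C q) (Cod C h)" "k \<cdot> q = h"
    and "\<And>k'. k' \<in> hom C (Cod C q) (Cod C h) \<Longrightarrow> k' \<cdot> q = h \<Longrightarrow> k' = k"
  shows "factor C q h = k"
  unfolding factor_def using assms by (intro the_equality conjI) blast+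

lemma coeq_is_coequalizer:
  assumes "has_coequalizers C" "parallel C f g"
  shows "is_coequalizer C f g (coeq C f g)"
  using assms unfolding has_coequalizers_def coeq_def by (metis someI_ex)

end

text \<open>The splitting is required to exist, without being part of the data. Since it consists of equations
  only, it is carried along by tensoring with any object.\<close>

definition split_coequalizer ::
    "('o, 'a, 'z) cat_scheme \<Rightarrow> 'a \<Rightarrow> 'a \<Rightarrow> 'a \<Rightarrow> bool" where
  "split_coequalizer C f g e \<longleftrightarrow> parallel C f g \<and> e \<in> Arr C \<and> Dom C e = Cod C f \<and>
     e \<cdot>\<^bsub>C\<^esub> f = e \<cdot>\<^bsub>C\<^esub> g \<and>
     (\<exists>s t. s \<in> hom C (Cod C e) (Cod C f) \<and> t \<in> hom C (Cod C f) (Dom C f) \<and>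
        e \<cdot>\<^bsub>C\<^esub> s = \<one>\<^bsub>C\<^esub> (Cod C e) \<and> f \<cdot>\<^bsub>C\<^esub> t = s \<cdot>\<^bsub>C\<^esub> e \<and> g \<cdot>\<^bsub>C\<^esub> t = \<one>\<^bsub>C\<^esub> (Cod C f))"

lemma split_coequalizerI:
  assumes "f \<in> Arr C" "g \<in> Arr C" "Dom C g = Dom C f" "Cod C g = Cod C f"
    and "e \<in> Arr C" "Dom C e = Cod C f" "e \<cdot>\<^bsub>C\<^esub> f = e \<cdot>\<^bsub>C\<^esub> g"
    and "s \<in> Arr C" "Dom C s = Cod C e" "Cod C s = Cod C f"
    and "t \<in> Arr C" "Dom C t = Cod C f" "Cod C t = Dom C f"
    and "e \<cdot>\<^bsub>C\<^esub> s = \<one>\<^bsub>C\<^esub> (Cod C e)" "f \<cdot>\<^bsub>C\<^esub> t = s \<cdot>\<^bsub>C\<^esub> e" "g \<cdot>\<^bsub>C\<^esub> t = \<one>\<^bsub>C\<^esub> (Cod C f)"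
  shows "split_coequalizer C f g e"
  unfolding split_coequalizer_def parallel_def hom_def using assms
  by (intro conjI exI[of _ s] exI[of _ t]; simp)

lemma split_coequalizerE:
  assumes "split_coequalizer C f g e"
  obtains s t where "f \<in> Arr C" "g \<in> Arr C" "Dom C g = Dom C f" "Cod C g = Cod C f"
    "e \<in> Arr C" "Dom C e = Cod C f" "e \<cdot>\<^bsub>C\<^esub> f = e \<cdot>\<^bsub>C\<^esub> g"
    "s \<in> Arr C" "Dom C s = Cod C e" "Cod C s = Cod C f"
    "t \<in> Arr C" "Dom C t = Cod C f" "Cod C t = Dom C f"
    "e \<cdot>\<^bsub>C\<^esub> s = \<one>\<^bsub>C\<^esub> (Cod C e)" "f \<cdot>\<^bsub>C\<^esub> t = s \<cdot>\<^bsub>C\<^esub> e" "g \<cdot>\<^bsub>C\<^esub> t = \<one>\<^bsub>C\<^esub> (Cod C f)"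
  using assms unfolding split_coequalizer_def parallel_def hom_def by auto

context category
begin

lemma split_coequalizer_is_coequalizer:
  assumes "split_coequalizer C f g e"
  shows "is_coequalizer C f g e"
  using assms
proof (rule split_coequalizerE)
  fix s t
  assume t: "f \<in> Arr C" "g \<in> Arr C" "Dom C g = Dom C f" "Cod C g = Cod C f"
    "e \<in> Arr C" "Dom C e = Cod C f"
    "s \<in> Arr C" "Dom C s = Cod C e" "Cod C s = Cod C f"
    "t \<in> Arr C" "Dom C t = Cod C f" "Cod C t = Dom C f"
    and fork: "e \<cdot> f = e \<cdot> g"
    and st: "e \<cdot> s = \<one> (Cod C e)" "f \<cdot> t = s \<cdot> e" "g \<cdot> t = \<one> (Cod C f)"
  have "\<exists>!k. k \<in> hom C (Cod C e) (Cod C h) \<and> k \<cdot> e = h"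
    if h: "h \<in> Arr C" "Dom C h = Cod C f" "h \<cdot> f = h \<cdot> g" for h
  proof (rule ex1I[of _ "h \<cdot> s"])
    have "(h \<cdot> f) \<cdot> t = (h \<cdot> g) \<cdot> t" using h by simp
    then have "h \<cdot> s \<cdot> e = h" using t h(1,2) st(2,3) by simp
    then show "h \<cdot> s \<in> hom C (Cod C e) (Cod C h) \<and> (h \<cdot> s) \<cdot> e = h"
      using t h by (simp add: hom_def)
  next
    fix k assume k: "k \<in> hom C (Cod C e) (Cod C h) \<and> k \<cdot> e = h"
    then have "h \<cdot> s = k \<cdot> e \<cdot> s" using t by (auto simp: hom_def)
    then show "k = h \<cdot> s" using k t st(1) by (simp add: hom_def)
  qed
  then show ?thesis
    unfolding is_coequalizer_def parallel_def by (intro conjI ballI impI; simp add: t fork)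
qed

lemma coequalizers_isomorphic:
  assumes e: "is_coequalizer C f g e" and q: "is_coequalizer C f g q"
  obtains u v where "u \<in> hom C (Cod C q) (Cod C e)" "v \<in> hom C (Cod C e) (Cod C q)"
    "u = factor C q e" "u \<cdot> q = e" "v \<cdot> e = q" "u \<cdot> v = \<one> (Cod C e)" "v \<cdot> u = \<one> (Cod C q)"
proof -
  note te = coequalizerD[OF e] and tq = coequalizerD[OF q]
  define u v where "u = factor C q e" and "v = factor C e q"
  have u: "u \<in> hom C (Cod C q) (Cod C e)" "u \<cdot> q = e"
    and v: "v \<in> hom C (Cod C e) (Cod C q)" "v \<cdot> e = q"
    unfolding u_def v_def
    using coequalizer_factor[OF q te(3,6,7)] coequalizer_factor[OF e tq(3,6,7)] by simp_all
  note [simp] = homD[OF u(1)] homD[OF v(1)] te(1-6) tq(3,6) u(2) v(2)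
  have "u \<cdot> v = \<one> (Cod C e)" by (rule coequalizer_epi[OF e]) simp_all
  moreover have "v \<cdot> u = \<one> (Cod C q)" by (rule coequalizer_epi[OF q]) simp_all
  ultimately show thesis using that[of u v] u v u_def by blast
qed

text \<open>If \<open>u\<close> is the isomorphism from \<open>q\<close> to the split coequalizer \<open>e\<close> with section \<open>s\<close>, then
  \<open>s \<cdot> u\<close> is a section of \<open>q\<close>. In this way the coequalizers obtained by choice turn out to be
  split.\<close>

lemma split_coequalizer_transfer:
  assumes e: "split_coequalizer C f g e" and q: "is_coequalizer C f g q"
  shows "split_coequalizer C f g q"
proof -
  from e obtain s t where st: "f \<in> Arr C" "g \<in> Arr C" "Dom C g = Dom C f" "Cod C g = Cod C f"
    "e \<in> Arr C" "Dom C e = Cod C f"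
    "s \<in> Arr C" "Dom C s = Cod C e" "Cod C s = Cod C f"
    "t \<in> Arr C" "Dom C t = Cod C f" "Cod C t = Dom C f"
    "e \<cdot> s = \<one> (Cod C e)" "f \<cdot> t = s \<cdot> e" "g \<cdot> t = \<one> (Cod C f)"
    by (rule split_coequalizerE) blast
  obtain u v where uv: "u \<in> hom C (Cod C q) (Cod C e)" "v \<in> hom C (Cod C e) (Cod C q)"
    "u \<cdot> q = e" "v \<cdot> e = q" "u \<cdot> v = \<one> (Cod C e)" "v \<cdot> u = \<one> (Cod C q)"
    by (rule coequalizers_isomorphic[OF split_coequalizer_is_coequalizer[OF e] q])
  note q' = coequalizerD(3,6,7)[OF q]
  have "(v \<cdot> e) \<cdot> s = v" using st homD[OF uv(2)] by simp
  then have qs: "q \<cdot> s = v" by (simp only: uv(4))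
  have "q \<cdot> s \<cdot> u = (q \<cdot> s) \<cdot> u" using st homD[OF uv(1)] q'(1,2) by simp
  also have "\<dots> = \<one> (Cod C q)" by (simp only: qs uv)
  finally have "q \<cdot> s \<cdot> u = \<one> (Cod C q)" .
  then show ?thesis
    by (intro split_coequalizerI[where s = "s \<cdot> u" and t = t])
      (use st q' homD[OF uv(1)] uv(3) in simp_all)
qed

lemma split_coequalizer_epi:
  assumes "split_coequalizer C f g e"
    and "k \<in> Arr C" "k' \<in> Arr C" "Dom C k = Cod C e" "Dom C k' = Cod C e" "k \<cdot> e = k' \<cdot> e"
  shows "k = k'"
  using coequalizer_epi[OF split_coequalizer_is_coequalizer] assms by blast

end

lemma (in strict_monoidal_category) split_coequalizer_tensor:
  assumes "split_coequalizer C f g e" and [simp]: "X \<in> Obj C"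
  shows "split_coequalizer C (\<one> X \<otimes> f) (\<one> X \<otimes> g) (\<one> X \<otimes> e)"
  using assms(1)
proof (rule split_coequalizerE)
  fix s t
  assume [simp]: "f \<in> Arr C" "g \<in> Arr C" "Dom C g = Dom C f" "Cod C g = Cod C f"
    "e \<in> Arr C" "Dom C e = Cod C f" "e \<cdot> f = e \<cdot> g"
    "s \<in> Arr C" "Dom C s = Cod C e" "Cod C s = Cod C f"
    "t \<in> Arr C" "Dom C t = Cod C f" "Cod C t = Dom C f"
    "e \<cdot> s = \<one> (Cod C e)" "f \<cdot> t = s \<cdot> e" "g \<cdot> t = \<one> (Cod C f)"
  show ?thesis
    by (rule split_coequalizerI[where s = "\<one> X \<otimes> s" and t = "\<one> X \<otimes> t"])
      (simp_all del: whisker_left whisker_right flip: whisker_left)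
qed

context right_C_category
begin

lemma split_coequalizer_act_right:
  assumes "split_coequalizer D f g e" and [simp]: "X \<in> Obj C"
  shows "split_coequalizer D (f \<diamondop> \<one>\<^bsub>C\<^esub> X) (g \<diamondop> \<one>\<^bsub>C\<^esub> X) (e \<diamondop> \<one>\<^bsub>C\<^esub> X)"
  using assms(1)
proof (rule split_coequalizerE)
  fix s t
  assume [simp]: "f \<in> Arr D" "g \<in> Arr D" "Dom D g = Dom D f" "Cod D g = Cod D f"
    "e \<in> Arr D" "Dom D e = Cod D f" "e \<cdot> f = e \<cdot> g"
    "s \<in> Arr D" "Dom D s = Cod D e" "Cod D s = Cod D f"
    "t \<in> Arr D" "Dom D t = Cod D f" "Cod D t = Dom D f"
    "e \<cdot> s = \<one> (Cod D e)" "f \<cdot> t = s \<cdot> e" "g \<cdot> t = \<one> (Cod D f)"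
  show ?thesis
    by (rule split_coequalizerI[where s = "s \<diamondop> \<one>\<^bsub>C\<^esub> X" and t = "t \<diamondop> \<one>\<^bsub>C\<^esub> X"])
      (simp_all del: act_whisker_right flip: act_whisker_right)
qed

end

section \<open>The action of a monoidal category on itself\<close>

lemma self_simps [simp]:
  "Obj (self C) = Obj C" "Arr (self C) = Arr C" "Dom (self C) = Dom C" "Cod (self C) = Cod C"
  "Idn (self C) = Idn C" "Cmp (self C) = Cmp C" "aob (self C) = tob C" "aar (self C) = tar C"
  by (simp_all add: self_def)

lemma self_notions [simp]:
  "hom (self C) = hom C" "parallel (self C) = parallel C"
  "is_coequalizer (self C) = is_coequalizer C" "factor (self C) = factor C"
  "has_coequalizers (self C) = has_coequalizers C" "coeq (self C) = coeq C"
  "split_coequalizer (self C) = split_coequalizer C"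
  "inverse_arrows (self C) = inverse_arrows C" "is_iso (self C) = is_iso C"
proof -
  show 1: "hom (self C) = hom C" "parallel (self C) = parallel C"
    by (auto simp: fun_eq_iff hom_def parallel_def)
  then show 2: "is_coequalizer (self C) = is_coequalizer C" "factor (self C) = factor C"
    by (auto simp: fun_eq_iff is_coequalizer_def factor_def)
  show "has_coequalizers (self C) = has_coequalizers C" "coeq (self C) = coeq C"
    by (auto simp: fun_eq_iff has_coequalizers_def coeq_def 1 2)
  show "split_coequalizer (self C) = split_coequalizer C"
    by (auto simp: fun_eq_iff split_coequalizer_def 1)
  show 3: "inverse_arrows (self C) = inverse_arrows C"
    by (auto simp: fun_eq_iff inverse_arrows_def 1)
  show "is_iso (self C) = is_iso C"
    by (auto simp: fun_eq_iff is_iso_def 3)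
qed

lemma (in strict_monoidal_category) self_right_C_category: "right_C_category C (self C)"
proof unfold_locales
qed (auto simp: hom_def interchange_typed)

lemma part_simps [simp]:
  "lob (left_part Y) = bob Y" "lact (left_part Y) = blact Y"
  "rob (right_part Y) = bob Y" "ract (right_part Y) = bract Y"
  "bob (regular_bimod A) = alg A" "blact (regular_bimod A) = mul A" "bract (regular_bimod A) = mul A"
  "rob (mod_part N) = rob N" "ract (mod_part N) = ract N"
  by (simp_all add: left_part_def right_part_def regular_bimod_def mod_part_def)

section \<open>Algebras and Kleisli extension\<close>

locale monoidal_algebra = strict_monoidal_category C
  for C :: "('o, 'a) mcat" (structure) +
  fixes A :: "('o, 'a) algebra"
  assumes algebra: "is_algebra C A"
begin

lemma algebra_simps [simp]:
  "alg A \<in> Obj C" "mul A \<in> Arr C" "Dom C (mul A) = alg A \<otimes>\<^sub>o alg A" "Cod C (mul A) = alg A"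
  "eta A \<in> Arr C" "Dom C (eta A) = uob C" "Cod C (eta A) = alg A"
  using algebra by (auto simp: is_algebra_def hom_def)

lemma algebra_eqs:
  "mul A \<cdot> (mul A \<otimes> \<one> alg A) = mul A \<cdot> (\<one> alg A \<otimes> mul A)"
  "mul A \<cdot> (eta A \<otimes> \<one> alg A) = \<one> alg A"
  "mul A \<cdot> (\<one> alg A \<otimes> eta A) = \<one> alg A"
  using algebra by (auto simp: is_algebra_def hom_def)

lemma algebra_whisker:
  assumes "W \<in> Obj C"
  shows "(mul A \<otimes> \<one> W) \<cdot> (mul A \<otimes> \<one> (alg A \<otimes>\<^sub>o W))
      = (mul A \<otimes> \<one> W) \<cdot> (\<one> alg A \<otimes> mul A \<otimes> \<one> W)"
    "(mul A \<otimes> \<one> W) \<cdot> (eta A \<otimes> \<one> (alg A \<otimes>\<^sub>o W)) = \<one> (alg A \<otimes>\<^sub>o W)"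
    "(mul A \<otimes> \<one> W) \<cdot> (\<one> alg A \<otimes> eta A \<otimes> \<one> W) = \<one> (alg A \<otimes>\<^sub>o W)"
  using algebra_eqs[THEN arg_cong, of "\<lambda>x. x \<otimes> \<one> W"] assms by simp_all

text \<open>The Kleisli extension of \<open>g : V \<rightarrow> A \<otimes> W\<close> for the monad \<open>A \<otimes> -\<close>, that is, the unique left linear
  morphism \<open>A \<otimes> V \<rightarrow> A \<otimes> W\<close> that restricts to \<open>g\<close> along the unit.\<close>

definition extension :: "'o \<Rightarrow> 'a \<Rightarrow> 'a" where
  "extension W g = (mul A \<otimes> \<one> W) \<cdot> (\<one> alg A \<otimes> g)"

context
  fixes W :: 'o and g :: 'a
  assumes [simp]: "W \<in> Obj C" "g \<in> Arr C" "Cod C g = alg A \<otimes>\<^sub>o W"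
begin

lemma extension_typing [simp]:
  "extension W g \<in> Arr C" "Dom C (extension W g) = alg A \<otimes>\<^sub>o Dom C g" "Cod C (extension W g) = alg A \<otimes>\<^sub>o W"
  by (simp_all add: extension_def)

lemma extension_unit:
  assumes [simp]: "Dom C g = V"
  shows "extension W g \<cdot> (eta A \<otimes> \<one> V) = g"
proof -
  have [simp]: "V \<in> Obj C" using Dom_Obj[of g] by simp
  have "extension W g \<cdot> (eta A \<otimes> \<one> V) = (mul A \<otimes> \<one> W) \<cdot> (eta A \<otimes> \<one> (alg A \<otimes>\<^sub>o W)) \<cdot> g"
    using slide[of "eta A" g] by (simp add: extension_def)
  then show ?thesis by (simp add: reassoc[OF algebra_whisker(2)])
qed

lemma extension_linear:
  assumes [simp]: "Dom C g = V"
  shows "extension W g \<cdot> (mul A \<otimes> \<one> V) = (mul A \<otimes> \<one> W) \<cdot> (\<one> alg A \<otimes> extension W g)"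
proof -
  have [simp]: "V \<in> Obj C" using Dom_Obj[of g] by simp
  have "extension W g \<cdot> (mul A \<otimes> \<one> V)
      = (mul A \<otimes> \<one> W) \<cdot> (mul A \<otimes> \<one> (alg A \<otimes>\<^sub>o W)) \<cdot> (\<one> (alg A \<otimes>\<^sub>o alg A) \<otimes> g)"
    using slide[of "mul A" g] by (simp add: extension_def)
  then show ?thesis by (simp add: extension_def reassoc_square[OF algebra_whisker(1)])
qed

lemma extension_Cmp:
  assumes [simp]: "h \<in> Arr C" "Dom C g = V" "Cod C h = alg A \<otimes>\<^sub>o V"
  shows "extension W g \<cdot> extension V h = extension W (extension W g \<cdot> h)"
proof -
  have [simp]: "V \<in> Obj C" using Dom_Obj[of g] by simp
  have "extension W g \<cdot> extension V h = (extension W g \<cdot> (mul A \<otimes> \<one> V)) \<cdot> (\<one> alg A \<otimes> h)"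
    by (simp add: extension_def[of V])
  also have "\<dots> = extension W (extension W g \<cdot> h)"
    unfolding extension_linear[OF assms(2)] by (simp add: extension_def[of W "extension W g \<cdot> h"])
  finally show ?thesis .
qed

lemma extension_precompose:
  assumes [simp]: "k \<in> Arr C" "Cod C k = Dom C g"
  shows "extension W (g \<cdot> k) = extension W g \<cdot> (\<one> alg A \<otimes> k)"
  by (simp add: extension_def)

lemma extension_whisker:
  assumes [simp]: "Z \<in> Obj C"
  shows "extension W g \<otimes> \<one> Z = extension (W \<otimes>\<^sub>o Z) (g \<otimes> \<one> Z)"
  by (simp add: extension_def)

end

lemma extension_eta: "W \<in> Obj C \<Longrightarrow> extension W (eta A \<otimes> \<one> W) = \<one> (alg A \<otimes>\<^sub>o W)"
  by (simp add: extension_def algebra_whisker(3))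

end

section \<open>Modules and balanced actions\<close>

locale algebra_action = right_C_category C D + C: monoidal_algebra C A
  for C :: "('o, 'a) mcat" and D :: "('p, 'b, 'o, 'a) rcat" (structure)
    and A :: "('o, 'a) algebra" +
  assumes C_coequalizers: "has_coequalizers C"
    and D_coequalizers: "has_coequalizers D"
begin

lemma self_action: "algebra_action C (self C) A"
  by (intro algebra_action.intro C.self_right_C_category C.monoidal_algebra_axioms
      algebra_action_axioms.intro)
    (simp_all add: C_coequalizers D_coequalizers)

lemma right_moduleD:
  assumes "right_module D C A M"
  shows "rob M \<in> Obj D" "ract M \<in> Arr D" "Dom D (ract M) = rob M \<diamondop>\<^sub>o alg A" "Cod D (ract M) = rob M"
    "ract M \<cdot> (ract M \<diamondop> \<one>\<^bsub>C\<^esub> alg A) = ract M \<cdot> (\<one> rob M \<diamondop> mul A)"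
    "ract M \<cdot> (\<one> rob M \<diamondop> eta A) = \<one> rob M"
  using assms by (auto simp: right_module_def hom_def)

lemma left_moduleD:
  assumes "left_module C A Y"
  shows "lob Y \<in> Obj C" "lact Y \<in> Arr C" "Dom C (lact Y) = alg A \<otimes>\<^sub>o\<^bsub>C\<^esub> lob Y" "Cod C (lact Y) = lob Y"
    "lact Y \<cdot>\<^bsub>C\<^esub> (\<one>\<^bsub>C\<^esub> alg A \<otimes>\<^bsub>C\<^esub> lact Y) = lact Y \<cdot>\<^bsub>C\<^esub> (mul A \<otimes>\<^bsub>C\<^esub> \<one>\<^bsub>C\<^esub> lob Y)"
    "lact Y \<cdot>\<^bsub>C\<^esub> (eta A \<otimes>\<^bsub>C\<^esub> \<one>\<^bsub>C\<^esub> lob Y) = \<one>\<^bsub>C\<^esub> lob Y"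
  using assms by (auto simp: left_module_def hom_def)

lemma bimoduleD:
  assumes "bimodule C A Y"
  shows "left_module C A (left_part Y)" "right_module (self C) C A (right_part Y)"
    "bob Y \<in> Obj C" "blact Y \<in> Arr C" "Dom C (blact Y) = alg A \<otimes>\<^sub>o\<^bsub>C\<^esub> bob Y" "Cod C (blact Y) = bob Y"
    "bract Y \<in> Arr C" "Dom C (bract Y) = bob Y \<otimes>\<^sub>o\<^bsub>C\<^esub> alg A" "Cod C (bract Y) = bob Y"
    "bract Y \<cdot>\<^bsub>C\<^esub> (bract Y \<otimes>\<^bsub>C\<^esub> \<one>\<^bsub>C\<^esub> alg A) = bract Y \<cdot>\<^bsub>C\<^esub> (\<one>\<^bsub>C\<^esub> bob Y \<otimes>\<^bsub>C\<^esub> mul A)"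
    "bract Y \<cdot>\<^bsub>C\<^esub> (\<one>\<^bsub>C\<^esub> bob Y \<otimes>\<^bsub>C\<^esub> eta A) = \<one>\<^bsub>C\<^esub> bob Y"
    "bract Y \<cdot>\<^bsub>C\<^esub> (blact Y \<otimes>\<^bsub>C\<^esub> \<one>\<^bsub>C\<^esub> alg A) = blact Y \<cdot>\<^bsub>C\<^esub> (\<one>\<^bsub>C\<^esub> alg A \<otimes>\<^bsub>C\<^esub> bract Y)"
  using assms by (auto simp: bimodule_def left_module_def right_module_def hom_def)

lemma quo_is_coequalizer:
  assumes "right_module D C A M" "left_module C A Y"
  shows "is_coequalizer D (ract M \<diamondop> \<one>\<^bsub>C\<^esub> lob Y) (\<one> rob M \<diamondop> lact Y) (quo D C M Y)"
  unfolding quo_def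
  by (rule coeq_is_coequalizer[OF D_coequalizers])
    (use right_moduleD[OF assms(1)] left_moduleD[OF assms(2)] in \<open>simp add: parallel_def\<close>)

lemma quo_simps:
  assumes "right_module D C A M" "left_module C A Y"
  shows "quo D C M Y \<in> Arr D" "Dom D (quo D C M Y) = rob M \<diamondop>\<^sub>o lob Y"
    "Cod D (quo D C M Y) = bal_ob D C M Y" "bal_ob D C M Y \<in> Obj D"
    "quo D C M Y \<cdot> (ract M \<diamondop> \<one>\<^bsub>C\<^esub> lob Y) = quo D C M Y \<cdot> (\<one> rob M \<diamondop> lact Y)"
  using coequalizerD[OF quo_is_coequalizer[OF assms]] right_moduleD[OF assms(1)] left_moduleD[OF assms(2)]
  by (auto simp: bal_ob_def)

text \<open>Linearity of \<open>g\<close> and \<open>h\<close> makes \<open>q' \<cdot> (g \<diamondop> h)\<close> coequalize the pair that defines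
  \<open>M \<diamondop>\<^sub>A Y\<close>. The resulting equation is all that is used about \<open>g \<diamondop>\<^sub>A h\<close>.\<close>

lemma bal_ar_quo:
  assumes M: "right_module D C A M" "right_module D C A M'"
    and Y: "left_module C A Y" "left_module C A Y'"
    and g: "right_linear D C A M M' g" and h: "left_linear C A Y Y' h"
  shows "bal_ar D C M M' Y Y' g h \<in> Arr D" "Dom D (bal_ar D C M M' Y Y' g h) = bal_ob D C M Y"
    "Cod D (bal_ar D C M M' Y Y' g h) = bal_ob D C M' Y'"
    "bal_ar D C M M' Y Y' g h \<cdot> quo D C M Y = quo D C M' Y' \<cdot> (g \<diamondop> h)"
proof -
  let ?q = "quo D C M Y" and ?q' = "quo D C M' Y'"
  have [simp]: "g \<in> Arr D" "Dom D g = rob M" "Cod D g = rob M'"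
    "h \<in> Arr C" "Dom C h = lob Y" "Cod C h = lob Y'"
    using g h by (auto simp: right_linear_def left_linear_def hom_def)
  note [simp] = right_moduleD[OF M(1)] right_moduleD[OF M(2)] left_moduleD[OF Y(1)] left_moduleD[OF Y(2)]
    quo_simps[OF M(1) Y(1)] quo_simps[OF M(2) Y(2)]
  have "(g \<diamondop> h) \<cdot> (ract M \<diamondop> \<one>\<^bsub>C\<^esub> lob Y) = (ract M' \<diamondop> \<one>\<^bsub>C\<^esub> lob Y') \<cdot> (g \<diamondop> (\<one>\<^bsub>C\<^esub> alg A \<otimes>\<^bsub>C\<^esub> h))"
    using g by (simp add: act_interchange_typed right_linear_def flip: aar_assoc_typed)
  then have "?q' \<cdot> (g \<diamondop> h) \<cdot> (ract M \<diamondop> \<one>\<^bsub>C\<^esub> lob Y)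
      = ?q' \<cdot> (ract M' \<diamondop> \<one>\<^bsub>C\<^esub> lob Y') \<cdot> (g \<diamondop> (\<one>\<^bsub>C\<^esub> alg A \<otimes>\<^bsub>C\<^esub> h))"
    by (rule arg_cong)
  also have "\<dots> = ?q' \<cdot> (\<one> rob M' \<diamondop> lact Y') \<cdot> (g \<diamondop> (\<one>\<^bsub>C\<^esub> alg A \<otimes>\<^bsub>C\<^esub> h))"
    by (simp add: reassoc_square[OF quo_simps(5)[OF M(2) Y(2)]])
  also have "\<dots> = ?q' \<cdot> (g \<diamondop> (lact Y' \<cdot>\<^bsub>C\<^esub> (\<one>\<^bsub>C\<^esub> alg A \<otimes>\<^bsub>C\<^esub> h)))"
    by (simp add: act_interchange_typed)
  also have "\<dots> = ?q' \<cdot> (g \<diamondop> h) \<cdot> (\<one> rob M \<diamondop> lact Y)"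
    using h by (simp add: act_interchange_typed left_linear_def)
  finally have eq: "?q' \<cdot> (g \<diamondop> h) \<cdot> (ract M \<diamondop> \<one>\<^bsub>C\<^esub> lob Y) = ?q' \<cdot> (g \<diamondop> h) \<cdot> (\<one> rob M \<diamondop> lact Y)" .
  have "bal_ar D C M M' Y Y' g h \<in> hom D (Cod D ?q) (Cod D (?q' \<cdot> (g \<diamondop> h)))"
    "bal_ar D C M M' Y Y' g h \<cdot> ?q = ?q' \<cdot> (g \<diamondop> h)"
    unfolding bal_ar_def
    by (rule coequalizer_factor[OF quo_is_coequalizer[OF M(1) Y(1)]]; use eq in simp)+
  then show "bal_ar D C M M' Y Y' g h \<in> Arr D" "Dom D (bal_ar D C M M' Y Y' g h) = bal_ob D C M Y"
    "Cod D (bal_ar D C M M' Y Y' g h) = bal_ob D C M' Y'"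
    "bal_ar D C M M' Y Y' g h \<cdot> quo D C M Y = quo D C M' Y' \<cdot> (g \<diamondop> h)"
    by (auto simp: hom_def)
qed

lemma regular_bimodule: "bimodule C A (regular_bimod A)"
  by (auto simp: bimodule_def left_module_def right_module_def hom_def C.algebra_eqs)

lemma runit_quo:
  assumes M: "right_module D C A M"
  defines "q \<equiv> quo D C M (left_part (regular_bimod A))"
  shows "runit_c D C A M \<in> Arr D" "Dom D (runit_c D C A M) = bal_ob D C M (left_part (regular_bimod A))"
    "Cod D (runit_c D C A M) = rob M" "runit_c D C A M \<cdot> q = ract M"
proof -
  have q: "is_coequalizer D (ract M \<diamondop> \<one>\<^bsub>C\<^esub> alg A) (\<one> rob M \<diamondop> mul A) q"
    unfolding q_def using quo_is_coequalizer[OF M bimoduleD(1)[OF regular_bimodule]] by simp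
  note [simp] = right_moduleD[OF M]
  have "runit_c D C A M \<in> hom D (Cod D q) (Cod D (ract M))" "runit_c D C A M \<cdot> q = ract M"
    unfolding runit_c_def q_def[symmetric]
    by (rule coequalizer_factor[OF q]; simp)+
  then show "runit_c D C A M \<in> Arr D" "Dom D (runit_c D C A M) = bal_ob D C M (left_part (regular_bimod A))"
    "Cod D (runit_c D C A M) = rob M" "runit_c D C A M \<cdot> q = ract M"
    by (auto simp: hom_def q_def bal_ob_def)
qed

end

section \<open>Free left modules\<close>

text \<open>The isomorphism \<open>\<phi>\<close> with \<open>A \<otimes> W\<close> and its inverse \<open>\<phi>'\<close> are part of the data, because the module
  \<open>K \<otimes>\<^sub>A K\<close> of interest lives on a chosen coequalizer and is free only up to isomorphism.\<close>

definition free_via ::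
    "('o, 'a) mcat \<Rightarrow> ('o, 'a) algebra \<Rightarrow> ('o, 'a) lmod \<Rightarrow> 'o \<Rightarrow> 'a \<Rightarrow> 'a \<Rightarrow> bool" where
  "free_via C A Y W \<phi> \<phi>' \<longleftrightarrow> left_module C A Y \<and> W \<in> Obj C \<and>
     \<phi> \<in> hom C (lob Y) (alg A \<otimes>\<^sub>o\<^bsub>C\<^esub> W) \<and> \<phi>' \<in> hom C (alg A \<otimes>\<^sub>o\<^bsub>C\<^esub> W) (lob Y) \<and>
     \<phi>' \<cdot>\<^bsub>C\<^esub> \<phi> = \<one>\<^bsub>C\<^esub> lob Y \<and> \<phi> \<cdot>\<^bsub>C\<^esub> \<phi>' = \<one>\<^bsub>C\<^esub> (alg A \<otimes>\<^sub>o\<^bsub>C\<^esub> W) \<and>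
     \<phi> \<cdot>\<^bsub>C\<^esub> lact Y = (mul A \<otimes>\<^bsub>C\<^esub> \<one>\<^bsub>C\<^esub> W) \<cdot>\<^bsub>C\<^esub> (\<one>\<^bsub>C\<^esub> alg A \<otimes>\<^bsub>C\<^esub> \<phi>)"

definition free_left_module :: "('o, 'a) mcat \<Rightarrow> ('o, 'a) algebra \<Rightarrow> ('o, 'a) lmod \<Rightarrow> bool" where
  "free_left_module C A Y \<longleftrightarrow> (\<exists>W \<phi> \<phi>'. free_via C A Y W \<phi> \<phi>')"

context algebra_action
begin

lemma free_viaD:
  assumes "free_via C A Y W \<phi> \<phi>'"
  shows "left_module C A Y" "W \<in> Obj C"
    "\<phi> \<in> Arr C" "Dom C \<phi> = lob Y" "Cod C \<phi> = alg A \<otimes>\<^sub>o\<^bsub>C\<^esub> W"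
    "\<phi>' \<in> Arr C" "Dom C \<phi>' = alg A \<otimes>\<^sub>o\<^bsub>C\<^esub> W" "Cod C \<phi>' = lob Y"
    "\<phi>' \<cdot>\<^bsub>C\<^esub> \<phi> = \<one>\<^bsub>C\<^esub> lob Y" "\<phi> \<cdot>\<^bsub>C\<^esub> \<phi>' = \<one>\<^bsub>C\<^esub> (alg A \<otimes>\<^sub>o\<^bsub>C\<^esub> W)"
    "\<phi> \<cdot>\<^bsub>C\<^esub> lact Y = (mul A \<otimes>\<^bsub>C\<^esub> \<one>\<^bsub>C\<^esub> W) \<cdot>\<^bsub>C\<^esub> (\<one>\<^bsub>C\<^esub> alg A \<otimes>\<^bsub>C\<^esub> \<phi>)"
  using assms by (auto simp: free_via_def hom_def)

lemma right_module_whisker: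
  assumes M: "right_module D C A M" and W: "W \<in> Obj C"
  shows "(ract M \<diamondop> \<one>\<^bsub>C\<^esub> W) \<cdot> (ract M \<diamondop> \<one>\<^bsub>C\<^esub> (alg A \<otimes>\<^sub>o\<^bsub>C\<^esub> W)) = (ract M \<diamondop> \<one>\<^bsub>C\<^esub> W) \<cdot> (\<one> rob M \<diamondop> (mul A \<otimes>\<^bsub>C\<^esub> \<one>\<^bsub>C\<^esub> W))"
    "(ract M \<diamondop> \<one>\<^bsub>C\<^esub> W) \<cdot> (\<one> rob M \<diamondop> (eta A \<otimes>\<^bsub>C\<^esub> \<one>\<^bsub>C\<^esub> W)) = \<one> (rob M \<diamondop>\<^sub>o W)"
  using arg_cong[OF right_moduleD(5)[OF M], of "\<lambda>x. x \<diamondop> \<one>\<^bsub>C\<^esub> W"]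
    arg_cong[OF right_moduleD(6)[OF M], of "\<lambda>x. x \<diamondop> \<one>\<^bsub>C\<^esub> W"] right_moduleD(1-4)[OF M] W
  by simp_all

text \<open>For \<open>Y = A \<otimes> W\<close> this is the canonical presentation of \<open>M\<close> by free modules, \<open>M \<diamondop> A \<diamondop> A \<rightrightarrows> M \<diamondop> A \<rightarrow> M\<close>,
  tensored with \<open>W\<close>. It is split by inserting a unit of \<open>A\<close> to the left of \<open>W\<close>.\<close>

lemma free_quotient:
  assumes M: "right_module D C A M" and Y: "free_via C A Y W \<phi> \<phi>'"
  shows "split_coequalizer D (ract M \<diamondop> \<one>\<^bsub>C\<^esub> lob Y) (\<one> rob M \<diamondop> lact Y)
    ((ract M \<diamondop> \<one>\<^bsub>C\<^esub> W) \<cdot> (\<one> rob M \<diamondop> \<phi>))"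
proof (rule split_coequalizerI)
  note [simp] = right_moduleD[OF M] free_viaD(2-)[OF Y] left_moduleD[OF free_viaD(1)[OF Y]]
  note [simp] = right_module_whisker(2)[OF M free_viaD(2)[OF Y]]
  let ?e = "(ract M \<diamondop> \<one>\<^bsub>C\<^esub> W) \<cdot> (\<one> rob M \<diamondop> \<phi>)"
  let ?s = "(\<one> rob M \<diamondop> \<phi>') \<cdot> (\<one> rob M \<diamondop> (eta A \<otimes>\<^bsub>C\<^esub> \<one>\<^bsub>C\<^esub> W))"
  let ?t = "(\<one> rob M \<diamondop> (\<one>\<^bsub>C\<^esub> alg A \<otimes>\<^bsub>C\<^esub> \<phi>')) \<cdot> (\<one> rob M \<diamondop> (\<one>\<^bsub>C\<^esub> alg A \<otimes>\<^bsub>C\<^esub> (eta A \<otimes>\<^bsub>C\<^esub> \<one>\<^bsub>C\<^esub> W))) \<cdot> (\<one> rob M \<diamondop> \<phi>)"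
  show "?e \<cdot> (ract M \<diamondop> \<one>\<^bsub>C\<^esub> lob Y) = ?e \<cdot> (\<one> rob M \<diamondop> lact Y)"
  proof -
    have "?e \<cdot> (\<one> rob M \<diamondop> lact Y) = (ract M \<diamondop> \<one>\<^bsub>C\<^esub> W) \<cdot> (\<one> rob M \<diamondop> (\<phi> \<cdot>\<^bsub>C\<^esub> lact Y))"
      by (simp del: free_viaD(11)[OF Y])
    also have "\<dots> = (ract M \<diamondop> \<one>\<^bsub>C\<^esub> W) \<cdot> (ract M \<diamondop> \<one>\<^bsub>C\<^esub> (alg A \<otimes>\<^sub>o\<^bsub>C\<^esub> W)) \<cdot> (\<one> rob M \<diamondop> (\<one>\<^bsub>C\<^esub> alg A \<otimes>\<^bsub>C\<^esub> \<phi>))"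
      by (simp add: reassoc_square[OF right_module_whisker(1)[OF M free_viaD(2)[OF Y]]])
    also have "\<dots> = ?e \<cdot> (ract M \<diamondop> \<one>\<^bsub>C\<^esub> lob Y)"
      using act_slide[of "ract M" \<phi>] by simp
    finally show ?thesis ..
  qed
  have \<phi>: "(\<one> rob M \<diamondop> \<phi>) \<cdot> (\<one> rob M \<diamondop> \<phi>') = \<one> (rob M \<diamondop>\<^sub>o (alg A \<otimes>\<^sub>o\<^bsub>C\<^esub> W))"
    by (simp del: act_whisker_left flip: act_whisker_left)
  show "?e \<cdot> ?s = \<one> (Cod D ?e)"
    by (simp add: reassoc[OF \<phi>])
  from arg_cong[OF act_slide[of "ract M" "\<phi>' \<cdot>\<^bsub>C\<^esub> (eta A \<otimes>\<^bsub>C\<^esub> \<one>\<^bsub>C\<^esub> W)"], of "\<lambda>x. x \<cdot> (\<one> rob M \<diamondop> \<phi>)"]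
  show "(ract M \<diamondop> \<one>\<^bsub>C\<^esub> lob Y) \<cdot> ?t = ?s \<cdot> ?e"
    by simp
  show "(\<one> rob M \<diamondop> lact Y) \<cdot> ?t = \<one> (Cod D (ract M \<diamondop> \<one>\<^bsub>C\<^esub> lob Y))"
  proof -
    have 1: "lact Y \<cdot>\<^bsub>C\<^esub> (\<one>\<^bsub>C\<^esub> alg A \<otimes>\<^bsub>C\<^esub> \<phi>') = \<phi>' \<cdot>\<^bsub>C\<^esub> (mul A \<otimes>\<^bsub>C\<^esub> \<one>\<^bsub>C\<^esub> W)"
    proof -
      have "\<phi>' \<cdot>\<^bsub>C\<^esub> ((\<phi> \<cdot>\<^bsub>C\<^esub> lact Y) \<cdot>\<^bsub>C\<^esub> (\<one>\<^bsub>C\<^esub> alg A \<otimes>\<^bsub>C\<^esub> \<phi>')) = lact Y \<cdot>\<^bsub>C\<^esub> (\<one>\<^bsub>C\<^esub> alg A \<otimes>\<^bsub>C\<^esub> \<phi>')"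
        by (simp add: C.reassoc[OF free_viaD(9)[OF Y]] del: free_viaD(11)[OF Y])
      moreover have "\<phi>' \<cdot>\<^bsub>C\<^esub> ((\<phi> \<cdot>\<^bsub>C\<^esub> lact Y) \<cdot>\<^bsub>C\<^esub> (\<one>\<^bsub>C\<^esub> alg A \<otimes>\<^bsub>C\<^esub> \<phi>')) = \<phi>' \<cdot>\<^bsub>C\<^esub> (mul A \<otimes>\<^bsub>C\<^esub> \<one>\<^bsub>C\<^esub> W)"
        by (simp del: C.whisker_left flip: C.whisker_left)
      ultimately show ?thesis by simp
    qed
    have "(\<one> rob M \<diamondop> lact Y) \<cdot> ?t = \<one> rob M \<diamondop> (lact Y \<cdot>\<^bsub>C\<^esub> (\<one>\<^bsub>C\<^esub> alg A \<otimes>\<^bsub>C\<^esub> \<phi>') \<cdot>\<^bsub>C\<^esub> (\<one>\<^bsub>C\<^esub> alg A \<otimes>\<^bsub>C\<^esub> (eta A \<otimes>\<^bsub>C\<^esub> \<one>\<^bsub>C\<^esub> W)) \<cdot>\<^bsub>C\<^esub> \<phi>)"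
      by simp
    also have "lact Y \<cdot>\<^bsub>C\<^esub> (\<one>\<^bsub>C\<^esub> alg A \<otimes>\<^bsub>C\<^esub> \<phi>') \<cdot>\<^bsub>C\<^esub> (\<one>\<^bsub>C\<^esub> alg A \<otimes>\<^bsub>C\<^esub> (eta A \<otimes>\<^bsub>C\<^esub> \<one>\<^bsub>C\<^esub> W)) \<cdot>\<^bsub>C\<^esub> \<phi> = \<one>\<^bsub>C\<^esub> lob Y"
      by (simp add: C.reassoc_square[OF 1] C.reassoc[OF C.algebra_whisker(3)])
    finally show ?thesis by simp
  qed
qed (simp_all add: right_moduleD[OF M] free_viaD(2-)[OF Y] left_moduleD[OF free_viaD(1)[OF Y]])

text \<open>The isomorphism \<open>M \<diamondop>\<^sub>A Y \<rightarrow> M \<diamondop> W\<close> comes from the uniqueness of coequalizers. Its inverse is the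
  section of the split coequalizer followed by the quotient morphism, which gives the explicit
  formula for \<open>v\<close>.\<close>

lemma free_quotient_comparison:
  assumes M: "right_module D C A M" and Y: "free_via C A Y W \<phi> \<phi>'"
  defines "q \<equiv> quo D C M Y" and "p \<equiv> (ract M \<diamondop> \<one>\<^bsub>C\<^esub> W) \<cdot> (\<one> rob M \<diamondop> \<phi>)"
    and "u \<equiv> factor D (quo D C M Y) ((ract M \<diamondop> \<one>\<^bsub>C\<^esub> W) \<cdot> (\<one> rob M \<diamondop> \<phi>))"
    and "v \<equiv> quo D C M Y \<cdot> (\<one> rob M \<diamondop> (\<phi>' \<cdot>\<^bsub>C\<^esub> (eta A \<otimes>\<^bsub>C\<^esub> \<one>\<^bsub>C\<^esub> W)))"
  shows "u \<in> hom D (bal_ob D C M Y) (rob M \<diamondop>\<^sub>o W)" "v \<in> hom D (rob M \<diamondop>\<^sub>o W) (bal_ob D C M Y)"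
    "u \<cdot> q = p" "v \<cdot> p = q" "u \<cdot> v = \<one> (rob M \<diamondop>\<^sub>o W)" "v \<cdot> u = \<one> (bal_ob D C M Y)"
proof -
  note [simp] = right_moduleD[OF M] free_viaD(2-)[OF Y] left_moduleD[OF free_viaD(1)[OF Y]]
    right_module_whisker(2)[OF M free_viaD(2)[OF Y]] quo_simps[OF M free_viaD(1)[OF Y]]
  let ?s = "\<one> rob M \<diamondop> (\<phi>' \<cdot>\<^bsub>C\<^esub> (eta A \<otimes>\<^bsub>C\<^esub> \<one>\<^bsub>C\<^esub> W))"
  note p = split_coequalizer_is_coequalizer[OF free_quotient[OF M Y], folded p_def]
  note q = quo_is_coequalizer[OF M free_viaD(1)[OF Y], folded q_def]
  obtain u' v' where uv: "u' \<in> hom D (Cod D q) (Cod D p)" "v' \<in> hom D (Cod D p) (Cod D q)"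
    "u' = factor D q p" "u' \<cdot> q = p" "v' \<cdot> p = q" "u' \<cdot> v' = \<one> (Cod D p)" "v' \<cdot> u' = \<one> (Cod D q)"
    by (rule coequalizers_isomorphic[OF p q])
  have u: "u' = u" by (simp add: uv(3) u_def p_def q_def)
  have cod: "Cod D p = rob M \<diamondop>\<^sub>o W" "Cod D q = bal_ob D C M Y" by (simp_all add: p_def q_def)
  have "(\<one> rob M \<diamondop> \<phi>) \<cdot> (\<one> rob M \<diamondop> \<phi>') = \<one> (rob M \<diamondop>\<^sub>o (alg A \<otimes>\<^sub>o\<^bsub>C\<^esub> W))"
    by (simp del: act_whisker_left flip: act_whisker_left)
  then have ps: "p \<cdot> ?s = \<one> (rob M \<diamondop>\<^sub>o W)" by (simp add: p_def reassoc)
  have "v' = v' \<cdot> (p \<cdot> ?s)" unfolding ps using homD[OF uv(2)] by (simp add: cod)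
  also have "\<dots> = (v' \<cdot> p) \<cdot> ?s" using homD[OF uv(2)] by (simp add: p_def)
  also have "\<dots> = v" by (simp add: uv(5) v_def q_def)
  finally have v: "v' = v" .
  show "u \<in> hom D (bal_ob D C M Y) (rob M \<diamondop>\<^sub>o W)" "v \<in> hom D (rob M \<diamondop>\<^sub>o W) (bal_ob D C M Y)"
    "u \<cdot> q = p" "v \<cdot> p = q" "u \<cdot> v = \<one> (rob M \<diamondop>\<^sub>o W)" "v \<cdot> u = \<one> (bal_ob D C M Y)"
    using uv unfolding u v cod by blast+
qed

lemma quo_split:
  assumes "right_module D C A M" "free_left_module C A Y"
  shows "split_coequalizer D (ract M \<diamondop> \<one>\<^bsub>C\<^esub> lob Y) (\<one> rob M \<diamondop> lact Y) (quo D C M Y)"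
  using assms split_coequalizer_transfer[OF free_quotient quo_is_coequalizer] free_viaD(1)
  unfolding free_left_module_def by blast

text \<open>The quotient \<open>q\<close> is split, so \<open>q \<diamondop> A\<close> and \<open>q \<diamondop> A \<diamondop> A\<close> are again coequalizers. The first defines
  the action, and the second reduces its axioms to those of \<open>Y\<close>.\<close>

lemma bal_rmod_quo:
  assumes M: "right_module D C A M" and Y: "bimodule C A Y" and free: "free_left_module C A (left_part Y)"
  defines "q \<equiv> quo D C M (left_part Y)" and "B \<equiv> bal_rmod D C A M Y"
  shows "right_module D C A B" "rob B = bal_ob D C M (left_part Y)"
    "ract B \<cdot> (q \<diamondop> \<one>\<^bsub>C\<^esub> alg A) = q \<cdot> (\<one> rob M \<diamondop> bract Y)"
proof -
  note [simp] = right_moduleD[OF M] bimoduleD(3-9)[OF Y]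
    quo_simps(1-4)[OF M bimoduleD(1)[OF Y], folded q_def]
  note qq = quo_simps(5)[OF M bimoduleD(1)[OF Y], folded q_def, simplified]
  have split: "split_coequalizer D (ract M \<diamondop> \<one>\<^bsub>C\<^esub> bob Y) (\<one> rob M \<diamondop> blact Y) q"
    using quo_split[OF M free] by (simp add: q_def)
  have B: "rob B = bal_ob D C M (left_part Y)" "ract B = factor D (q \<diamondop> \<one>\<^bsub>C\<^esub> alg A) (q \<cdot> (\<one> rob M \<diamondop> bract Y))"
    by (simp_all add: B_def bal_rmod_def q_def)
  show "rob B = bal_ob D C M (left_part Y)" by (rule B)
  have eq: "q \<cdot> (\<one> rob M \<diamondop> bract Y) \<cdot> (ract M \<diamondop> \<one>\<^bsub>C\<^esub> (bob Y \<otimes>\<^sub>o\<^bsub>C\<^esub> alg A))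
      = q \<cdot> (\<one> rob M \<diamondop> bract Y) \<cdot> (\<one> rob M \<diamondop> (blact Y \<otimes>\<^bsub>C\<^esub> \<one>\<^bsub>C\<^esub> alg A))"
  proof -
    have "q \<cdot> (\<one> rob M \<diamondop> bract Y) \<cdot> (ract M \<diamondop> \<one>\<^bsub>C\<^esub> (bob Y \<otimes>\<^sub>o\<^bsub>C\<^esub> alg A))
        = q \<cdot> (ract M \<diamondop> \<one>\<^bsub>C\<^esub> bob Y) \<cdot> (\<one> rob M \<diamondop> (\<one>\<^bsub>C\<^esub> alg A \<otimes>\<^bsub>C\<^esub> bract Y))"
      using act_slide[of "ract M" "bract Y"] by simp
    also have "\<dots> = q \<cdot> (\<one> rob M \<diamondop> (blact Y \<cdot>\<^bsub>C\<^esub> (\<one>\<^bsub>C\<^esub> alg A \<otimes>\<^bsub>C\<^esub> bract Y)))"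
      by (simp add: reassoc_square[OF qq])
    also have "\<dots> = q \<cdot> (\<one> rob M \<diamondop> bract Y) \<cdot> (\<one> rob M \<diamondop> (blact Y \<otimes>\<^bsub>C\<^esub> \<one>\<^bsub>C\<^esub> alg A))"
      by (simp flip: bimoduleD(12)[OF Y])
    finally show ?thesis .
  qed
  note splitA = split_coequalizer_act_right[OF split C.algebra_simps(1), simplified]
  have "ract B \<in> hom D (Cod D (q \<diamondop> \<one>\<^bsub>C\<^esub> alg A)) (Cod D (q \<cdot> (\<one> rob M \<diamondop> bract Y)))"
    "ract B \<cdot> (q \<diamondop> \<one>\<^bsub>C\<^esub> alg A) = q \<cdot> (\<one> rob M \<diamondop> bract Y)"
    unfolding B(2)
    by (rule coequalizer_factor[OF split_coequalizer_is_coequalizer[OF splitA]]; use eq in simp)+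
  then have [simp]: "ract B \<in> Arr D" "Dom D (ract B) = bal_ob D C M (left_part Y) \<diamondop>\<^sub>o alg A"
      "Cod D (ract B) = bal_ob D C M (left_part Y)"
    and act: "ract B \<cdot> (q \<diamondop> \<one>\<^bsub>C\<^esub> alg A) = q \<cdot> (\<one> rob M \<diamondop> bract Y)"
    by (auto simp: hom_def)
  show "ract B \<cdot> (q \<diamondop> \<one>\<^bsub>C\<^esub> alg A) = q \<cdot> (\<one> rob M \<diamondop> bract Y)" by (rule act)
  have splitAA: "split_coequalizer D (ract M \<diamondop> \<one>\<^bsub>C\<^esub> (bob Y \<otimes>\<^sub>o\<^bsub>C\<^esub> alg A \<otimes>\<^sub>o\<^bsub>C\<^esub> alg A))
      (\<one> rob M \<diamondop> (blact Y \<otimes>\<^bsub>C\<^esub> \<one>\<^bsub>C\<^esub> (alg A \<otimes>\<^sub>o\<^bsub>C\<^esub> alg A))) (q \<diamondop> \<one>\<^bsub>C\<^esub> (alg A \<otimes>\<^sub>o\<^bsub>C\<^esub> alg A))"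
    using split_coequalizer_act_right[OF split, of "alg A \<otimes>\<^sub>o\<^bsub>C\<^esub> alg A"] by simp
  have "ract B \<cdot> (ract B \<diamondop> \<one>\<^bsub>C\<^esub> alg A) = ract B \<cdot> (\<one> rob B \<diamondop> mul A)"
  proof (rule split_coequalizer_epi[OF splitAA])
    have actA: "(ract B \<diamondop> \<one>\<^bsub>C\<^esub> alg A) \<cdot> (q \<diamondop> \<one>\<^bsub>C\<^esub> (alg A \<otimes>\<^sub>o\<^bsub>C\<^esub> alg A)) = (q \<diamondop> \<one>\<^bsub>C\<^esub> alg A) \<cdot> (\<one> rob M \<diamondop> (bract Y \<otimes>\<^bsub>C\<^esub> \<one>\<^bsub>C\<^esub> alg A))"
      using arg_cong[OF act, of "\<lambda>x. x \<diamondop> \<one>\<^bsub>C\<^esub> alg A"] by simp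
    have "(ract B \<cdot> (ract B \<diamondop> \<one>\<^bsub>C\<^esub> alg A)) \<cdot> (q \<diamondop> \<one>\<^bsub>C\<^esub> (alg A \<otimes>\<^sub>o\<^bsub>C\<^esub> alg A))
        = q \<cdot> (\<one> rob M \<diamondop> (bract Y \<cdot>\<^bsub>C\<^esub> (bract Y \<otimes>\<^bsub>C\<^esub> \<one>\<^bsub>C\<^esub> alg A)))"
      by (simp add: actA reassoc_square[OF act])
    also have "\<dots> = q \<cdot> (\<one> rob M \<diamondop> bract Y) \<cdot> (\<one> (rob M \<diamondop>\<^sub>o bob Y) \<diamondop> mul A)"
      by (simp add: bimoduleD(10)[OF Y])
    also have "\<dots> = ract B \<cdot> (q \<diamondop> \<one>\<^bsub>C\<^esub> alg A) \<cdot> (\<one> (rob M \<diamondop>\<^sub>o bob Y) \<diamondop> mul A)"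
      by (simp add: reassoc_square[OF act])
    also have "\<dots> = (ract B \<cdot> (\<one> rob B \<diamondop> mul A)) \<cdot> (q \<diamondop> \<one>\<^bsub>C\<^esub> (alg A \<otimes>\<^sub>o\<^bsub>C\<^esub> alg A))"
      using act_slide[of q "mul A"] by (simp add: B(1))
    finally show "(ract B \<cdot> (ract B \<diamondop> \<one>\<^bsub>C\<^esub> alg A)) \<cdot> (q \<diamondop> \<one>\<^bsub>C\<^esub> (alg A \<otimes>\<^sub>o\<^bsub>C\<^esub> alg A))
        = (ract B \<cdot> (\<one> rob B \<diamondop> mul A)) \<cdot> (q \<diamondop> \<one>\<^bsub>C\<^esub> (alg A \<otimes>\<^sub>o\<^bsub>C\<^esub> alg A))" .
  qed (simp_all add: B(1))
  moreover have "ract B \<cdot> (\<one> rob B \<diamondop> eta A) = \<one> rob B"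
  proof (rule split_coequalizer_epi[OF split])
    have "(ract B \<cdot> (\<one> rob B \<diamondop> eta A)) \<cdot> q = ract B \<cdot> (q \<diamondop> \<one>\<^bsub>C\<^esub> alg A) \<cdot> (\<one> (rob M \<diamondop>\<^sub>o bob Y) \<diamondop> eta A)"
      using act_slide[of q "eta A"] by (simp add: B(1))
    also have "\<dots> = q \<cdot> (\<one> rob M \<diamondop> (bract Y \<cdot>\<^bsub>C\<^esub> (\<one>\<^bsub>C\<^esub> bob Y \<otimes>\<^bsub>C\<^esub> eta A)))"
      by (simp add: reassoc_square[OF act])
    also have "\<dots> = \<one> rob B \<cdot> q" by (simp add: bimoduleD(11)[OF Y] B(1))
    finally show "(ract B \<cdot> (\<one> rob B \<diamondop> eta A)) \<cdot> q = \<one> rob B \<cdot> q" .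
  qed (simp_all add: B(1))
  ultimately show "right_module D C A B"
    by (simp add: right_module_def hom_def B(1))
qed

end

section \<open>Balanced products of bimodules\<close>

context algebra_action
begin

text \<open>The mirror image for the left action: now \<open>A \<otimes> q\<close> and \<open>A \<otimes> A \<otimes> q\<close> are coequalizers.\<close>

lemma bal_bimod_quo:
  assumes U: "bimodule C A U" and V: "bimodule C A V" and free: "free_left_module C A (left_part V)"
  defines "q \<equiv> quo (self C) C (right_part U) (left_part V)" and "B \<equiv> bal_bimod C A U V"
  shows "left_module C A (left_part B)" "right_part B = bal_rmod (self C) C A (right_part U) V"
    "bob B = Cod C q" "blact B \<cdot>\<^bsub>C\<^esub> (\<one>\<^bsub>C\<^esub> alg A \<otimes>\<^bsub>C\<^esub> q) = q \<cdot>\<^bsub>C\<^esub> (blact U \<otimes>\<^bsub>C\<^esub> \<one>\<^bsub>C\<^esub> bob V)"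
    "q \<in> Arr C" "Dom C q = bob U \<otimes>\<^sub>o\<^bsub>C\<^esub> bob V" "q \<cdot>\<^bsub>C\<^esub> (bract U \<otimes>\<^bsub>C\<^esub> \<one>\<^bsub>C\<^esub> bob V) = q \<cdot>\<^bsub>C\<^esub> (\<one>\<^bsub>C\<^esub> bob U \<otimes>\<^bsub>C\<^esub> blact V)"
    "split_coequalizer C (bract U \<otimes>\<^bsub>C\<^esub> \<one>\<^bsub>C\<^esub> bob V) (\<one>\<^bsub>C\<^esub> bob U \<otimes>\<^bsub>C\<^esub> blact V) q"
proof -
  interpret S: algebra_action C "self C" A by (rule self_action)
  note [simp] = bimoduleD(3-9)[OF U] bimoduleD(3-9)[OF V]
  show q [simp]: "q \<in> Arr C" "Dom C q = bob U \<otimes>\<^sub>o\<^bsub>C\<^esub> bob V"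
    and qq: "q \<cdot>\<^bsub>C\<^esub> (bract U \<otimes>\<^bsub>C\<^esub> \<one>\<^bsub>C\<^esub> bob V) = q \<cdot>\<^bsub>C\<^esub> (\<one>\<^bsub>C\<^esub> bob U \<otimes>\<^bsub>C\<^esub> blact V)"
    using S.quo_simps[OF bimoduleD(2)[OF U] bimoduleD(1)[OF V]] by (simp_all add: q_def)
  show split: "split_coequalizer C (bract U \<otimes>\<^bsub>C\<^esub> \<one>\<^bsub>C\<^esub> bob V) (\<one>\<^bsub>C\<^esub> bob U \<otimes>\<^bsub>C\<^esub> blact V) q"
    using S.quo_split[OF bimoduleD(2)[OF U] free] by (simp add: q_def)
  show "right_part B = bal_rmod (self C) C A (right_part U) V"
    by (simp add: B_def bal_bimod_def bal_rmod_def right_part_def bal_ob_def Let_def)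
  show bob [simp]: "bob B = Cod C q"
    by (simp add: B_def q_def bal_bimod_def Let_def)
  have lact: "blact B = factor C (\<one>\<^bsub>C\<^esub> alg A \<otimes>\<^bsub>C\<^esub> q) (q \<cdot>\<^bsub>C\<^esub> (blact U \<otimes>\<^bsub>C\<^esub> \<one>\<^bsub>C\<^esub> bob V))"
    by (simp add: B_def q_def bal_bimod_def Let_def)
  note splitA = C.split_coequalizer_tensor[OF split C.algebra_simps(1), simplified]
  have eq: "q \<cdot>\<^bsub>C\<^esub> (blact U \<otimes>\<^bsub>C\<^esub> \<one>\<^bsub>C\<^esub> bob V) \<cdot>\<^bsub>C\<^esub> (\<one>\<^bsub>C\<^esub> alg A \<otimes>\<^bsub>C\<^esub> bract U \<otimes>\<^bsub>C\<^esub> \<one>\<^bsub>C\<^esub> bob V)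
      = q \<cdot>\<^bsub>C\<^esub> (blact U \<otimes>\<^bsub>C\<^esub> \<one>\<^bsub>C\<^esub> bob V) \<cdot>\<^bsub>C\<^esub> (\<one>\<^bsub>C\<^esub> (alg A \<otimes>\<^sub>o\<^bsub>C\<^esub> bob U) \<otimes>\<^bsub>C\<^esub> blact V)"
  proof -
    have "q \<cdot>\<^bsub>C\<^esub> (blact U \<otimes>\<^bsub>C\<^esub> \<one>\<^bsub>C\<^esub> bob V) \<cdot>\<^bsub>C\<^esub> (\<one>\<^bsub>C\<^esub> alg A \<otimes>\<^bsub>C\<^esub> bract U \<otimes>\<^bsub>C\<^esub> \<one>\<^bsub>C\<^esub> bob V)
        = q \<cdot>\<^bsub>C\<^esub> ((blact U \<cdot>\<^bsub>C\<^esub> (\<one>\<^bsub>C\<^esub> alg A \<otimes>\<^bsub>C\<^esub> bract U)) \<otimes>\<^bsub>C\<^esub> \<one>\<^bsub>C\<^esub> bob V)"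
      by simp
    also have "\<dots> = q \<cdot>\<^bsub>C\<^esub> (bract U \<otimes>\<^bsub>C\<^esub> \<one>\<^bsub>C\<^esub> bob V) \<cdot>\<^bsub>C\<^esub> (blact U \<otimes>\<^bsub>C\<^esub> \<one>\<^bsub>C\<^esub> (alg A \<otimes>\<^sub>o\<^bsub>C\<^esub> bob V))"
      by (simp flip: bimoduleD(12)[OF U])
    also have "\<dots> = q \<cdot>\<^bsub>C\<^esub> (blact U \<otimes>\<^bsub>C\<^esub> \<one>\<^bsub>C\<^esub> bob V) \<cdot>\<^bsub>C\<^esub> (\<one>\<^bsub>C\<^esub> (alg A \<otimes>\<^sub>o\<^bsub>C\<^esub> bob U) \<otimes>\<^bsub>C\<^esub> blact V)"
      using C.slide[of "blact U" "blact V"] by (simp add: C.reassoc_square[OF qq])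
    finally show ?thesis .
  qed
  have "blact B \<in> hom C (Cod C (\<one>\<^bsub>C\<^esub> alg A \<otimes>\<^bsub>C\<^esub> q)) (Cod C (q \<cdot>\<^bsub>C\<^esub> (blact U \<otimes>\<^bsub>C\<^esub> \<one>\<^bsub>C\<^esub> bob V)))"
    "blact B \<cdot>\<^bsub>C\<^esub> (\<one>\<^bsub>C\<^esub> alg A \<otimes>\<^bsub>C\<^esub> q) = q \<cdot>\<^bsub>C\<^esub> (blact U \<otimes>\<^bsub>C\<^esub> \<one>\<^bsub>C\<^esub> bob V)"
    unfolding lact
    by (rule C.coequalizer_factor[OF C.split_coequalizer_is_coequalizer[OF splitA]]; use eq in simp)+
  then have [simp]: "blact B \<in> Arr C" "Dom C (blact B) = alg A \<otimes>\<^sub>o\<^bsub>C\<^esub> Cod C q" "Cod C (blact B) = Cod C q"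
    and act: "blact B \<cdot>\<^bsub>C\<^esub> (\<one>\<^bsub>C\<^esub> alg A \<otimes>\<^bsub>C\<^esub> q) = q \<cdot>\<^bsub>C\<^esub> (blact U \<otimes>\<^bsub>C\<^esub> \<one>\<^bsub>C\<^esub> bob V)"
    by (auto simp: hom_def)
  show "blact B \<cdot>\<^bsub>C\<^esub> (\<one>\<^bsub>C\<^esub> alg A \<otimes>\<^bsub>C\<^esub> q) = q \<cdot>\<^bsub>C\<^esub> (blact U \<otimes>\<^bsub>C\<^esub> \<one>\<^bsub>C\<^esub> bob V)" by (rule act)
  note splitAA = C.split_coequalizer_tensor[OF split, of "alg A \<otimes>\<^sub>o\<^bsub>C\<^esub> alg A", simplified]
  have "blact B \<cdot>\<^bsub>C\<^esub> (\<one>\<^bsub>C\<^esub> alg A \<otimes>\<^bsub>C\<^esub> blact B) = blact B \<cdot>\<^bsub>C\<^esub> (mul A \<otimes>\<^bsub>C\<^esub> \<one>\<^bsub>C\<^esub> bob B)"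
  proof (rule C.split_coequalizer_epi[OF splitAA])
    have actA: "(\<one>\<^bsub>C\<^esub> alg A \<otimes>\<^bsub>C\<^esub> blact B) \<cdot>\<^bsub>C\<^esub> (\<one>\<^bsub>C\<^esub> (alg A \<otimes>\<^sub>o\<^bsub>C\<^esub> alg A) \<otimes>\<^bsub>C\<^esub> q)
        = (\<one>\<^bsub>C\<^esub> alg A \<otimes>\<^bsub>C\<^esub> q) \<cdot>\<^bsub>C\<^esub> (\<one>\<^bsub>C\<^esub> alg A \<otimes>\<^bsub>C\<^esub> blact U \<otimes>\<^bsub>C\<^esub> \<one>\<^bsub>C\<^esub> bob V)"
      using arg_cong[OF act, of "\<lambda>x. \<one>\<^bsub>C\<^esub> alg A \<otimes>\<^bsub>C\<^esub> x"] by simp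
    have "(blact B \<cdot>\<^bsub>C\<^esub> (\<one>\<^bsub>C\<^esub> alg A \<otimes>\<^bsub>C\<^esub> blact B)) \<cdot>\<^bsub>C\<^esub> (\<one>\<^bsub>C\<^esub> (alg A \<otimes>\<^sub>o\<^bsub>C\<^esub> alg A) \<otimes>\<^bsub>C\<^esub> q)
        = q \<cdot>\<^bsub>C\<^esub> ((blact U \<cdot>\<^bsub>C\<^esub> (\<one>\<^bsub>C\<^esub> alg A \<otimes>\<^bsub>C\<^esub> blact U)) \<otimes>\<^bsub>C\<^esub> \<one>\<^bsub>C\<^esub> bob V)"
      by (simp add: actA C.reassoc_square[OF act])
    also have "\<dots> = q \<cdot>\<^bsub>C\<^esub> (blact U \<otimes>\<^bsub>C\<^esub> \<one>\<^bsub>C\<^esub> bob V) \<cdot>\<^bsub>C\<^esub> (mul A \<otimes>\<^bsub>C\<^esub> \<one>\<^bsub>C\<^esub> (bob U \<otimes>\<^sub>o\<^bsub>C\<^esub> bob V))"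
      using left_moduleD(5)[OF bimoduleD(1)[OF U]] by simp
    also have "\<dots> = blact B \<cdot>\<^bsub>C\<^esub> (\<one>\<^bsub>C\<^esub> alg A \<otimes>\<^bsub>C\<^esub> q) \<cdot>\<^bsub>C\<^esub> (mul A \<otimes>\<^bsub>C\<^esub> \<one>\<^bsub>C\<^esub> (bob U \<otimes>\<^sub>o\<^bsub>C\<^esub> bob V))"
      by (simp add: C.reassoc_square[OF act])
    also have "\<dots> = (blact B \<cdot>\<^bsub>C\<^esub> (mul A \<otimes>\<^bsub>C\<^esub> \<one>\<^bsub>C\<^esub> bob B)) \<cdot>\<^bsub>C\<^esub> (\<one>\<^bsub>C\<^esub> (alg A \<otimes>\<^sub>o\<^bsub>C\<^esub> alg A) \<otimes>\<^bsub>C\<^esub> q)"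
      using C.slide[of "mul A" q] by simp
    finally show "(blact B \<cdot>\<^bsub>C\<^esub> (\<one>\<^bsub>C\<^esub> alg A \<otimes>\<^bsub>C\<^esub> blact B)) \<cdot>\<^bsub>C\<^esub> (\<one>\<^bsub>C\<^esub> (alg A \<otimes>\<^sub>o\<^bsub>C\<^esub> alg A) \<otimes>\<^bsub>C\<^esub> q)
        = (blact B \<cdot>\<^bsub>C\<^esub> (mul A \<otimes>\<^bsub>C\<^esub> \<one>\<^bsub>C\<^esub> bob B)) \<cdot>\<^bsub>C\<^esub> (\<one>\<^bsub>C\<^esub> (alg A \<otimes>\<^sub>o\<^bsub>C\<^esub> alg A) \<otimes>\<^bsub>C\<^esub> q)" .
  qed simp_all
  moreover have "blact B \<cdot>\<^bsub>C\<^esub> (eta A \<otimes>\<^bsub>C\<^esub> \<one>\<^bsub>C\<^esub> bob B) = \<one>\<^bsub>C\<^esub> bob B"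
  proof (rule C.split_coequalizer_epi[OF split])
    have "(blact B \<cdot>\<^bsub>C\<^esub> (eta A \<otimes>\<^bsub>C\<^esub> \<one>\<^bsub>C\<^esub> bob B)) \<cdot>\<^bsub>C\<^esub> q
        = blact B \<cdot>\<^bsub>C\<^esub> (\<one>\<^bsub>C\<^esub> alg A \<otimes>\<^bsub>C\<^esub> q) \<cdot>\<^bsub>C\<^esub> (eta A \<otimes>\<^bsub>C\<^esub> \<one>\<^bsub>C\<^esub> (bob U \<otimes>\<^sub>o\<^bsub>C\<^esub> bob V))"
      using C.slide[of "eta A" q] by simp
    also have "\<dots> = q \<cdot>\<^bsub>C\<^esub> ((blact U \<cdot>\<^bsub>C\<^esub> (eta A \<otimes>\<^bsub>C\<^esub> \<one>\<^bsub>C\<^esub> bob U)) \<otimes>\<^bsub>C\<^esub> \<one>\<^bsub>C\<^esub> bob V)"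
      by (simp add: C.reassoc_square[OF act])
    also have "\<dots> = \<one>\<^bsub>C\<^esub> bob B \<cdot>\<^bsub>C\<^esub> q"
      using left_moduleD(6)[OF bimoduleD(1)[OF U]] by simp
    finally show "(blact B \<cdot>\<^bsub>C\<^esub> (eta A \<otimes>\<^bsub>C\<^esub> \<one>\<^bsub>C\<^esub> bob B)) \<cdot>\<^bsub>C\<^esub> q = \<one>\<^bsub>C\<^esub> bob B \<cdot>\<^bsub>C\<^esub> q" .
  qed simp_all
  ultimately show "left_module C A (left_part B)"
    by (simp add: left_module_def hom_def)
qed

text \<open>The composite \<open>q' \<cdot> (q \<diamondop> V)\<close> is not presented as the coequalizer of one pair, so the factorization is
  done in two stages: first through \<open>q \<diamondop> V\<close>, by balancing between \<open>M\<close> and \<open>U\<close>, then through \<open>q'\<close>, by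
  balancing between \<open>U\<close> and \<open>V\<close>. Both are epimorphisms, which gives uniqueness.\<close>

lemma assoc_c_quo:
  assumes M: "right_module D C A M"
    and U: "bimodule C A U" and freeU: "free_left_module C A (left_part U)"
    and V: "bimodule C A V" and freeV: "free_left_module C A (left_part V)"
  defines "q \<equiv> quo D C M (left_part U)" and "q' \<equiv> quo D C (bal_rmod D C A M U) (left_part V)"
    and "r \<equiv> quo (self C) C (right_part U) (left_part V)"
    and "r' \<equiv> quo D C M (left_part (bal_bimod C A U V))"
  shows "assoc_c D C A M U V \<in> Arr D" "Dom D (assoc_c D C A M U V) = Cod D q'"
    "Cod D (assoc_c D C A M U V) = Cod D r'"
    "assoc_c D C A M U V \<cdot> q' \<cdot> (q \<diamondop> \<one>\<^bsub>C\<^esub> bob V) = r' \<cdot> (\<one> rob M \<diamondop> r)"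
proof -
  let ?B = "bal_rmod D C A M U" and ?R = "bal_bimod C A U V"
  note B = bal_rmod_quo[OF M U freeU] and R = bal_bimod_quo[OF U V freeV]
  note [simp] = right_moduleD(1-4)[OF M] bimoduleD(3-9)[OF U] bimoduleD(3-9)[OF V]
    right_moduleD(1-4)[OF B(1)] B(2) left_moduleD(1-4)[OF R(1), simplified] R(5,6)[folded r_def] R(3)[folded r_def]
    quo_simps(1-4)[OF M bimoduleD(1)[OF U], folded q_def]
    quo_simps(1-4)[OF B(1) bimoduleD(1)[OF V], folded q'_def]
    quo_simps(1-4)[OF M R(1), folded r'_def]
  note qU = quo_simps(5)[OF M bimoduleD(1)[OF U], folded q_def, simplified]
  note rV = R(7)[folded r_def] and r'B = quo_simps(5)[OF M R(1), folded r'_def, simplified]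
  note actB = B(3)[folded q_def] and actR = R(4)[folded r_def]
  have splitU: "split_coequalizer D (ract M \<diamondop> \<one>\<^bsub>C\<^esub> bob U) (\<one> rob M \<diamondop> blact U) q"
    using quo_split[OF M freeU] by (simp add: q_def)
  note splitUV = split_coequalizer_act_right[OF splitU bimoduleD(3)[OF V], simplified]
  note splitUAV = split_coequalizer_act_right[OF splitU, of "alg A \<otimes>\<^sub>o\<^bsub>C\<^esub> bob V", simplified]
  have splitBV: "split_coequalizer D (ract ?B \<diamondop> \<one>\<^bsub>C\<^esub> bob V) (\<one> (bal_ob D C M (left_part U)) \<diamondop> blact V) q'"
    using quo_split[OF B(1) freeV] by (simp add: q'_def)
  let ?h = "r' \<cdot> (\<one> rob M \<diamondop> r)"
  have "?h \<cdot> (ract M \<diamondop> \<one>\<^bsub>C\<^esub> (bob U \<otimes>\<^sub>o\<^bsub>C\<^esub> bob V)) = r' \<cdot> (ract M \<diamondop> \<one>\<^bsub>C\<^esub> Cod C r) \<cdot> (\<one> rob M \<diamondop> (\<one>\<^bsub>C\<^esub> alg A \<otimes>\<^bsub>C\<^esub> r))"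
    using act_slide[of "ract M" r] by simp
  also have "\<dots> = r' \<cdot> (\<one> rob M \<diamondop> (blact ?R \<cdot>\<^bsub>C\<^esub> (\<one>\<^bsub>C\<^esub> alg A \<otimes>\<^bsub>C\<^esub> r)))"
    by (simp add: reassoc_square[OF r'B])
  also have "\<dots> = ?h \<cdot> (\<one> rob M \<diamondop> (blact U \<otimes>\<^bsub>C\<^esub> \<one>\<^bsub>C\<^esub> bob V))"
    by (simp add: actR)
  finally have eq1: "?h \<cdot> (ract M \<diamondop> \<one>\<^bsub>C\<^esub> (bob U \<otimes>\<^sub>o\<^bsub>C\<^esub> bob V)) = ?h \<cdot> (\<one> rob M \<diamondop> (blact U \<otimes>\<^bsub>C\<^esub> \<one>\<^bsub>C\<^esub> bob V))" .
  \<comment> \<open>First stage: factor through \<open>q \<diamondop> V\<close>.\<close>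
  define k1 where "k1 = factor D (q \<diamondop> \<one>\<^bsub>C\<^esub> bob V) ?h"
  have "k1 \<in> hom D (Cod D (q \<diamondop> \<one>\<^bsub>C\<^esub> bob V)) (Cod D ?h)" and k1q: "k1 \<cdot> (q \<diamondop> \<one>\<^bsub>C\<^esub> bob V) = ?h"
    unfolding k1_def
    by (rule coequalizer_factor[OF split_coequalizer_is_coequalizer[OF splitUV]]; use eq1 in simp)+
  then have [simp]: "k1 \<in> Arr D" "Dom D k1 = bal_ob D C M (left_part U) \<diamondop>\<^sub>o bob V"
    "Cod D k1 = bal_ob D C M (left_part ?R)"
    by (auto simp: hom_def)
  have eq2: "k1 \<cdot> (ract ?B \<diamondop> \<one>\<^bsub>C\<^esub> bob V) = k1 \<cdot> (\<one> (bal_ob D C M (left_part U)) \<diamondop> blact V)"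
  proof (rule split_coequalizer_epi[OF splitUAV])
    have actBV: "(ract ?B \<diamondop> \<one>\<^bsub>C\<^esub> bob V) \<cdot> (q \<diamondop> \<one>\<^bsub>C\<^esub> (alg A \<otimes>\<^sub>o\<^bsub>C\<^esub> bob V)) = (q \<diamondop> \<one>\<^bsub>C\<^esub> bob V) \<cdot> (\<one> rob M \<diamondop> (bract U \<otimes>\<^bsub>C\<^esub> \<one>\<^bsub>C\<^esub> bob V))"
      using arg_cong[OF actB, of "\<lambda>x. x \<diamondop> \<one>\<^bsub>C\<^esub> bob V"] by simp
    have "(k1 \<cdot> (ract ?B \<diamondop> \<one>\<^bsub>C\<^esub> bob V)) \<cdot> (q \<diamondop> \<one>\<^bsub>C\<^esub> (alg A \<otimes>\<^sub>o\<^bsub>C\<^esub> bob V))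
        = r' \<cdot> (\<one> rob M \<diamondop> (r \<cdot>\<^bsub>C\<^esub> (bract U \<otimes>\<^bsub>C\<^esub> \<one>\<^bsub>C\<^esub> bob V)))"
      by (simp add: actBV reassoc_square[OF k1q])
    also have "\<dots> = r' \<cdot> (\<one> rob M \<diamondop> r) \<cdot> (\<one> (rob M \<diamondop>\<^sub>o bob U) \<diamondop> blact V)"
      by (simp add: rV)
    also have "\<dots> = k1 \<cdot> (q \<diamondop> \<one>\<^bsub>C\<^esub> bob V) \<cdot> (\<one> (rob M \<diamondop>\<^sub>o bob U) \<diamondop> blact V)"
      by (simp add: reassoc_square[OF k1q])
    also have "\<dots> = (k1 \<cdot> (\<one> (bal_ob D C M (left_part U)) \<diamondop> blact V)) \<cdot> (q \<diamondop> \<one>\<^bsub>C\<^esub> (alg A \<otimes>\<^sub>o\<^bsub>C\<^esub> bob V))"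
      using act_slide[of q "blact V"] by simp
    finally show "(k1 \<cdot> (ract ?B \<diamondop> \<one>\<^bsub>C\<^esub> bob V)) \<cdot> (q \<diamondop> \<one>\<^bsub>C\<^esub> (alg A \<otimes>\<^sub>o\<^bsub>C\<^esub> bob V))
        = (k1 \<cdot> (\<one> (bal_ob D C M (left_part U)) \<diamondop> blact V)) \<cdot> (q \<diamondop> \<one>\<^bsub>C\<^esub> (alg A \<otimes>\<^sub>o\<^bsub>C\<^esub> bob V))" .
  qed simp_all
  \<comment> \<open>Second stage: factor through \<open>q'\<close>.\<close>
  define k where "k = factor D q' k1"
  have "k \<in> hom D (Cod D q') (Cod D k1)" and kq: "k \<cdot> q' = k1"
    unfolding k_def
    by (rule coequalizer_factor[OF split_coequalizer_is_coequalizer[OF splitBV]]; use eq2 in simp)+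
  then have [simp]: "k \<in> Arr D" "Dom D k = bal_ob D C ?B (left_part V)" "Cod D k = bal_ob D C M (left_part ?R)"
    by (auto simp: hom_def)
  have kh: "k \<cdot> q' \<cdot> (q \<diamondop> \<one>\<^bsub>C\<^esub> bob V) = ?h"
    by (simp add: reassoc[OF kq] k1q)
  have kk: "(k \<cdot> q') \<cdot> (q \<diamondop> \<one>\<^bsub>C\<^esub> bob V) = ?h"
    by (simp add: kq k1q)
  have unique: "k' = k" if k': "k' \<in> Arr D" "Dom D k' = bal_ob D C ?B (left_part V)"
      "Cod D k' = bal_ob D C M (left_part ?R)" "k' \<cdot> q' \<cdot> (q \<diamondop> \<one>\<^bsub>C\<^esub> bob V) = ?h" for k'
  proof -
    have "(k' \<cdot> q') \<cdot> (q \<diamondop> \<one>\<^bsub>C\<^esub> bob V) = (k \<cdot> q') \<cdot> (q \<diamondop> \<one>\<^bsub>C\<^esub> bob V)"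
      unfolding kk k'(4)[symmetric] by (rule Cmp_assoc_typed) (simp_all add: k'(1-3))
    then have "k' \<cdot> q' = k \<cdot> q'"
      by (rule split_coequalizer_epi[OF splitUV, rotated -1]) (simp_all add: k'(1-3))
    then show ?thesis
      by (rule split_coequalizer_epi[OF splitBV, rotated -1]) (simp_all add: k'(1-3))
  qed
  have "assoc_c D C A M U V = k"
    unfolding assoc_c_def q_def[symmetric] q'_def[symmetric] r_def[symmetric] r'_def[symmetric]
    by (rule factor_eqI) (auto simp: hom_def kh intro: unique)
  then show "assoc_c D C A M U V \<in> Arr D" "Dom D (assoc_c D C A M U V) = Cod D q'"
    "Cod D (assoc_c D C A M U V) = Cod D r'"
    "assoc_c D C A M U V \<cdot> q' \<cdot> (q \<diamondop> \<one>\<^bsub>C\<^esub> bob V) = r' \<cdot> (\<one> rob M \<diamondop> r)"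
    by (simp_all add: kh)
qed

end

section \<open>Cowreath identities in Kleisli form\<close>

sublocale cowreath \<subseteq> monoidal_algebra C A
  by unfold_locales (rule alg_A)

context cowreath
begin

lemma cowreath_typing [simp]:
  "X \<in> Obj C"
  "\<psi> \<in> Arr C" "Dom C \<psi> = X \<otimes>\<^sub>o alg A" "Cod C \<psi> = alg A \<otimes>\<^sub>o X"
  "\<delta> \<in> Arr C" "Dom C \<delta> = X" "Cod C \<delta> = alg A \<otimes>\<^sub>o X \<otimes>\<^sub>o X"
  "f \<in> Arr C" "Dom C f = X" "Cod C f = alg A"
  using X_in psi_in delta_in f_in by (auto simp: hom_def)

text \<open>The Kleisli extensions of the cowreath data: \<open>\<beta>\<close> is the right action of \<open>A\<close> on \<open>A \<otimes> X\<close>, \<open>\<rho>\<close> its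
  comultiplication as seen through \<open>\<Upsilon>\<close>, and \<open>\<epsilon>\<close> its counit. Every law for them below is proved by
  moving all extensions to the outside with \<open>extension_Cmp\<close>; what is left inside is one axiom of the
  cowreath.\<close>

abbreviation \<rho> :: 'a where "\<rho> \<equiv> extension (X \<otimes>\<^sub>o X) \<delta>"
abbreviation \<beta> :: 'a where "\<beta> \<equiv> extension X \<psi>"
abbreviation \<epsilon> :: 'a where "\<epsilon> \<equiv> extension (uob C) f"

lemma right_action_assoc: "\<beta> \<cdot> (\<beta> \<otimes> \<one> alg A) = \<beta> \<cdot> (\<one> (alg A \<otimes>\<^sub>o X) \<otimes> mul A)"
proof -
  have "\<beta> \<cdot> (\<beta> \<otimes> \<one> alg A) = extension X (\<beta> \<cdot> (\<psi> \<otimes> \<one> alg A))"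
    by (simp add: extension_whisker extension_Cmp)
  also have "\<dots> = extension X (\<psi> \<cdot> (\<one> X \<otimes> mul A))"
    by (simp add: psi_mul extension_def[of X \<psi>])
  also have "\<dots> = \<beta> \<cdot> (\<one> (alg A \<otimes>\<^sub>o X) \<otimes> mul A)"
    by (simp add: extension_precompose)
  finally show ?thesis .
qed

lemma right_action_unit: "\<beta> \<cdot> (\<one> (alg A \<otimes>\<^sub>o X) \<otimes> eta A) = \<one> (alg A \<otimes>\<^sub>o X)"
proof -
  have "\<beta> \<cdot> (\<one> (alg A \<otimes>\<^sub>o X) \<otimes> eta A) = extension X (\<psi> \<cdot> (\<one> X \<otimes> eta A))"
    by (simp add: extension_precompose)
  then show ?thesis by (simp add: psi_eta extension_eta)
qed

text \<open>Together with the next two laws, this says that \<open>A \<otimes> X\<close> with \<open>\<beta>\<close> and \<open>\<rho>\<close> is a generalized entwined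
  module in \<open>C\<close>.\<close>

lemma coaction_right_action: "\<rho> \<cdot> \<beta> = (\<beta> \<otimes> \<one> X) \<cdot> (\<one> (alg A \<otimes>\<^sub>o X) \<otimes> \<psi>) \<cdot> (\<rho> \<otimes> \<one> alg A)"
proof -
  let ?g = "(\<psi> \<otimes> \<one> X) \<cdot> (\<one> X \<otimes> \<psi>)"
  have "\<rho> \<cdot> \<beta> = extension (X \<otimes>\<^sub>o X) (\<rho> \<cdot> \<psi>)"
    by (simp add: extension_Cmp)
  also have "\<rho> \<cdot> \<psi> = extension (X \<otimes>\<^sub>o X) ?g \<cdot> (\<delta> \<otimes> \<one> alg A)"
    using delta_psi by (simp add: extension_def)
  also have "extension (X \<otimes>\<^sub>o X) \<dots> = extension (X \<otimes>\<^sub>o X) ?g \<cdot> extension (X \<otimes>\<^sub>o X \<otimes>\<^sub>o alg A) (\<delta> \<otimes> \<one> alg A)"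
    by (simp add: extension_Cmp)
  also have "\<dots> = (\<beta> \<otimes> \<one> X) \<cdot> (\<one> (alg A \<otimes>\<^sub>o X) \<otimes> \<psi>) \<cdot> (\<rho> \<otimes> \<one> alg A)"
    by (simp add: extension_whisker extension_precompose)
  finally show ?thesis .
qed

lemma coaction_coassoc: "(\<rho> \<otimes> \<one> X) \<cdot> \<rho> = (\<beta> \<otimes> \<one> (X \<otimes>\<^sub>o X)) \<cdot> (\<one> (alg A \<otimes>\<^sub>o X) \<otimes> \<delta>) \<cdot> \<rho>"
proof -
  let ?W = "X \<otimes>\<^sub>o X \<otimes>\<^sub>o X" and ?g = "(\<psi> \<otimes> \<one> (X \<otimes>\<^sub>o X)) \<cdot> (\<one> X \<otimes> \<delta>)"
  have "(\<rho> \<otimes> \<one> X) \<cdot> \<rho> = extension ?W (extension ?W (\<delta> \<otimes> \<one> X) \<cdot> \<delta>)"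
    by (simp add: extension_whisker extension_Cmp)
  also have "extension ?W (\<delta> \<otimes> \<one> X) \<cdot> \<delta> = extension ?W ?g \<cdot> \<delta>"
    using delta_coassoc by (simp add: extension_def)
  also have "extension ?W \<dots> = extension ?W ?g \<cdot> \<rho>"
    by (simp add: extension_Cmp)
  also have "\<dots> = (\<beta> \<otimes> \<one> (X \<otimes>\<^sub>o X)) \<cdot> (\<one> (alg A \<otimes>\<^sub>o X) \<otimes> \<delta>) \<cdot> \<rho>"
    by (simp add: extension_whisker extension_precompose)
  finally show ?thesis .
qed

lemma coaction_counit_right: "\<beta> \<cdot> (\<one> (alg A \<otimes>\<^sub>o X) \<otimes> f) \<cdot> \<rho> = \<one> (alg A \<otimes>\<^sub>o X)"
proof -
  let ?g = "\<psi> \<cdot> (\<one> X \<otimes> f)"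
  have "\<beta> \<cdot> (\<one> (alg A \<otimes>\<^sub>o X) \<otimes> f) \<cdot> \<rho> = extension X ?g \<cdot> \<rho>"
    by (simp add: extension_precompose)
  also have "\<dots> = extension X (extension X ?g \<cdot> \<delta>)"
    by (simp add: extension_Cmp)
  also have "extension X ?g \<cdot> \<delta> = eta A \<otimes> \<one> X"
    using f_delta_right by (simp add: extension_def)
  finally show ?thesis by (simp add: extension_eta)
qed

lemma coaction_counit_left: "(\<epsilon> \<otimes> \<one> X) \<cdot> \<rho> = \<one> (alg A \<otimes>\<^sub>o X)"
proof -
  have "(\<epsilon> \<otimes> \<one> X) \<cdot> \<rho> = extension X (extension X (f \<otimes> \<one> X) \<cdot> \<delta>)"
    by (simp add: extension_whisker extension_Cmp)
  also have "extension X (f \<otimes> \<one> X) \<cdot> \<delta> = eta A \<otimes> \<one> X"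
    using f_delta_left by (simp add: extension_def)
  finally show ?thesis by (simp add: extension_eta)
qed

lemma counit_right_linear: "\<epsilon> \<cdot> \<beta> = mul A \<cdot> (\<epsilon> \<otimes> \<one> alg A)"
proof -
  have "\<epsilon> \<cdot> \<beta> = extension (uob C) (\<epsilon> \<cdot> \<psi>)"
    by (simp add: extension_Cmp)
  also have "\<epsilon> \<cdot> \<psi> = mul A \<cdot> (f \<otimes> \<one> alg A)"
    using f_psi by (simp add: extension_def)
  finally show ?thesis
    by (simp add: extension_def reassoc_square[OF algebra_eqs(1)])
qed

end

section \<open>The coring of a cowreath\<close>

lemma cowreath_coring_simps:
  "bob (cowreath_coring C A X \<psi> \<delta> f) = alg A \<otimes>\<^sub>o\<^bsub>C\<^esub> X"
  "blact (cowreath_coring C A X \<psi> \<delta> f) = mul A \<otimes>\<^bsub>C\<^esub> \<one>\<^bsub>C\<^esub> X"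
  "bract (cowreath_coring C A X \<psi> \<delta> f) = (mul A \<otimes>\<^bsub>C\<^esub> \<one>\<^bsub>C\<^esub> X) \<cdot>\<^bsub>C\<^esub> (\<one>\<^bsub>C\<^esub> alg A \<otimes>\<^bsub>C\<^esub> \<psi>)"
  "comul (cowreath_coring C A X \<psi> \<delta> f) = inv_arr C (Upsilon C A X \<psi>) \<cdot>\<^bsub>C\<^esub>
     (mul A \<otimes>\<^bsub>C\<^esub> \<one>\<^bsub>C\<^esub> X \<otimes>\<^bsub>C\<^esub> \<one>\<^bsub>C\<^esub> X) \<cdot>\<^bsub>C\<^esub> (\<one>\<^bsub>C\<^esub> alg A \<otimes>\<^bsub>C\<^esub> \<delta>)"
  "couni (cowreath_coring C A X \<psi> \<delta> f) = mul A \<cdot>\<^bsub>C\<^esub> (\<one>\<^bsub>C\<^esub> alg A \<otimes>\<^bsub>C\<^esub> f)"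
  "right_part (cowreath_bimod C A X \<psi>) = right_part (cowreath_coring C A X \<psi> \<delta> f)"
  "left_part (cowreath_bimod C A X \<psi>) = left_part (cowreath_coring C A X \<psi> \<delta> f)"
  by (simp_all add: cowreath_coring_def cowreath_bimod_def bimod.defs right_part_def left_part_def)

lemma (in category) inv_arr_eqI:
  assumes "inverse_arrows C f g"
  shows "inv_arr C f = g"
  unfolding inv_arr_def
proof (rule the_equality, rule assms)
  fix h assume h: "inverse_arrows C f h"
  have t: "f \<in> Arr C" "g \<in> Arr C" "h \<in> Arr C" "Dom C g = Cod C f" "Cod C g = Dom C f"
    "Dom C h = Cod C f" "Cod C h = Dom C f"
    and e: "g \<cdot> f = \<one> (Dom C f)" "f \<cdot> h = \<one> (Cod C f)"
    using assms h by (auto simp: inverse_arrows_def hom_def)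
  have "(g \<cdot> f) \<cdot> h = g \<cdot> (f \<cdot> h)" using t by simp
  then show "h = g" unfolding e using t by simp
qed

locale cowreath_action = algebra_action C D A + W: cowreath C A X \<psi> \<delta> f
  for C :: "('o, 'a) mcat" and D :: "('p, 'b, 'o, 'a) rcat" (structure)
    and A :: "('o, 'a) algebra" and X :: 'o and \<psi> \<delta> f :: 'a
begin

abbreviation K :: "('o, 'a) coring" where
  "K \<equiv> cowreath_coring C A X \<psi> \<delta> f"

abbreviation qK :: 'a where
  "qK \<equiv> quo (self C) C (right_part K) (left_part K)"

text \<open>The canonical isomorphism \<open>M \<diamondop>\<^sub>A K \<rightarrow> M \<diamondop> X\<close> and, below, its inverse; \<open>comparison\<close> proves this.\<close>

definition contract :: "('p, 'b) rmod \<Rightarrow> 'b" where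
  "contract M = factor D (quo D C M (left_part K)) (ract M \<diamondop> \<one>\<^bsub>C\<^esub> X)"

definition expand :: "('p, 'b) rmod \<Rightarrow> 'b" where
  "expand M = quo D C M (left_part K) \<cdot> (\<one> rob M \<diamondop> (eta A \<otimes>\<^bsub>C\<^esub> \<one>\<^bsub>C\<^esub> X))"

lemma self_cowreath_action: "cowreath_action C (self C) A X \<psi> \<delta> f"
  by (intro cowreath_action.intro self_action W.cowreath_axioms)

lemma bract_K: "bract K = W.\<beta>"
  by (simp add: C.extension_def cowreath_coring_simps)

lemma K_simps [simp]: "bob K = alg A \<otimes>\<^sub>o\<^bsub>C\<^esub> X" "blact K = mul A \<otimes>\<^bsub>C\<^esub> \<one>\<^bsub>C\<^esub> X"
  by (simp_all add: cowreath_coring_simps)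

lemma K_bimodule: "bimodule C A K"
proof -
  have "W.\<beta> \<cdot>\<^bsub>C\<^esub> (mul A \<otimes>\<^bsub>C\<^esub> \<one>\<^bsub>C\<^esub> X \<otimes>\<^bsub>C\<^esub> \<one>\<^bsub>C\<^esub> alg A) = (mul A \<otimes>\<^bsub>C\<^esub> \<one>\<^bsub>C\<^esub> X) \<cdot>\<^bsub>C\<^esub> (\<one>\<^bsub>C\<^esub> alg A \<otimes>\<^bsub>C\<^esub> W.\<beta>)"
    by (simp add: C.extension_linear)
  then show ?thesis
    unfolding bimodule_def left_module_def right_module_def part_simps bract_K
    by (auto simp: hom_def W.right_action_assoc W.right_action_unit C.algebra_whisker)
qed

lemma K_free_via: "free_via C A (left_part K) X (\<one>\<^bsub>C\<^esub> (alg A \<otimes>\<^sub>o\<^bsub>C\<^esub> X)) (\<one>\<^bsub>C\<^esub> (alg A \<otimes>\<^sub>o\<^bsub>C\<^esub> X))"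
  using bimoduleD(1)[OF K_bimodule] by (simp add: free_via_def hom_def)

lemma K_free: "free_left_module C A (left_part K)"
  using K_free_via unfolding free_left_module_def by blast

text \<open>\<open>K\<close> is free on \<open>X\<close> by definition, so this is \<open>free_quotient_comparison\<close> with \<open>\<phi>\<close> an identity.\<close>

lemma comparison:
  assumes M: "right_module D C A M"
  defines "q \<equiv> quo D C M (left_part K)"
  shows "contract M \<in> Arr D" "Dom D (contract M) = bal_ob D C M (left_part K)" "Cod D (contract M) = rob M \<diamondop>\<^sub>o X"
    "expand M \<in> Arr D" "Dom D (expand M) = rob M \<diamondop>\<^sub>o X" "Cod D (expand M) = bal_ob D C M (left_part K)"
    "contract M \<cdot> q = ract M \<diamondop> \<one>\<^bsub>C\<^esub> X" "expand M \<cdot> (ract M \<diamondop> \<one>\<^bsub>C\<^esub> X) = q"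
    "contract M \<cdot> expand M = \<one> (rob M \<diamondop>\<^sub>o X)" "expand M \<cdot> contract M = \<one> (bal_ob D C M (left_part K))"
    "expand M = q \<cdot> (\<one> rob M \<diamondop> (eta A \<otimes>\<^bsub>C\<^esub> \<one>\<^bsub>C\<^esub> X))"
proof -
  have "contract M \<in> hom D (bal_ob D C M (left_part K)) (rob M \<diamondop>\<^sub>o X)"
    "expand M \<in> hom D (rob M \<diamondop>\<^sub>o X) (bal_ob D C M (left_part K))"
    "contract M \<cdot> q = ract M \<diamondop> \<one>\<^bsub>C\<^esub> X" "expand M \<cdot> (ract M \<diamondop> \<one>\<^bsub>C\<^esub> X) = q"
    "contract M \<cdot> expand M = \<one> (rob M \<diamondop>\<^sub>o X)" "expand M \<cdot> contract M = \<one> (bal_ob D C M (left_part K))"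
    using free_quotient_comparison[OF M K_free_via] right_moduleD(1-4)[OF M]
    by (simp_all add: contract_def expand_def q_def)
  then show "contract M \<in> Arr D" "Dom D (contract M) = bal_ob D C M (left_part K)" "Cod D (contract M) = rob M \<diamondop>\<^sub>o X"
    "expand M \<in> Arr D" "Dom D (expand M) = rob M \<diamondop>\<^sub>o X" "Cod D (expand M) = bal_ob D C M (left_part K)"
    "contract M \<cdot> q = ract M \<diamondop> \<one>\<^bsub>C\<^esub> X" "expand M \<cdot> (ract M \<diamondop> \<one>\<^bsub>C\<^esub> X) = q"
    "contract M \<cdot> expand M = \<one> (rob M \<diamondop>\<^sub>o X)" "expand M \<cdot> contract M = \<one> (bal_ob D C M (left_part K))"
    by (auto simp: hom_def)
qed (simp add: expand_def q_def)

lemma expand_cancel: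
  assumes M: "right_module D C A M" and x: "x \<in> Arr D" "Cod D x = rob M \<diamondop>\<^sub>o X"
    and y: "y \<in> Arr D" "Cod D y = rob M \<diamondop>\<^sub>o X" and xy: "Dom D x = Dom D y"
  shows "expand M \<cdot> x = expand M \<cdot> y \<longleftrightarrow> x = y"
proof
  assume "expand M \<cdot> x = expand M \<cdot> y"
  then have "(contract M \<cdot> expand M) \<cdot> x = (contract M \<cdot> expand M) \<cdot> y"
    using x y xy comparison(1-6)[OF M] by simp
  then show "x = y" using x y by (simp add: comparison(9)[OF M])
qed simp

abbreviation \<Upsilon> :: 'a where "\<Upsilon> \<equiv> Upsilon C A X \<psi>"
abbreviation \<Upsilon>' :: 'a where "\<Upsilon>' \<equiv> inv_arr C \<Upsilon>"
abbreviation KK :: "('o, 'a) bimod" where "KK \<equiv> bal_bimod C A K K"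

lemmas KK_quo = bal_bimod_quo[OF K_bimodule K_bimodule K_free]

lemma qK_typing [simp]:
  "qK \<in> Arr C" "Dom C qK = alg A \<otimes>\<^sub>o\<^bsub>C\<^esub> X \<otimes>\<^sub>o\<^bsub>C\<^esub> alg A \<otimes>\<^sub>o\<^bsub>C\<^esub> X" "Cod C qK = bob KK" "bob KK \<in> Obj C"
  using KK_quo(3,5,6) C.Cod_Obj[OF KK_quo(5)] by simp_all

text \<open>The isomorphism \<open>\<Upsilon>\<close> is the comparison \<open>contract\<close> for the action of \<open>C\<close> on itself, at the right module
  \<open>K\<close>. Hence its inverse is \<open>expand\<close>, which is the form in which the comultiplication can be
  computed with.\<close>

lemma Upsilon_props:
  "\<Upsilon> \<in> Arr C" "Dom C \<Upsilon> = bob KK" "Cod C \<Upsilon> = alg A \<otimes>\<^sub>o\<^bsub>C\<^esub> X \<otimes>\<^sub>o\<^bsub>C\<^esub> X"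
  "\<Upsilon>' \<in> Arr C" "Dom C \<Upsilon>' = alg A \<otimes>\<^sub>o\<^bsub>C\<^esub> X \<otimes>\<^sub>o\<^bsub>C\<^esub> X" "Cod C \<Upsilon>' = bob KK"
  "\<Upsilon> \<cdot>\<^bsub>C\<^esub> qK = W.\<beta> \<otimes>\<^bsub>C\<^esub> \<one>\<^bsub>C\<^esub> X" "\<Upsilon> \<cdot>\<^bsub>C\<^esub> \<Upsilon>' = \<one>\<^bsub>C\<^esub> (alg A \<otimes>\<^sub>o\<^bsub>C\<^esub> X \<otimes>\<^sub>o\<^bsub>C\<^esub> X)" "\<Upsilon>' \<cdot>\<^bsub>C\<^esub> \<Upsilon> = \<one>\<^bsub>C\<^esub> bob KK"
  "\<Upsilon>' = cowreath_action.expand C (self C) A X \<psi> \<delta> f (right_part K)"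
proof -
  interpret S: cowreath_action C "self C" A X \<psi> \<delta> f by (rule self_cowreath_action)
  note s = S.comparison[OF bimoduleD(2)[OF K_bimodule], simplified, unfolded bract_K]
  have ob: "bal_ob (self C) C (right_part K) (left_part K) = bob KK"
    by (simp add: bal_ob_def)
  have U: "\<Upsilon> = S.contract (right_part K)"
  proof -
    have "bract (cowreath_bimod C A X \<psi>) = bract K"
      by (simp add: cowreath_coring_simps cowreath_bimod_def)
    then show ?thesis
      unfolding Upsilon_def Let_def cowreath_coring_simps(6,7)[of _ _ _ _ \<delta> f] S.contract_def by simp
  qed
  show V: "\<Upsilon>' = S.expand (right_part K)"
    by (rule C.inv_arr_eqI) (use s in \<open>simp add: inverse_arrows_def hom_def U\<close>)
  show "\<Upsilon> \<in> Arr C" "Dom C \<Upsilon> = bob KK" "Cod C \<Upsilon> = alg A \<otimes>\<^sub>o\<^bsub>C\<^esub> X \<otimes>\<^sub>o\<^bsub>C\<^esub> X"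
    "\<Upsilon>' \<in> Arr C" "Dom C \<Upsilon>' = alg A \<otimes>\<^sub>o\<^bsub>C\<^esub> X \<otimes>\<^sub>o\<^bsub>C\<^esub> X" "Cod C \<Upsilon>' = bob KK"
    "\<Upsilon> \<cdot>\<^bsub>C\<^esub> qK = W.\<beta> \<otimes>\<^bsub>C\<^esub> \<one>\<^bsub>C\<^esub> X" "\<Upsilon> \<cdot>\<^bsub>C\<^esub> \<Upsilon>' = \<one>\<^bsub>C\<^esub> (alg A \<otimes>\<^sub>o\<^bsub>C\<^esub> X \<otimes>\<^sub>o\<^bsub>C\<^esub> X)" "\<Upsilon>' \<cdot>\<^bsub>C\<^esub> \<Upsilon> = \<one>\<^bsub>C\<^esub> bob KK"
    unfolding V unfolding U using s(1-10) unfolding ob by simp_all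
qed

lemma comul_K: "comul K = \<Upsilon>' \<cdot>\<^bsub>C\<^esub> W.\<rho>"
  by (simp add: cowreath_coring_simps C.extension_def)

lemma couni_K: "couni K = W.\<epsilon>"
  by (simp add: cowreath_coring_simps C.extension_def)

text \<open>Both sides agree after composition with the epimorphism \<open>A \<otimes> qK\<close>, where the claim is that the right
  action \<open>\<beta>\<close>, as a Kleisli extension, is left linear.\<close>

lemma Upsilon_left_linear: "\<Upsilon> \<cdot>\<^bsub>C\<^esub> blact KK = (mul A \<otimes>\<^bsub>C\<^esub> \<one>\<^bsub>C\<^esub> (X \<otimes>\<^sub>o\<^bsub>C\<^esub> X)) \<cdot>\<^bsub>C\<^esub> (\<one>\<^bsub>C\<^esub> alg A \<otimes>\<^bsub>C\<^esub> \<Upsilon>)"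
proof (rule C.split_coequalizer_epi[OF C.split_coequalizer_tensor[OF KK_quo(8) C.algebra_simps(1)]])
  note [simp] = Upsilon_props(1-6,8,9) left_moduleD(2-4)[OF KK_quo(1), simplified]
  have "(\<Upsilon> \<cdot>\<^bsub>C\<^esub> blact KK) \<cdot>\<^bsub>C\<^esub> (\<one>\<^bsub>C\<^esub> alg A \<otimes>\<^bsub>C\<^esub> qK) = (\<Upsilon> \<cdot>\<^bsub>C\<^esub> qK) \<cdot>\<^bsub>C\<^esub> (mul A \<otimes>\<^bsub>C\<^esub> \<one>\<^bsub>C\<^esub> (X \<otimes>\<^sub>o\<^bsub>C\<^esub> alg A \<otimes>\<^sub>o\<^bsub>C\<^esub> X))"
    using KK_quo(4) by (simp add: C.reassoc[OF Upsilon_props(7)] Upsilon_props(7))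
  also have "\<dots> = (W.\<beta> \<cdot>\<^bsub>C\<^esub> (mul A \<otimes>\<^bsub>C\<^esub> \<one>\<^bsub>C\<^esub> (X \<otimes>\<^sub>o\<^bsub>C\<^esub> alg A))) \<otimes>\<^bsub>C\<^esub> \<one>\<^bsub>C\<^esub> X"
    by (simp add: Upsilon_props(7))
  also have "\<dots> = ((mul A \<otimes>\<^bsub>C\<^esub> \<one>\<^bsub>C\<^esub> (X \<otimes>\<^sub>o\<^bsub>C\<^esub> X)) \<cdot>\<^bsub>C\<^esub> (\<one>\<^bsub>C\<^esub> alg A \<otimes>\<^bsub>C\<^esub> \<Upsilon>)) \<cdot>\<^bsub>C\<^esub> (\<one>\<^bsub>C\<^esub> alg A \<otimes>\<^bsub>C\<^esub> qK)"
    using arg_cong[OF Upsilon_props(7), of "\<lambda>x. \<one>\<^bsub>C\<^esub> alg A \<otimes>\<^bsub>C\<^esub> x"] by (simp add: C.extension_linear)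
  finally show "(\<Upsilon> \<cdot>\<^bsub>C\<^esub> blact KK) \<cdot>\<^bsub>C\<^esub> (\<one>\<^bsub>C\<^esub> alg A \<otimes>\<^bsub>C\<^esub> qK)
      = ((mul A \<otimes>\<^bsub>C\<^esub> \<one>\<^bsub>C\<^esub> (X \<otimes>\<^sub>o\<^bsub>C\<^esub> X)) \<cdot>\<^bsub>C\<^esub> (\<one>\<^bsub>C\<^esub> alg A \<otimes>\<^bsub>C\<^esub> \<Upsilon>)) \<cdot>\<^bsub>C\<^esub> (\<one>\<^bsub>C\<^esub> alg A \<otimes>\<^bsub>C\<^esub> qK)" .
qed (simp_all add: Upsilon_props(1-9) left_moduleD(2-4)[OF KK_quo(1), simplified])

lemma KK_free_via: "free_via C A (left_part KK) (X \<otimes>\<^sub>o\<^bsub>C\<^esub> X) \<Upsilon> \<Upsilon>'"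
  using KK_quo(1) Upsilon_props Upsilon_left_linear by (simp add: free_via_def hom_def)

lemma comul_left_linear: "left_linear C A (left_part K) (left_part KK) (comul K)"
proof -
  note [simp] = Upsilon_props(1-6,8,9) left_moduleD(2-4)[OF KK_quo(1), simplified]
  have "(\<Upsilon>' \<cdot>\<^bsub>C\<^esub> \<Upsilon>) \<cdot>\<^bsub>C\<^esub> blact KK \<cdot>\<^bsub>C\<^esub> (\<one>\<^bsub>C\<^esub> alg A \<otimes>\<^bsub>C\<^esub> \<Upsilon>') \<cdot>\<^bsub>C\<^esub> (\<one>\<^bsub>C\<^esub> alg A \<otimes>\<^bsub>C\<^esub> W.\<rho>)
      = \<Upsilon>' \<cdot>\<^bsub>C\<^esub> (\<Upsilon> \<cdot>\<^bsub>C\<^esub> blact KK) \<cdot>\<^bsub>C\<^esub> (\<one>\<^bsub>C\<^esub> alg A \<otimes>\<^bsub>C\<^esub> \<Upsilon>') \<cdot>\<^bsub>C\<^esub> (\<one>\<^bsub>C\<^esub> alg A \<otimes>\<^bsub>C\<^esub> W.\<rho>)"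
    by (simp del: Upsilon_props(9))
  also have "\<dots> = \<Upsilon>' \<cdot>\<^bsub>C\<^esub> (mul A \<otimes>\<^bsub>C\<^esub> \<one>\<^bsub>C\<^esub> (X \<otimes>\<^sub>o\<^bsub>C\<^esub> X)) \<cdot>\<^bsub>C\<^esub> (\<one>\<^bsub>C\<^esub> alg A \<otimes>\<^bsub>C\<^esub> (\<Upsilon> \<cdot>\<^bsub>C\<^esub> \<Upsilon>' \<cdot>\<^bsub>C\<^esub> W.\<rho>))"
    unfolding Upsilon_left_linear by (simp del: Upsilon_props(8))
  also have "\<Upsilon> \<cdot>\<^bsub>C\<^esub> \<Upsilon>' \<cdot>\<^bsub>C\<^esub> W.\<rho> = W.\<rho>"
    by (simp add: C.reassoc[OF Upsilon_props(8)])
  finally show ?thesis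
    by (simp add: left_linear_def hom_def comul_K C.extension_linear)
qed

lemma couni_left_linear: "left_linear C A (left_part K) (left_part (regular_bimod A)) (couni K)"
  using C.extension_linear[of "uob C" f X] by (simp add: left_linear_def hom_def couni_K)

end

section \<open>Corepresentations and generalized entwined modules\<close>

lemma mod_part_right_module [simp]: "right_module D C A (mod_part N) = right_module D C A N"
  by (simp add: right_module_def)

context cowreath_action
begin

text \<open>The action on \<open>M \<diamondop>\<^sub>A K\<close> corresponds under \<open>expand\<close> to \<open>(\<nu> \<diamondop> X) \<cdot> (M \<diamondop> \<psi>)\<close> on \<open>M \<diamondop> X\<close>, because the right
  action \<open>\<beta>\<close> of \<open>K\<close> restricts to \<open>\<psi>\<close> along the unit of \<open>A\<close>.\<close>

lemma coact_linear_iff: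
  assumes M: "right_module D C A M" and \<rho>: "\<rho> \<in> hom D (rob M) (rob M \<diamondop>\<^sub>o X)"
  shows "right_linear D C A M (bal_rmod D C A M K) (expand M \<cdot> \<rho>) \<longleftrightarrow>
    \<rho> \<cdot> ract M = (ract M \<diamondop> \<one>\<^bsub>C\<^esub> X) \<cdot> (\<one> rob M \<diamondop> \<psi>) \<cdot> (\<rho> \<diamondop> \<one>\<^bsub>C\<^esub> alg A)"
proof -
  let ?B = "bal_rmod D C A M K" and ?q = "quo D C M (left_part K)"
  note B = bal_rmod_quo[OF M K_bimodule K_free] and LK = bimoduleD(1)[OF K_bimodule]
  note [simp] = right_moduleD(1-4)[OF M] homD[OF \<rho>] comparison(1-6)[OF M] quo_simps(1-4)[OF M LK, simplified]
    right_moduleD(1-4)[OF B(1)] B(2)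
  have "ract ?B \<cdot> (expand M \<diamondop> \<one>\<^bsub>C\<^esub> alg A)
      = (ract ?B \<cdot> (?q \<diamondop> \<one>\<^bsub>C\<^esub> alg A)) \<cdot> (\<one> rob M \<diamondop> (eta A \<otimes>\<^bsub>C\<^esub> \<one>\<^bsub>C\<^esub> (X \<otimes>\<^sub>o\<^bsub>C\<^esub> alg A)))"
    by (simp add: comparison(11)[OF M])
  also have "\<dots> = ?q \<cdot> (\<one> rob M \<diamondop> (W.\<beta> \<cdot>\<^bsub>C\<^esub> (eta A \<otimes>\<^bsub>C\<^esub> \<one>\<^bsub>C\<^esub> (X \<otimes>\<^sub>o\<^bsub>C\<^esub> alg A))))"
    unfolding B(3) by (simp add: bract_K)
  also have "\<dots> = expand M \<cdot> (ract M \<diamondop> \<one>\<^bsub>C\<^esub> X) \<cdot> (\<one> rob M \<diamondop> \<psi>)"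
    by (simp add: C.extension_unit reassoc[OF comparison(8)[OF M]])
  finally have v: "ract ?B \<cdot> (expand M \<diamondop> \<one>\<^bsub>C\<^esub> alg A) = expand M \<cdot> (ract M \<diamondop> \<one>\<^bsub>C\<^esub> X) \<cdot> (\<one> rob M \<diamondop> \<psi>)" .
  have "ract ?B \<cdot> ((expand M \<cdot> \<rho>) \<diamondop> \<one>\<^bsub>C\<^esub> alg A)
      = (ract ?B \<cdot> (expand M \<diamondop> \<one>\<^bsub>C\<^esub> alg A)) \<cdot> (\<rho> \<diamondop> \<one>\<^bsub>C\<^esub> alg A)"
    by simp
  also have "\<dots> = expand M \<cdot> (ract M \<diamondop> \<one>\<^bsub>C\<^esub> X) \<cdot> (\<one> rob M \<diamondop> \<psi>) \<cdot> (\<rho> \<diamondop> \<one>\<^bsub>C\<^esub> alg A)"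
    unfolding v by simp
  finally show ?thesis
    by (simp add: right_linear_def hom_def expand_cancel[OF M] del: act_whisker_right)
qed

text \<open>The analogue \<open>w\<close> of \<open>contract\<close> for \<open>M \<diamondop>\<^sub>A (K \<otimes>\<^sub>A K) \<rightarrow> M \<diamondop> X \<diamondop> X\<close>. Coassociativity is an equation
  between morphisms into the source of \<open>w\<close> and is tested after composition with it.\<close>

lemma KK_comparison:
  assumes M: "right_module D C A M"
  obtains w where "w \<in> Arr D" "Dom D w = bal_ob D C M (left_part KK)" "Cod D w = rob M \<diamondop>\<^sub>o (X \<otimes>\<^sub>o\<^bsub>C\<^esub> X)"
    "w \<cdot> quo D C M (left_part KK) = (ract M \<diamondop> \<one>\<^bsub>C\<^esub> (X \<otimes>\<^sub>o\<^bsub>C\<^esub> X)) \<cdot> (\<one> rob M \<diamondop> \<Upsilon>)"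
    "\<And>x y. \<lbrakk>x \<in> Arr D; y \<in> Arr D; Dom D x = Dom D y; Cod D x = bal_ob D C M (left_part KK);
      Cod D y = bal_ob D C M (left_part KK)\<rbrakk> \<Longrightarrow> w \<cdot> x = w \<cdot> y \<longleftrightarrow> x = y"
proof -
  obtain w z where w: "w \<in> hom D (bal_ob D C M (left_part KK)) (rob M \<diamondop>\<^sub>o (X \<otimes>\<^sub>o\<^bsub>C\<^esub> X))"
    and z: "z \<in> hom D (rob M \<diamondop>\<^sub>o (X \<otimes>\<^sub>o\<^bsub>C\<^esub> X)) (bal_ob D C M (left_part KK))"
    and wq: "w \<cdot> quo D C M (left_part KK) = (ract M \<diamondop> \<one>\<^bsub>C\<^esub> (X \<otimes>\<^sub>o\<^bsub>C\<^esub> X)) \<cdot> (\<one> rob M \<diamondop> \<Upsilon>)"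
    and zw: "z \<cdot> w = \<one> (bal_ob D C M (left_part KK))"
    using free_quotient_comparison[OF M KK_free_via] by blast
  note [simp] = homD[OF w] homD[OF z]
  have "x = y" if "x \<in> Arr D" "y \<in> Arr D" "Dom D x = Dom D y" "Cod D x = bal_ob D C M (left_part KK)"
      "Cod D y = bal_ob D C M (left_part KK)" "w \<cdot> x = w \<cdot> y" for x y
  proof -
    have "(z \<cdot> w) \<cdot> x = (z \<cdot> w) \<cdot> y" using that by simp
    then show ?thesis unfolding zw using that by simp
  qed
  then show thesis using that[of w] wq by (metis homD w)
qed

text \<open>Every structure morphism that is applied to a coaction \<open>expand M \<cdot> \<rho>\<close> is evaluated by this formula:
  the coaction enters the balanced product through the unit of \<open>A\<close>.\<close>

lemma bal_ar_expand:
  assumes M: "right_module D C A M" and M': "right_module D C A M'" and Y: "left_module C A Y"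
    and g: "right_linear D C A M M' g" and h: "left_linear C A (left_part K) Y h"
    and x: "x \<in> Arr D" "Cod D x = rob M \<diamondop>\<^sub>o X"
  shows "bal_ar D C M M' (left_part K) Y g h \<cdot> expand M \<cdot> x
    = quo D C M' Y \<cdot> (g \<diamondop> h) \<cdot> (\<one> rob M \<diamondop> (eta A \<otimes>\<^bsub>C\<^esub> \<one>\<^bsub>C\<^esub> X)) \<cdot> x"
proof -
  note LK = bimoduleD(1)[OF K_bimodule]
  note b = bal_ar_quo[OF M M' LK Y g h]
  note [simp] = right_moduleD(1-4)[OF M] right_moduleD(1-4)[OF M'] b(1-3) x
    quo_simps(1-4)[OF M LK, simplified] quo_simps(1-4)[OF M' Y] left_moduleD(1-4)[OF Y]
  have [simp]: "g \<in> Arr D" "Dom D g = rob M" "Cod D g = rob M'"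
    "h \<in> Arr C" "Dom C h = alg A \<otimes>\<^sub>o\<^bsub>C\<^esub> X" "Cod C h = lob Y"
    using g h by (auto simp: right_linear_def left_linear_def hom_def)
  show ?thesis
    by (simp add: comparison(11)[OF M] reassoc_square[OF b(4)])
qed

lemma right_linear_Idn: "right_module D C A M \<Longrightarrow> right_linear D C A M M (\<one> rob M)"
  using right_moduleD(1-4)[of M] by (simp add: right_linear_def hom_def)

lemma left_linear_Idn: "left_module C A Y \<Longrightarrow> left_linear C A Y Y (\<one>\<^bsub>C\<^esub> lob Y)"
  using left_moduleD(1-4)[of Y] by (simp add: left_linear_def hom_def)

text \<open>Under the isomorphism \<open>w\<close> of \<open>KK_comparison\<close> the two sides of coassociativity become exactly the two
  sides of the \<open>\<delta>\<close>-axiom. On the left, \<open>qK\<close> is followed by \<open>\<Upsilon>\<close>, and \<open>\<Upsilon> \<cdot> qK = \<beta> \<otimes> X\<close> collapses the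
  two units of \<open>A\<close> into one; on the right, \<open>\<Upsilon>\<close> cancels against the comultiplication.\<close>

lemma coact_coassoc_iff:
  assumes M: "right_module D C A M" and \<rho>: "\<rho> \<in> hom D (rob M) (rob M \<diamondop>\<^sub>o X)"
    and lin: "right_linear D C A M (bal_rmod D C A M K) (expand M \<cdot> \<rho>)"
  shows "assoc_c D C A M K K \<cdot>
      bal_ar D C M (bal_rmod D C A M K) (left_part K) (left_part K) (expand M \<cdot> \<rho>) (\<one>\<^bsub>C\<^esub> bob K) \<cdot> expand M \<cdot> \<rho>
    = bal_ar D C M M (left_part K) (left_part KK) (\<one> rob M) (comul K) \<cdot> expand M \<cdot> \<rho>
    \<longleftrightarrow> (\<rho> \<diamondop> \<one>\<^bsub>C\<^esub> X) \<cdot> \<rho> = (ract M \<diamondop> \<one>\<^bsub>C\<^esub> X \<otimes>\<^bsub>C\<^esub> \<one>\<^bsub>C\<^esub> X) \<cdot> (\<one> rob M \<diamondop> \<delta>) \<cdot> \<rho>"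
  (is "?a \<cdot> ?b \<cdot> _ = ?c \<cdot> _ \<longleftrightarrow> _")
proof -
  let ?B = "bal_rmod D C A M K" and ?q = "quo D C M (left_part K)"
  let ?q' = "quo D C ?B (left_part K)" and ?r' = "quo D C M (left_part KK)"
  note B = bal_rmod_quo[OF M K_bimodule K_free] and LK = bimoduleD(1)[OF K_bimodule]
  note a = assoc_c_quo[OF M K_bimodule K_free K_bimodule K_free]
  have lK: "left_linear C A (left_part K) (left_part K) (\<one>\<^bsub>C\<^esub> bob K)"
    using left_linear_Idn[OF LK] by simp
  note b = bal_ar_quo[OF M B(1) LK LK lin lK]
  note c = bal_ar_quo[OF M M LK KK_quo(1) right_linear_Idn[OF M] comul_left_linear]
  obtain w where w: "w \<in> Arr D" "Dom D w = bal_ob D C M (left_part KK)" "Cod D w = rob M \<diamondop>\<^sub>o (X \<otimes>\<^sub>o\<^bsub>C\<^esub> X)"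
    and wq: "w \<cdot> ?r' = (ract M \<diamondop> \<one>\<^bsub>C\<^esub> (X \<otimes>\<^sub>o\<^bsub>C\<^esub> X)) \<cdot> (\<one> rob M \<diamondop> \<Upsilon>)"
    and w_cancel: "\<And>x y. \<lbrakk>x \<in> Arr D; y \<in> Arr D; Dom D x = Dom D y; Cod D x = bal_ob D C M (left_part KK);
      Cod D y = bal_ob D C M (left_part KK)\<rbrakk> \<Longrightarrow> w \<cdot> x = w \<cdot> y \<longleftrightarrow> x = y"
    by (rule KK_comparison[OF M]) blast
  note [simp] = right_moduleD(1-4)[OF M] homD[OF \<rho>] comparison(1-6)[OF M] right_moduleD(1-4)[OF B(1)] B(2)
    quo_simps(1-4)[OF M LK, simplified] quo_simps(1-4)[OF B(1) LK, simplified]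
    quo_simps(1-4)[OF M KK_quo(1), simplified] a(1-3) b(1-3)[unfolded K_simps] c(1-3) w Upsilon_props(1-6)
  have comul [simp]: "comul K \<in> Arr C" "Dom C (comul K) = alg A \<otimes>\<^sub>o\<^bsub>C\<^esub> X" "Cod C (comul K) = bob KK"
    by (simp_all add: comul_K)
  let ?i = "\<lambda>Y. eta A \<otimes>\<^bsub>C\<^esub> \<one>\<^bsub>C\<^esub> Y"
  have L: "w \<cdot> ?a \<cdot> ?b \<cdot> expand M \<cdot> \<rho> = (\<rho> \<diamondop> \<one>\<^bsub>C\<^esub> X) \<cdot> \<rho>"
  proof -
    have "?a \<cdot> ?b \<cdot> expand M \<cdot> \<rho> = ?a \<cdot> ?q' \<cdot> (expand M \<diamondop> \<one>\<^bsub>C\<^esub> bob K) \<cdot> (\<rho> \<diamondop> \<one>\<^bsub>C\<^esub> bob K) \<cdot> (\<one> rob M \<diamondop> ?i X) \<cdot> \<rho>"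
      using bal_ar_expand[OF M B(1) LK lin lK, of \<rho>] by simp
    also have "\<dots> = (?a \<cdot> ?q' \<cdot> (?q \<diamondop> \<one>\<^bsub>C\<^esub> bob K)) \<cdot> (\<one> rob M \<diamondop> ?i (X \<otimes>\<^sub>o\<^bsub>C\<^esub> bob K)) \<cdot> (\<rho> \<diamondop> \<one>\<^bsub>C\<^esub> bob K) \<cdot> (\<one> rob M \<diamondop> ?i X) \<cdot> \<rho>"
      by (simp add: comparison(11)[OF M])
    also have "\<dots> = ?r' \<cdot> (\<one> rob M \<diamondop> qK) \<cdot> (\<one> rob M \<diamondop> ?i (X \<otimes>\<^sub>o\<^bsub>C\<^esub> bob K)) \<cdot> (\<rho> \<diamondop> \<one>\<^bsub>C\<^esub> bob K) \<cdot> (\<one> rob M \<diamondop> ?i X) \<cdot> \<rho>"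
      unfolding a(4) by simp
    also have "\<dots> = ?r' \<cdot> (\<one> rob M \<diamondop> (qK \<cdot>\<^bsub>C\<^esub> ?i (X \<otimes>\<^sub>o\<^bsub>C\<^esub> bob K) \<cdot>\<^bsub>C\<^esub> (\<one>\<^bsub>C\<^esub> X \<otimes>\<^bsub>C\<^esub> ?i X))) \<cdot> (\<rho> \<diamondop> \<one>\<^bsub>C\<^esub> X) \<cdot> \<rho>"
      using reassoc_square[OF act_slide[of \<rho> "?i X"]] by simp
    finally have 1: "?a \<cdot> ?b \<cdot> expand M \<cdot> \<rho> = \<dots>" .
    have "\<Upsilon> \<cdot>\<^bsub>C\<^esub> qK \<cdot>\<^bsub>C\<^esub> ?i (X \<otimes>\<^sub>o\<^bsub>C\<^esub> bob K) \<cdot>\<^bsub>C\<^esub> (\<one>\<^bsub>C\<^esub> X \<otimes>\<^bsub>C\<^esub> ?i X)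
        = ((W.\<beta> \<cdot>\<^bsub>C\<^esub> ?i (X \<otimes>\<^sub>o\<^bsub>C\<^esub> alg A)) \<otimes>\<^bsub>C\<^esub> \<one>\<^bsub>C\<^esub> X) \<cdot>\<^bsub>C\<^esub> (\<one>\<^bsub>C\<^esub> X \<otimes>\<^bsub>C\<^esub> ?i X)"
      by (simp add: C.reassoc[OF Upsilon_props(7)])
    also have "\<dots> = (\<psi> \<cdot>\<^bsub>C\<^esub> (\<one>\<^bsub>C\<^esub> X \<otimes>\<^bsub>C\<^esub> eta A)) \<otimes>\<^bsub>C\<^esub> \<one>\<^bsub>C\<^esub> X"
      by (simp add: C.extension_unit)
    also have "\<dots> = ?i (X \<otimes>\<^sub>o\<^bsub>C\<^esub> X)"
      by (simp add: W.psi_eta)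
    finally have 2: "\<Upsilon> \<cdot>\<^bsub>C\<^esub> qK \<cdot>\<^bsub>C\<^esub> ?i (X \<otimes>\<^sub>o\<^bsub>C\<^esub> bob K) \<cdot>\<^bsub>C\<^esub> (\<one>\<^bsub>C\<^esub> X \<otimes>\<^bsub>C\<^esub> ?i X) = ?i (X \<otimes>\<^sub>o\<^bsub>C\<^esub> X)" .
    have "w \<cdot> ?a \<cdot> ?b \<cdot> expand M \<cdot> \<rho> = (w \<cdot> ?r') \<cdot> (\<one> rob M \<diamondop> (qK \<cdot>\<^bsub>C\<^esub> ?i (X \<otimes>\<^sub>o\<^bsub>C\<^esub> bob K) \<cdot>\<^bsub>C\<^esub> (\<one>\<^bsub>C\<^esub> X \<otimes>\<^bsub>C\<^esub> ?i X))) \<cdot> (\<rho> \<diamondop> \<one>\<^bsub>C\<^esub> X) \<cdot> \<rho>"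
      unfolding 1 by simp
    also have "\<dots> = (ract M \<diamondop> \<one>\<^bsub>C\<^esub> (X \<otimes>\<^sub>o\<^bsub>C\<^esub> X)) \<cdot> (\<one> rob M \<diamondop> (\<Upsilon> \<cdot>\<^bsub>C\<^esub> qK \<cdot>\<^bsub>C\<^esub> ?i (X \<otimes>\<^sub>o\<^bsub>C\<^esub> bob K) \<cdot>\<^bsub>C\<^esub> (\<one>\<^bsub>C\<^esub> X \<otimes>\<^bsub>C\<^esub> ?i X))) \<cdot> (\<rho> \<diamondop> \<one>\<^bsub>C\<^esub> X) \<cdot> \<rho>"
      unfolding wq by simp
    also have "\<dots> = (\<rho> \<diamondop> \<one>\<^bsub>C\<^esub> X) \<cdot> \<rho>"
      unfolding 2 by (simp add: reassoc[OF right_module_whisker(2)[OF M]])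
    finally show ?thesis .
  qed
  have R: "w \<cdot> ?c \<cdot> expand M \<cdot> \<rho> = (ract M \<diamondop> \<one>\<^bsub>C\<^esub> X \<otimes>\<^bsub>C\<^esub> \<one>\<^bsub>C\<^esub> X) \<cdot> (\<one> rob M \<diamondop> \<delta>) \<cdot> \<rho>"
  proof -
    have "w \<cdot> ?c \<cdot> expand M \<cdot> \<rho> = (w \<cdot> ?r') \<cdot> (\<one> rob M \<diamondop> comul K) \<cdot> (\<one> rob M \<diamondop> ?i X) \<cdot> \<rho>"
      by (simp add: bal_ar_expand[OF M M KK_quo(1) right_linear_Idn[OF M] comul_left_linear])
    also have "\<dots> = (ract M \<diamondop> \<one>\<^bsub>C\<^esub> (X \<otimes>\<^sub>o\<^bsub>C\<^esub> X)) \<cdot> (\<one> rob M \<diamondop> (\<Upsilon> \<cdot>\<^bsub>C\<^esub> comul K \<cdot>\<^bsub>C\<^esub> ?i X)) \<cdot> \<rho>"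
      unfolding wq by simp
    also have "\<Upsilon> \<cdot>\<^bsub>C\<^esub> comul K \<cdot>\<^bsub>C\<^esub> ?i X = \<delta>"
      by (simp add: comul_K C.reassoc[OF Upsilon_props(8)] C.extension_unit)
    finally show ?thesis by simp
  qed
  show ?thesis
    unfolding L[symmetric] R[symmetric] by (rule w_cancel[symmetric]) simp_all
qed

lemma coact_counit:
  assumes M: "right_module D C A M" and \<rho>: "\<rho> \<in> hom D (rob M) (rob M \<diamondop>\<^sub>o X)"
  shows "runit_c D C A M \<cdot> bal_ar D C M M (left_part K) (left_part (regular_bimod A)) (\<one> rob M) (couni K) \<cdot> expand M \<cdot> \<rho>
    = ract M \<cdot> (\<one> rob M \<diamondop> f) \<cdot> \<rho>"
proof -
  note LA = bimoduleD(1)[OF regular_bimodule]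
  note [simp] = right_moduleD(1-4)[OF M] homD[OF \<rho>] runit_quo(1-3)[OF M] quo_simps(1-4)[OF M LA, simplified]
  have "runit_c D C A M \<cdot> bal_ar D C M M (left_part K) (left_part (regular_bimod A)) (\<one> rob M) (couni K) \<cdot> expand M \<cdot> \<rho>
      = ract M \<cdot> (\<one> rob M \<diamondop> (couni K \<cdot>\<^bsub>C\<^esub> (eta A \<otimes>\<^bsub>C\<^esub> \<one>\<^bsub>C\<^esub> X))) \<cdot> \<rho>"
    using bal_ar_expand[OF M M LA right_linear_Idn[OF M] couni_left_linear, of \<rho>]
    by (simp add: couni_K reassoc[OF runit_quo(4)[OF M]])
  also have "couni K \<cdot>\<^bsub>C\<^esub> (eta A \<otimes>\<^bsub>C\<^esub> \<one>\<^bsub>C\<^esub> X) = f"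
    by (simp add: couni_K C.extension_unit)
  finally show ?thesis .
qed

lemma corepresentation_iff_entwined:
  assumes \<rho>: "\<rho> \<in> hom D (rob N) (rob N \<diamondop>\<^sub>o X)"
    and "right_module D C A N"
  shows "corepresentation D C A K (N\<lparr>coact := expand (mod_part N) \<cdot> \<rho>\<rparr>) \<longleftrightarrow>
    entwined_module D C A X \<psi> \<delta> f (N\<lparr>coact := \<rho>\<rparr>)"
proof -
  let ?M = "mod_part N"
  have M: "right_module D C A ?M" using assms(2) by simp
  have \<rho>': "\<rho> \<in> hom D (rob ?M) (rob ?M \<diamondop>\<^sub>o X)" using \<rho> by simp
  have mp: "mod_part (N\<lparr>coact := c\<rparr>) = ?M" for c by (simp add: mod_part_def)
  have rm: "right_module D C A (N\<lparr>coact := c\<rparr>)" for c using assms(2) by (simp add: right_module_def)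
  show ?thesis
    unfolding corepresentation_def entwined_module_def Let_def mp
    using coact_linear_iff[OF M \<rho>'] coact_coassoc_iff[OF M \<rho>'] coact_counit[OF M \<rho>'] M \<rho> rm
    by (auto simp: part_simps)
qed

text \<open>Naturality of \<open>expand\<close> in \<open>M\<close> turns one condition into the other.\<close>

lemma colinear_iff_entwined:
  assumes M: "right_module D C A M" and N: "right_module D C A N"
    and \<rho>M: "\<rho>M \<in> hom D (rob M) (rob M \<diamondop>\<^sub>o X)" and \<rho>N: "\<rho>N \<in> hom D (rob N) (rob N \<diamondop>\<^sub>o X)"
  shows "colinear D C A K (M\<lparr>coact := expand (mod_part M) \<cdot> \<rho>M\<rparr>) (N\<lparr>coact := expand (mod_part N) \<cdot> \<rho>N\<rparr>) h \<longleftrightarrow>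
    entwined_map D C A X (M\<lparr>coact := \<rho>M\<rparr>) (N\<lparr>coact := \<rho>N\<rparr>) h"
proof -
  let ?M = "mod_part M" and ?N = "mod_part N"
  have M': "right_module D C A ?M" and N': "right_module D C A ?N" using M N by simp_all
  have mp: "mod_part (N\<lparr>coact := c\<rparr>) = mod_part N" for N :: "('p, 'b) comod" and c by (simp add: mod_part_def)
  have rl: "right_linear D C A (M\<lparr>coact := c\<rparr>) (N\<lparr>coact := d\<rparr>) = right_linear D C A ?M ?N" for c d
    by (simp add: right_linear_def fun_eq_iff)
  have "expand ?N \<cdot> \<rho>N \<cdot> h = bal_ar D C ?M ?N (left_part K) (left_part K) h (\<one>\<^bsub>C\<^esub> bob K) \<cdot> expand ?M \<cdot> \<rho>M
      \<longleftrightarrow> \<rho>N \<cdot> h = (h \<diamondop> \<one>\<^bsub>C\<^esub> X) \<cdot> \<rho>M" if h: "right_linear D C A ?M ?N h"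
  proof -
    note LK = bimoduleD(1)[OF K_bimodule]
    have lK: "left_linear C A (left_part K) (left_part K) (\<one>\<^bsub>C\<^esub> bob K)"
      using left_linear_Idn[OF LK] by simp
    have [simp]: "h \<in> Arr D" "Dom D h = rob M" "Cod D h = rob N"
      using h by (auto simp: right_linear_def hom_def)
    note [simp] = right_moduleD(1-4)[OF M] right_moduleD(1-4)[OF N] homD[OF \<rho>M] homD[OF \<rho>N]
      comparison(1-6)[OF M', simplified] comparison(1-6)[OF N', simplified] quo_simps(1-4)[OF N' LK, simplified]
    have "bal_ar D C ?M ?N (left_part K) (left_part K) h (\<one>\<^bsub>C\<^esub> bob K) \<cdot> expand ?M \<cdot> \<rho>M
        = quo D C ?N (left_part K) \<cdot> (h \<diamondop> \<one>\<^bsub>C\<^esub> bob K) \<cdot> (\<one> rob M \<diamondop> (eta A \<otimes>\<^bsub>C\<^esub> \<one>\<^bsub>C\<^esub> X)) \<cdot> \<rho>M"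
      using bal_ar_expand[OF M' N' LK h lK, of \<rho>M] by simp
    also have "\<dots> = expand ?N \<cdot> (h \<diamondop> \<one>\<^bsub>C\<^esub> X) \<cdot> \<rho>M"
      using reassoc_square[OF act_slide[of h "eta A \<otimes>\<^bsub>C\<^esub> \<one>\<^bsub>C\<^esub> X"]] by (simp add: comparison(11)[OF N'])
    finally show ?thesis by (simp add: expand_cancel[OF N'])
  qed
  then show ?thesis
    unfolding colinear_def entwined_map_def mp rl
    using \<rho>N comparison(1-6)[OF N'] by (auto simp: right_linear_def hom_def)
qed

end

section \<open>Compatibility of the coring\<close>

lemma (in category) factor_eq:
  assumes q: "is_coequalizer C f g q" and k: "k \<in> Arr C" "Dom C k = Cod C q" "k \<cdot> q = h"
  shows "factor C q h = k"
proof (rule factor_eqI)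
  note t = coequalizerD(3)[OF q]
  have cod: "Cod C h = Cod C k" using k t by (simp flip: k(3))
  show "k \<in> hom C (Cod C q) (Cod C h)" using k cod by (simp add: hom_def)
  show "k' = k" if "k' \<in> hom C (Cod C q) (Cod C h)" "k' \<cdot> q = h" for k'
    by (rule coequalizer_epi[OF q]) (use that k in \<open>auto simp: hom_def\<close>)
qed (rule k)

lemma (in right_C_category) coflat_tensor:
  assumes Y: "coflat D C Y" "Y \<in> Obj C" and Z: "coflat D C Z" "Z \<in> Obj C"
  shows "coflat D C (Y \<otimes>\<^sub>o\<^bsub>C\<^esub> Z)"
  unfolding coflat_def
proof (intro allI impI)
  fix f g q assume q: "is_coequalizer D f g q"
  note t = coequalizerD(1-3)[OF q]
  have "is_coequalizer D ((f \<diamondop> \<one>\<^bsub>C\<^esub> Y) \<diamondop> \<one>\<^bsub>C\<^esub> Z) ((g \<diamondop> \<one>\<^bsub>C\<^esub> Y) \<diamondop> \<one>\<^bsub>C\<^esub> Z) ((q \<diamondop> \<one>\<^bsub>C\<^esub> Y) \<diamondop> \<one>\<^bsub>C\<^esub> Z)"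
    using Y(1) Z(1) q unfolding coflat_def by blast
  then show "is_coequalizer D (f \<diamondop> \<one>\<^bsub>C\<^esub> (Y \<otimes>\<^sub>o\<^bsub>C\<^esub> Z)) (g \<diamondop> \<one>\<^bsub>C\<^esub> (Y \<otimes>\<^sub>o\<^bsub>C\<^esub> Z)) (q \<diamondop> \<one>\<^bsub>C\<^esub> (Y \<otimes>\<^sub>o\<^bsub>C\<^esub> Z))"
    using t Y(2) Z(2) by simp
qed

context cowreath_action
begin

lemma free_act_module:
  assumes M: "M \<in> Obj D" and Z: "right_module (self C) C A Z"
  shows "right_module D C A (free_act D M Z)"
proof -
  interpret S: algebra_action C "self C" A by (rule self_action)
  note [simp] = S.right_moduleD(1-4)[OF Z, simplified] M
  show ?thesis
    using arg_cong[OF S.right_moduleD(5)[OF Z], of "\<lambda>x. \<one> M \<diamondop> x"]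
      arg_cong[OF S.right_moduleD(6)[OF Z], of "\<lambda>x. \<one> M \<diamondop> x"]
    by (simp add: right_module_def hom_def free_act_def)
qed

text \<open>Both \<open>(M \<diamondop> Z) \<diamondop>\<^sub>A K\<close> and \<open>M \<diamondop> (Z \<otimes>\<^sub>A K)\<close> are identified with \<open>M \<diamondop> Z \<diamondop> X\<close>, one by \<open>contract\<close> in \<open>D\<close> and
  the other by \<open>contract\<close> in \<open>C\<close>, and the canonical morphism respects the identifications.\<close>

lemma K_robust: "robust D C A (left_part K)"
  unfolding robust_def
proof (intro allI impI, elim conjE)
  fix M and Z :: "('o, 'a) rmod" assume M: "M \<in> Obj D" and Z: "right_module (self C) C A Z"
  interpret S: cowreath_action C "self C" A X \<psi> \<delta> f by (rule self_cowreath_action)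
  let ?F = "free_act D M Z" and ?qZ = "quo (self C) C Z (left_part K)"
  let ?q = "quo D C ?F (left_part K)"
  note F = free_act_module[OF M Z] and LK = bimoduleD(1)[OF K_bimodule]
  have F_simps [simp]: "rob ?F = M \<diamondop>\<^sub>o rob Z" "ract ?F = \<one> M \<diamondop> ract Z"
    by (simp_all add: free_act_def)
  note s = S.comparison(1-10)[OF Z, simplified]
  note S_simps [simp] = S.right_moduleD(1-4)[OF Z, simplified] M s(1-6) comparison(1-6)[OF F, simplified]
    quo_simps(1-4)[OF F LK, simplified] S.quo_simps(1-4)[OF Z LK, simplified]
  have vu: "(\<one> M \<diamondop> S.expand Z) \<cdot> (\<one> M \<diamondop> S.contract Z) = \<one> (M \<diamondop>\<^sub>o bal_ob (self C) C Z (left_part K))"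
    "(\<one> M \<diamondop> S.contract Z) \<cdot> (\<one> M \<diamondop> S.expand Z) = \<one> (M \<diamondop>\<^sub>o (rob Z \<otimes>\<^sub>o\<^bsub>C\<^esub> X))"
    using s(9,10)[THEN arg_cong, of "\<lambda>x. \<one> M \<diamondop> x"] by simp_all
  have "theta D C M Z (left_part K) = (\<one> M \<diamondop> S.expand Z) \<cdot> contract ?F"
    unfolding theta_def
  proof (rule factor_eq[OF quo_is_coequalizer[OF F LK]])
    have "((\<one> M \<diamondop> S.expand Z) \<cdot> contract ?F) \<cdot> ?q = \<one> M \<diamondop> (S.expand Z \<cdot>\<^bsub>C\<^esub> (ract Z \<otimes>\<^bsub>C\<^esub> \<one>\<^bsub>C\<^esub> X))"
      using comparison(7)[OF F] by simp
    then show "((\<one> M \<diamondop> S.expand Z) \<cdot> contract ?F) \<cdot> ?q = \<one> M \<diamondop> ?qZ"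
      by (simp only: s(8))
  qed simp_all
  moreover have "inverse_arrows D ((\<one> M \<diamondop> S.expand Z) \<cdot> contract ?F) (expand ?F \<cdot> (\<one> M \<diamondop> S.contract Z))"
    using comparison(9,10)[OF F]
    by (simp add: inverse_arrows_def hom_def reassoc[OF vu(2)] reassoc[OF comparison(9)[OF F]] vu(1))
  ultimately show "is_iso D (theta D C M Z (left_part K))"
    unfolding is_iso_def by auto
qed

text \<open>Right linearity of the comultiplication, coassociativity and the right counit law hold because \<open>K\<close> is
  a corepresentation of itself, by \<open>corepresentation_iff_entwined\<close> for the action of \<open>C\<close> on itself. The
  left counit law concerns the other tensor factor and reduces to \<open>f_delta_left\<close>.\<close>

lemma K_compatible:
  assumes "coflat D C (alg A)" "coflat D C X" "left_coflat C (alg A)" "left_coflat C X"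
  shows "compatible_coring D C A K"
proof -
  interpret S: cowreath_action C "self C" A X \<psi> \<delta> f by (rule self_cowreath_action)
  note LK = bimoduleD(1)[OF K_bimodule] and RK = bimoduleD(2)[OF K_bimodule]
  have good: "good_bimodule D C A K"
    using assms K_bimodule K_robust S.K_robust coflat_tensor[of "alg A" X] S.coflat_tensor[of "alg A" X]
    by (simp add: good_bimodule_def)
  \<comment> \<open>\<open>K\<close> as a right module coacted upon by its own comultiplication.\<close>
  let ?N = "\<lparr>rob = bob K, ract = bract K, coact = comul K\<rparr>"
  have mp: "mod_part ?N = right_part K" by (simp add: mod_part_def right_part_def)
  have "entwined_module (self C) C A X \<psi> \<delta> f (?N\<lparr>coact := W.\<rho>\<rparr>)"
    using RK W.coaction_right_action W.coaction_coassoc W.coaction_counit_right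
    by (simp add: entwined_module_def right_module_def hom_def bract_K)
  then have "corepresentation (self C) C A K (?N\<lparr>coact := S.expand (mod_part ?N) \<cdot>\<^bsub>C\<^esub> W.\<rho>\<rparr>)"
    using S.corepresentation_iff_entwined[of W.\<rho> ?N] RK
    by (simp add: hom_def right_module_def)
  then have corep: "corepresentation (self C) C A K ?N"
    unfolding mp by (simp add: comul_K Upsilon_props(10))
  have right: "right_linear (self C) C A (right_part K) (right_part KK) (comul K)"
    using corep unfolding corepresentation_def mp Let_def KK_quo(2) by simp
  have couni_right: "right_linear (self C) C A (right_part K) (right_part (regular_bimod A)) (couni K)"
    using W.counit_right_linear by (simp add: right_linear_def hom_def couni_K bract_K)
  have left: "lunit_c C A (left_part K) \<cdot>\<^bsub>C\<^esub> bal_ar (self C) C (right_part K) (right_part (regular_bimod A))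
      (left_part K) (left_part K) (couni K) (\<one>\<^bsub>C\<^esub> bob K) \<cdot>\<^bsub>C\<^esub> comul K = \<one>\<^bsub>C\<^esub> bob K"
  proof -
    note RA = bimoduleD(2)[OF regular_bimodule]
    \<comment> \<open>The left unit constraint at \<open>K\<close> is the comparison for the right module \<open>A\<close>.\<close>
    have lunit: "lunit_c C A (left_part K) = S.contract (right_part (regular_bimod A))"
      by (simp add: lunit_c_def S.contract_def)
    have lK: "left_linear C A (left_part K) (left_part K) (\<one>\<^bsub>C\<^esub> (alg A \<otimes>\<^sub>o\<^bsub>C\<^esub> X))"
      using left_linear_Idn[OF LK] by simp
    note [simp] = S.comparison(1-6)[OF RA, simplified] S.quo_simps(1-4)[OF RA LK, simplified]
    have "bal_ar (self C) C (right_part K) (right_part (regular_bimod A))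
        (left_part K) (left_part K) (couni K) (\<one>\<^bsub>C\<^esub> bob K) \<cdot>\<^bsub>C\<^esub> comul K
        = quo (self C) C (right_part (regular_bimod A)) (left_part K) \<cdot>\<^bsub>C\<^esub> (W.\<epsilon> \<otimes>\<^bsub>C\<^esub> \<one>\<^bsub>C\<^esub> (alg A \<otimes>\<^sub>o\<^bsub>C\<^esub> X))
          \<cdot>\<^bsub>C\<^esub> (\<one>\<^bsub>C\<^esub> (alg A \<otimes>\<^sub>o\<^bsub>C\<^esub> X) \<otimes>\<^bsub>C\<^esub> (eta A \<otimes>\<^bsub>C\<^esub> \<one>\<^bsub>C\<^esub> X)) \<cdot>\<^bsub>C\<^esub> W.\<rho>"
      using S.bal_ar_expand[OF RK RA LK couni_right lK, of W.\<rho>]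
      by (simp add: comul_K Upsilon_props(10) couni_K)
    then have "lunit_c C A (left_part K) \<cdot>\<^bsub>C\<^esub> bal_ar (self C) C (right_part K) (right_part (regular_bimod A))
        (left_part K) (left_part K) (couni K) (\<one>\<^bsub>C\<^esub> bob K) \<cdot>\<^bsub>C\<^esub> comul K
        = (mul A \<otimes>\<^bsub>C\<^esub> \<one>\<^bsub>C\<^esub> X) \<cdot>\<^bsub>C\<^esub> (W.\<epsilon> \<otimes>\<^bsub>C\<^esub> \<one>\<^bsub>C\<^esub> (alg A \<otimes>\<^sub>o\<^bsub>C\<^esub> X))
          \<cdot>\<^bsub>C\<^esub> (\<one>\<^bsub>C\<^esub> (alg A \<otimes>\<^sub>o\<^bsub>C\<^esub> X) \<otimes>\<^bsub>C\<^esub> (eta A \<otimes>\<^bsub>C\<^esub> \<one>\<^bsub>C\<^esub> X)) \<cdot>\<^bsub>C\<^esub> W.\<rho>"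
      by (simp add: lunit C.reassoc[OF S.comparison(7)[OF RA, simplified]])
    also have "\<dots> = (mul A \<otimes>\<^bsub>C\<^esub> \<one>\<^bsub>C\<^esub> X) \<cdot>\<^bsub>C\<^esub> (\<one>\<^bsub>C\<^esub> alg A \<otimes>\<^bsub>C\<^esub> (eta A \<otimes>\<^bsub>C\<^esub> \<one>\<^bsub>C\<^esub> X)) \<cdot>\<^bsub>C\<^esub> (W.\<epsilon> \<otimes>\<^bsub>C\<^esub> \<one>\<^bsub>C\<^esub> X) \<cdot>\<^bsub>C\<^esub> W.\<rho>"
      using C.reassoc_square[OF C.slide[of W.\<epsilon> "eta A \<otimes>\<^bsub>C\<^esub> \<one>\<^bsub>C\<^esub> X"], of W.\<rho>] by simp
    finally show ?thesis
      using W.coaction_counit_left by (simp add: C.algebra_whisker(3))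
  qed
  show ?thesis
    using good right left corep couni_right comul_left_linear couni_left_linear
    unfolding compatible_coring_def bimodule_map_def corepresentation_def mp Let_def KK_quo(2)
    by simp
qed

end

section \<open>Isomorphism of the two categories\<close>

lemma structured_cat_simps [simp]:
  "M \<in> Obj (structured_cat D P H) \<longleftrightarrow> P M"
  "(M, h, N) \<in> Arr (structured_cat D P H) \<longleftrightarrow> P M \<and> P N \<and> H M N h"
  "Dom (structured_cat D P H) (M, h, N) = M" "Cod (structured_cat D P H) (M, h, N) = N"
  "(N, h', N') \<cdot>\<^bsub>structured_cat D P H\<^esub> (M, h, L) = (M, h' \<cdot>\<^bsub>D\<^esub> h, N')"
  "\<one>\<^bsub>structured_cat D P H\<^esub> M = (M, \<one>\<^bsub>D\<^esub> rob M, M)"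
  by (simp_all add: structured_cat_def)

lemma structured_hom:
  "t \<in> hom (structured_cat D P H) M N \<longleftrightarrow> (\<exists>h. t = (M, h, N) \<and> P M \<and> P N \<and> H M N h)"
  by (cases t) (auto simp: hom_def)

text \<open>Such a category inherits associativity and units from \<open>D\<close>; only closure of its morphisms under
  identities and composition is to be checked.\<close>

lemma structured_category:
  assumes "category D"
    and hom: "\<And>M N h. \<lbrakk>P M; P N; H M N h\<rbrakk> \<Longrightarrow> h \<in> hom D (rob M) (rob N)"
    and Idn: "\<And>M. P M \<Longrightarrow> H M M (\<one>\<^bsub>D\<^esub> rob M)"
    and Cmp: "\<And>L M N h k. \<lbrakk>P L; P M; P N; H L M h; H M N k\<rbrakk> \<Longrightarrow> H L N (k \<cdot>\<^bsub>D\<^esub> h)"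
  shows "category (structured_cat D P H)"
proof -
  interpret D: category D by fact
  show ?thesis
  proof
    fix t assume "t \<in> Arr (structured_cat D P H)"
    then show "Dom (structured_cat D P H) t \<in> Obj (structured_cat D P H)"
      "Cod (structured_cat D P H) t \<in> Obj (structured_cat D P H)"
      by (cases t; simp)+
  next
    fix M assume "M \<in> Obj (structured_cat D P H)"
    then show "\<one>\<^bsub>structured_cat D P H\<^esub> M \<in> hom (structured_cat D P H) M M"
      by (simp add: structured_hom Idn)
  next
    fix L M N s t
    assume "s \<in> hom (structured_cat D P H) L M" "t \<in> hom (structured_cat D P H) M N"
    then show "t \<cdot>\<^bsub>structured_cat D P H\<^esub> s \<in> hom (structured_cat D P H) L N"
      by (auto simp: structured_hom intro: Cmp)
  next
    fix L M N R s t w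
    assume "s \<in> hom (structured_cat D P H) L M" "t \<in> hom (structured_cat D P H) M N"
      "w \<in> hom (structured_cat D P H) N R"
    then show "(w \<cdot>\<^bsub>structured_cat D P H\<^esub> t) \<cdot>\<^bsub>structured_cat D P H\<^esub> s
        = w \<cdot>\<^bsub>structured_cat D P H\<^esub> t \<cdot>\<^bsub>structured_cat D P H\<^esub> s"
      using D.Cmp_assoc hom by (fastforce simp: structured_hom)
  next
    fix M N t assume "t \<in> hom (structured_cat D P H) M N"
    then obtain h where t: "t = (M, h, N)" "h \<in> hom D (rob M) (rob N)"
      using hom by (auto simp: structured_hom)
    show "t \<cdot>\<^bsub>structured_cat D P H\<^esub> \<one>\<^bsub>structured_cat D P H\<^esub> M = t"
      "\<one>\<^bsub>structured_cat D P H\<^esub> N \<cdot>\<^bsub>structured_cat D P H\<^esub> t = t"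
      using D.Cmp_Idn[OF t(2)] D.Idn_Cmp[OF t(2)] by (simp_all add: t(1))
  qed
qed

text \<open>When structured objects are matched by mutually inverse maps \<open>F\<close> and \<open>G\<close> that change neither the
  underlying object nor which morphisms of \<open>D\<close> are admitted, closure under identities and composition
  is inherited by the other side. It is therefore enough to know that one side is a category.\<close>

lemma isomorphic_structured_cats:
  fixes F G :: "('p, 'b) comod \<Rightarrow> ('p, 'b) comod"
  assumes cat: "category (structured_cat D P' H')"
    and hom: "\<And>M N h. \<lbrakk>P' M; P' N; H' M N h\<rbrakk> \<Longrightarrow> h \<in> hom D (rob M) (rob N)"
    and D: "category D"
    and F: "\<And>M. P M \<Longrightarrow> P' (F M)" "\<And>M. P M \<Longrightarrow> rob (F M) = rob M"
    and G: "\<And>M. P' M \<Longrightarrow> P (G M)" "\<And>M. P' M \<Longrightarrow> rob (G M) = rob M"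
    and GF: "\<And>M. P M \<Longrightarrow> G (F M) = M" and FG: "\<And>M. P' M \<Longrightarrow> F (G M) = M"
    and H: "\<And>M N h. \<lbrakk>P M; P N\<rbrakk> \<Longrightarrow> H M N h \<longleftrightarrow> H' (F M) (F N) h"
  shows "isomorphic_categories (structured_cat D P H) (structured_cat D P' H')"
proof -
  let ?S = "structured_cat D P H" and ?T = "structured_cat D P' H'"
  interpret T: category ?T by fact
  have H_hom: "h \<in> hom D (rob M) (rob N)" if "P M" "P N" "H M N h" for M N h
    using hom[of "F M" "F N" h] F H that by simp
  have T_Idn: "H' M M (\<one>\<^bsub>D\<^esub> rob M)" if "P' M" for M
    using T.Idn_in[of M] that by (simp add: structured_hom)
  have T_Cmp: "H' L N (k \<cdot>\<^bsub>D\<^esub> h)" if "P' L" "P' M" "P' N" "H' L M h" "H' M N k" for L M N h k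
    using T.Cmp_in[of "(L, h, M)" L M "(M, k, N)" N] that by (simp add: structured_hom)
  have S: "category ?S"
  proof (rule structured_category[OF D])
    show "H M M (\<one>\<^bsub>D\<^esub> rob M)" if "P M" for M
      using T_Idn[of "F M"] that F H by simp
    show "H L N (k \<cdot>\<^bsub>D\<^esub> h)" if "P L" "P M" "P N" "H L M h" "H M N k" for L M N h k
      using T_Cmp[of "F L" "F M" "F N" h k] that F(1) H by simp
  qed (rule H_hom)
  have H': "H' M N h \<longleftrightarrow> H (G M) (G N) h" if "P' M" "P' N" for M N h
    using H[of "G M" "G N" h] that G(1) FG by simp
  let ?Fa = "\<lambda>(M, h, N). (F M, h, F N)" and ?Ga = "\<lambda>(M, h, N). (G M, h, G N)"
  have "cat_functor ?S ?T F ?Fa"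
    by (intro cat_functor.intro S cat cat_functor_axioms.intro) (auto simp: structured_hom F H)
  moreover have "cat_functor ?T ?S G ?Ga"
    by (intro cat_functor.intro S cat cat_functor_axioms.intro) (auto simp: structured_hom G H')
  moreover have "\<forall>M \<in> Obj ?S. G (F M) = M" "\<forall>t \<in> Arr ?S. ?Ga (?Fa t) = t"
    "\<forall>M \<in> Obj ?T. F (G M) = M" "\<forall>t \<in> Arr ?T. ?Fa (?Ga t) = t"
    by (auto simp: GF FG)
  ultimately show ?thesis
    unfolding isomorphic_categories_def by blast
qed

context cowreath_action
begin

lemma entwined_category: "category (entwined_cat D C A X \<psi> \<delta> f)"
  unfolding entwined_cat_def
proof (rule structured_category)
  show "category D" by unfold_locales
next
  fix M N h assume "entwined_map D C A X M N h"
  then show "h \<in> hom D (rob M) (rob N)" by (simp add: entwined_map_def right_linear_def)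
next
  fix M assume M: "entwined_module D C A X \<psi> \<delta> f M"
  then show "entwined_map D C A X M M (\<one> rob M)"
    using right_moduleD[of M] by (auto simp: entwined_module_def entwined_map_def right_linear_def hom_def)
next
  fix L M N h k
  assume L: "entwined_module D C A X \<psi> \<delta> f L" and M: "entwined_module D C A X \<psi> \<delta> f M"
    and N: "entwined_module D C A X \<psi> \<delta> f N"
    and h: "entwined_map D C A X L M h" and k: "entwined_map D C A X M N k"
  have eqs: "h \<cdot> ract L = ract M \<cdot> (h \<diamondop> \<one>\<^bsub>C\<^esub> alg A)" "k \<cdot> ract M = ract N \<cdot> (k \<diamondop> \<one>\<^bsub>C\<^esub> alg A)"
    "coact M \<cdot> h = (h \<diamondop> \<one>\<^bsub>C\<^esub> X) \<cdot> coact L" "coact N \<cdot> k = (k \<diamondop> \<one>\<^bsub>C\<^esub> X) \<cdot> coact M"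
    using h k by (auto simp: entwined_map_def right_linear_def)
  have [simp]: "h \<in> Arr D" "Dom D h = rob L" "Cod D h = rob M" "k \<in> Arr D" "Dom D k = rob M" "Cod D k = rob N"
    using h k by (auto simp: entwined_map_def right_linear_def hom_def)
  have mod: "right_module D C A L" "right_module D C A M" "right_module D C A N"
    using L M N by (auto simp: entwined_module_def)
  have [simp]: "coact L \<in> Arr D" "Dom D (coact L) = rob L" "Cod D (coact L) = rob L \<diamondop>\<^sub>o X"
    "coact M \<in> Arr D" "Dom D (coact M) = rob M" "Cod D (coact M) = rob M \<diamondop>\<^sub>o X"
    "coact N \<in> Arr D" "Dom D (coact N) = rob N" "Cod D (coact N) = rob N \<diamondop>\<^sub>o X"
    using L M N by (auto simp: entwined_module_def hom_def)
  note [simp] = mod[THEN right_moduleD(1)] mod[THEN right_moduleD(2)] mod[THEN right_moduleD(3)]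
    mod[THEN right_moduleD(4)]
  show "entwined_map D C A X L N (k \<cdot> h)"
    by (simp add: entwined_map_def right_linear_def hom_def eqs(1,3) reassoc_square[OF eqs(2)]
        reassoc_square[OF eqs(4)])
qed

text \<open>Passing from \<open>coact M\<close> to \<open>contract (mod_part M) \<cdot> coact M\<close> and back.\<close>

lemma corepresentations_isomorphic_entwined_modules:
  "isomorphic_categories (corep_cat D C A K) (entwined_cat D C A X \<psi> \<delta> f)"
  unfolding corep_cat_def entwined_cat_def
proof (rule isomorphic_structured_cats)
  let ?F = "\<lambda>M. M\<lparr>coact := contract (mod_part M) \<cdot> coact M\<rparr>" and ?G = "\<lambda>M. M\<lparr>coact := expand (mod_part M) \<cdot> coact M\<rparr>"
  have mp [simp]: "mod_part (M\<lparr>coact := c\<rparr>) = mod_part M" for M :: "('p, 'b) comod" and c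
    by (simp add: mod_part_def)
  have corepD: "right_module D C A M" "right_module D C A (mod_part M)"
      "contract (mod_part M) \<cdot> coact M \<in> hom D (rob M) (rob M \<diamondop>\<^sub>o X)" "expand (mod_part M) \<cdot> contract (mod_part M) \<cdot> coact M = coact M"
    if "corepresentation D C A K M" for M
  proof -
    show M: "right_module D C A M" and M': "right_module D C A (mod_part M)"
      using that by (simp_all add: corepresentation_def Let_def)
    have c: "coact M \<in> hom D (rob M) (bal_ob D C (mod_part M) (left_part K))"
      using that by (simp add: corepresentation_def Let_def right_linear_def bal_rmod_def)
    note [simp] = homD[OF c] comparison(1-6)[OF M', simplified]
    show "contract (mod_part M) \<cdot> coact M \<in> hom D (rob M) (rob M \<diamondop>\<^sub>o X)"
      by (simp add: hom_def)
    show "expand (mod_part M) \<cdot> contract (mod_part M) \<cdot> coact M = coact M"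
      by (simp add: reassoc[OF comparison(10)[OF M']])
  qed
  have entwD: "right_module D C A M" "coact M \<in> hom D (rob M) (rob M \<diamondop>\<^sub>o X)"
      "contract (mod_part M) \<cdot> expand (mod_part M) \<cdot> coact M = coact M"
    if "entwined_module D C A X \<psi> \<delta> f M" for M
  proof -
    show M: "right_module D C A M" and c: "coact M \<in> hom D (rob M) (rob M \<diamondop>\<^sub>o X)"
      using that by (simp_all add: entwined_module_def)
    have M': "right_module D C A (mod_part M)" using M by simp
    note [simp] = homD[OF c] comparison(1-6)[OF M', simplified]
    show "contract (mod_part M) \<cdot> expand (mod_part M) \<cdot> coact M = coact M"
      by (simp add: reassoc[OF comparison(9)[OF M']])
  qed
  show "category (structured_cat D (entwined_module D C A X \<psi> \<delta> f) (entwined_map D C A X))"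
    using entwined_category by (simp add: entwined_cat_def)
  show "h \<in> hom D (rob M) (rob N)" if "entwined_map D C A X M N h" for M N h
    using that by (simp add: entwined_map_def right_linear_def)
  show "category D" by unfold_locales
  show "entwined_module D C A X \<psi> \<delta> f (?F M)" if "corepresentation D C A K M" for M
    using corepresentation_iff_entwined[OF corepD(3)[OF that] corepD(1)[OF that]] that by (simp add: corepD(4))
  show "corepresentation D C A K (?G M)" if "entwined_module D C A X \<psi> \<delta> f M" for M
    using corepresentation_iff_entwined[OF entwD(2)[OF that] entwD(1)[OF that]] that by simp
  show "?G (?F M) = M" if "corepresentation D C A K M" for M
    by (simp add: corepD(4)[OF that])
  show "?F (?G M) = M" if "entwined_module D C A X \<psi> \<delta> f M" for M
    by (simp add: entwD(3)[OF that])
  show "colinear D C A K M N h \<longleftrightarrow> entwined_map D C A X (?F M) (?F N) h"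
    if "corepresentation D C A K M" "corepresentation D C A K N" for M N h
    using colinear_iff_entwined[OF corepD(1)[OF that(1)] corepD(1)[OF that(2)] corepD(3)[OF that(1)] corepD(3)[OF that(2)]]
    by (simp add: corepD(4)[OF that(1)] corepD(4)[OF that(2)])
qed simp_all

end

theorem theorem4p8:
  fixes C :: "('o, 'a) mcat" and D :: "('p, 'b, 'o, 'a) rcat"
    and A :: "('o, 'a) algebra" and X :: 'o and \<psi> \<delta> f :: 'a
  assumes "strict_monoidal_category C" and "has_coequalizers C"
    and "right_C_category C D" and "has_coequalizers D"
    and "cowreath C A X \<psi> \<delta> f"
    and "coflat D C (alg A)" and "coflat D C X"
    and "left_coflat C (alg A)" and "left_coflat C X"
  shows "compatible_coring D C A (cowreath_coring C A X \<psi> \<delta> f) \<and>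
    isomorphic_categories (corep_cat D C A (cowreath_coring C A X \<psi> \<delta> f))
      (entwined_cat D C A X \<psi> \<delta> f)"
proof -
  interpret W: cowreath C A X \<psi> \<delta> f by fact
  interpret cowreath_action C D A X \<psi> \<delta> f
    by (intro cowreath_action.intro algebra_action.intro algebra_action_axioms.intro
        W.monoidal_algebra_axioms assms)
  show ?thesis
    using K_compatible corepresentations_isomorphic_entwined_modules assms by blast
qed

end
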